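(* Let $G$ be a finite simple graph with edge ideal $I = I(G)$. (1) $I$ has a minimal free resolution supported on its Scarf complex $\mathrm{Scarf}(I)$ if and only if $G$ is a gap-free forest. If moreover $G$ is connected and $t>1$ is an integer, then: (2) $I^t$ has a minimal free resolution supported on its Scarf complex $\mathrm{Scarf}(I^t)$ if and only if $G$ is an isolated vertex, an edge, or a path of length $2$ (i.e. a path with $2$ edges and $3$ vertices).
   Context: Let $\mathsf k$ be an arbitrary field. For a finite simple graph $G$ with vertices $x_1,\dots,x_n$, let $S=\mathsf k[x_1,\dots,x_n]$ (vertices are identified with variables). The edge ideal is $I(G)=(x_ix_j \mid \{x_i,x_j\}\in E(G))\subseteq S$. For a monomial ideal $I$ with minimal monomial generating set $\mathrm{Gens}(I)$, the Taylor complex $\mathrm{Taylor}(I)$ is the full simplex with vertex set $\mathrm{Gens}(I)$: its faces are all subsets $\sigma\subseteq \mathrm{Gens}(I)$, and each face is labeled by $\mathbf m_\sigma=\mathrm{lcm}(u : u\in\sigma)$ (with $\mathbf m_\varnothing=1$). The Scarf complex $\mathrm{Scarf}(I)$ is the subcomplex of $\mathrm{Taylor}(I)$ consisting of all faces whose label is not the label of any other face of $\mathrm{Taylor}(I)$. A subcomplex $\Delta\subseteq \mathrm{Taylor}(I)$ supports a free resolution of $I$ if the homogenized simplicial chain complex of $\Delta$ is a free resolution of $I$. This is the complex of free modules $F_i=\bigoplus_{\sigma\in\Delta,\ \dim\sigma=i} S e_\sigma$, with $e_\sigma$ in multidegree $\mathbf m_\sigma$ and differential $d(e_\sigma)=\sum_{u\in\sigma}\pm\frac{\mathbf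 m_\sigma}{\mathbf m_{\sigma\setminus\{u\}}}e_{\sigma\setminus\{u\}}$ (usual simplicial signs), augmented by $F_0\to I$, $e_{\{u\}}\mapsto u$. When $\mathrm{Scarf}(I)$ supports a free resolution of $I$, that resolution is automatically minimal. The zero ideal is regarded as trivially having such a resolution. A graph $G$ is gap-free if whenever $x_1x_2$ and $y_1y_2$ are edges in the same connected component of $G$, then $x_iy_j$ is an edge of $G$ for some $i,j\in\{1,2\}$. *)

theory Defs
  imports
    "HOL-Library.Poly_Mapping"
    "HOL-Algebra.Ideal_Product"
    "Graph_Theory.Digraph_Component"
begin

section \<open>Polynomial rings and monomials\<close>

text \<open>
  A monomial is identified with its exponent vector, so products of monomials are sums of
  exponent vectors.
\<close>

type_synonym 'v monomial = "'v \<Rightarrow>\<^sub>0 nat"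
type_synonym ('v, 'k) mpoly = "'v monomial \<Rightarrow>\<^sub>0 'k"

text \<open>The ring \<open>k[x\<^sub>v | v \<in> V]\<close>.\<close>

definition poly_ring :: "'v set \<Rightarrow> ('v, 'k::field) mpoly ring" where
  "poly_ring V = \<lparr>carrier = {p. \<forall>m\<in>Poly_Mapping.keys p. Poly_Mapping.keys m \<subseteq> V},
     monoid.mult = (*), one = 1, ring.zero = 0, add = (+)\<rparr>"

definition mpoly_mon :: "'v monomial \<Rightarrow> ('v, 'k::field) mpoly" where
  "mpoly_mon m = Poly_Mapping.single m 1"

text \<open>The empty set of monomials has least common multiple \<open>1\<close>, i.e. the exponent vector \<open>0\<close>.\<close>

definition mlcm :: "'v monomial set \<Rightarrow> 'v monomial" where
  "mlcm \<sigma> = (\<Sum>v\<in>(\<Union>u\<in>\<sigma>. Poly_Mapping.keys u). Poly_Mapping.single v (Max ((\<lambda>u. Poly_Mapping.lookup u v) ` \<sigma>)))"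

lemma lookup_mlcm:
  assumes "finite \<sigma>"
  shows "Poly_Mapping.lookup (mlcm \<sigma>) v = Max (insert 0 ((\<lambda>u. Poly_Mapping.lookup u v) ` \<sigma>))"
proof -
  let ?K = "\<Union>u\<in>\<sigma>. Poly_Mapping.keys u" and ?M = "\<lambda>w. Max ((\<lambda>u. Poly_Mapping.lookup u w) ` \<sigma>)"
  have fin: "finite ?K" using assms by simp
  have "Poly_Mapping.lookup (mlcm \<sigma>) v = (\<Sum>w\<in>?K. if w = v then ?M w else 0)"
    unfolding mlcm_def
    by (simp add: Poly_Mapping.lookup_sum lookup_single when_def cong: if_cong)
  also have "\<dots> = (if v \<in> ?K then ?M v else 0)"
    using fin by (simp add: sum.delta')
  also have "\<dots> = Max (insert 0 ((\<lambda>u. Poly_Mapping.lookup u v) ` \<sigma>))"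
  proof (cases "v \<in> ?K")
    case True
    then have "(\<lambda>u. Poly_Mapping.lookup u v) ` \<sigma> \<noteq> {}" by blast
    then show ?thesis using True assms by simp
  next
    case False
    then have "\<forall>u\<in>\<sigma>. Poly_Mapping.lookup u v = 0" by (auto simp: in_keys_iff)
    then have "insert 0 ((\<lambda>u. Poly_Mapping.lookup u v) ` \<sigma>) = {0}" by auto
    then have "Max (insert 0 ((\<lambda>u. Poly_Mapping.lookup u v) ` \<sigma>)) = 0" by (simp only: Max_singleton)
    then show ?thesis using False by simp
  qed
  finally show ?thesis .
qed


section \<open>Taylor and Scarf complexes\<close>

definition is_min_mon_gens ::
  "'v set \<Rightarrow> ('v, 'k::field) mpoly set \<Rightarrow> 'v monomial set \<Rightarrow> bool" where
  "is_min_mon_gens V I B \<longleftrightarrow>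
     (\<forall>m\<in>B. Poly_Mapping.keys m \<subseteq> V) \<and>
     genideal (poly_ring V) (mpoly_mon ` B) = I \<and>
     (\<forall>B'. B' \<subset> B \<longrightarrow> genideal (poly_ring V) (mpoly_mon ` B') \<noteq> I)"

text \<open>
  \<open>Gens V I\<close> is only meaningful for a monomial ideal \<open>I\<close> of \<open>k[x\<^sub>v | v \<in> V]\<close>; see
  \<open>ex1_min_mon_gens\<close> below.
\<close>

definition Gens :: "'v set \<Rightarrow> ('v, 'k::field) mpoly set \<Rightarrow> 'v monomial set" where
  "Gens V I = (THE B. is_min_mon_gens V I B)"

lemma cring_poly_ring: "cring (poly_ring V :: ('v, 'k::field) mpoly ring)"
proof (rule cringI)
  show "abelian_group (poly_ring V :: ('v, 'k) mpoly ring)"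
  proof (rule abelian_groupI)
    fix x :: "('v, 'k) mpoly" assume "x \<in> carrier (poly_ring V)"
    then show "\<exists>y\<in>carrier (poly_ring V). y \<oplus>\<^bsub>poly_ring V\<^esub> x = \<zero>\<^bsub>poly_ring V\<^esub>"
      by (intro bexI[of _ "- x"]) (auto simp: poly_ring_def)
  next
    fix x y :: "('v, 'k) mpoly"
    assume "x \<in> carrier (poly_ring V)" "y \<in> carrier (poly_ring V)"
    then show "x \<oplus>\<^bsub>poly_ring V\<^esub> y \<in> carrier (poly_ring V)"
      using keys_add[of x y] by (auto simp: poly_ring_def)
  qed (simp_all add: poly_ring_def add_ac)
  show "comm_monoid (poly_ring V :: ('v, 'k) mpoly ring)"
  proof
    fix x y :: "('v, 'k) mpoly"
    assume "x \<in> carrier (poly_ring V)" "y \<in> carrier (poly_ring V)"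
    then show "x \<otimes>\<^bsub>poly_ring V\<^esub> y \<in> carrier (poly_ring V)"
      by (auto simp: poly_ring_def dest!: subsetD[OF keys_mult] subsetD[OF keys_add] dest: subsetD)
  qed (simp_all add: poly_ring_def mult_ac)
qed (simp add: poly_ring_def distrib_right)

lemma poly_mapping_sum_single:
  "(\<Sum>m\<in>Poly_Mapping.keys p. Poly_Mapping.single m (Poly_Mapping.lookup p m)) = p"
proof (rule poly_mapping_eqI)
  fix n
  have "Poly_Mapping.lookup (\<Sum>m\<in>Poly_Mapping.keys p. Poly_Mapping.single m (Poly_Mapping.lookup p m)) n
      = (\<Sum>m\<in>Poly_Mapping.keys p. if m = n then Poly_Mapping.lookup p m else 0)"
    by (simp add: Poly_Mapping.lookup_sum lookup_single when_def cong: if_cong)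
  also have "\<dots> = Poly_Mapping.lookup p n"
    by (simp add: in_keys_iff)
  finally show "Poly_Mapping.lookup (\<Sum>m\<in>Poly_Mapping.keys p.
      Poly_Mapping.single m (Poly_Mapping.lookup p m)) n = Poly_Mapping.lookup p n" .
qed

text \<open>A monomial ideal consists of the polynomials all of whose monomials are multiples of generators.\<close>

lemma genideal_mon:
  fixes A :: "'v monomial set"
  assumes A: "\<And>m. m \<in> A \<Longrightarrow> Poly_Mapping.keys m \<subseteq> V"
  shows "genideal (poly_ring V) (mpoly_mon ` A :: ('v, 'k::field) mpoly set) =
    {p \<in> carrier (poly_ring V). \<forall>m\<in>Poly_Mapping.keys p. \<exists>a\<in>A. \<exists>n. m = n + a}" (is "?I = ?J")
proof
  let ?R = "poly_ring V :: ('v, 'k) mpoly ring"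
  interpret cring ?R by (rule cring_poly_ring)
  have sub: "mpoly_mon ` A \<subseteq> carrier ?R"
    using A by (fastforce simp: mpoly_mon_def poly_ring_def)
  have "ideal ?J ?R"
  proof (rule idealI)
    show "ring ?R" by (rule ring_axioms)
    have inv: "inv\<^bsub>add_monoid ?R\<^esub> x = - x" if "x \<in> carrier ?R" for x
    proof -
      have "- x \<in> carrier ?R" using that by (auto simp: poly_ring_def)
      then have "\<ominus>\<^bsub>?R\<^esub> x = - x"
        using that by (intro minus_equality) (auto simp: poly_ring_def)
      then show ?thesis by (simp add: a_inv_def)
    qed
    show "subgroup ?J (add_monoid ?R)"
    proof
      show "?J \<subseteq> carrier (add_monoid ?R)" by auto
      show "\<one>\<^bsub>add_monoid ?R\<^esub> \<in> ?J" by (auto simp: poly_ring_def)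
      fix x y assume xy: "x \<in> ?J" "y \<in> ?J"
      then have "x \<oplus>\<^bsub>?R\<^esub> y \<in> carrier ?R" by (intro a_closed) auto
      then show "x \<otimes>\<^bsub>add_monoid ?R\<^esub> y \<in> ?J"
        using xy keys_add[of x y] by (auto simp: poly_ring_def)
    next
      fix x assume "x \<in> ?J"
      then show "inv\<^bsub>add_monoid ?R\<^esub> x \<in> ?J"
        by (subst inv) (auto simp: poly_ring_def)
    qed
    fix a x assume a: "a \<in> ?J" and x: "x \<in> carrier ?R"
    have "x \<otimes>\<^bsub>?R\<^esub> a \<in> carrier ?R" using a x by (intro m_closed) auto
    moreover have "\<exists>b\<in>A. \<exists>n. m = n + b" if m: "m \<in> Poly_Mapping.keys (x * a)" for m
    proof -
      obtain p q where pq: "m = p + q" "q \<in> Poly_Mapping.keys a" using m keys_mult[of x a] by blast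
      then obtain b n where "b \<in> A" "q = n + b" using a by blast
      then show ?thesis using pq(1) by (metis add.assoc)
    qed
    ultimately show *: "x \<otimes>\<^bsub>?R\<^esub> a \<in> ?J" by (auto simp: poly_ring_def)
    then show "a \<otimes>\<^bsub>?R\<^esub> x \<in> ?J" using a x by (metis (no_types, lifting) m_comm mem_Collect_eq)
  qed
  moreover have "mpoly_mon ` A \<subseteq> ?J"
    using sub by (auto simp: mpoly_mon_def intro!: bexI exI[of _ 0])
  ultimately show "?I \<subseteq> ?J" by (rule genideal_minimal)
  show "?J \<subseteq> ?I"
  proof
    interpret I: ideal ?I ?R by (rule genideal_ideal[OF sub])
    fix p assume p: "p \<in> ?J"
    have term_in: "Poly_Mapping.single m (Poly_Mapping.lookup p m) \<in> ?I"
      if m: "m \<in> Poly_Mapping.keys p" for m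
    proof -
      obtain a n where an: "a \<in> A" "m = n + a" using p m by blast
      have "Poly_Mapping.keys m \<subseteq> V" using p m by (auto simp: poly_ring_def)
      moreover have "Poly_Mapping.keys n \<subseteq> Poly_Mapping.keys m"
        using an(2) by (auto simp: in_keys_iff lookup_add)
      ultimately have "Poly_Mapping.single n (Poly_Mapping.lookup p m) \<in> carrier ?R"
        by (auto simp: poly_ring_def)
      moreover have "mpoly_mon a \<in> ?I" using genideal_self[OF sub] an(1) by blast
      ultimately have "Poly_Mapping.single n (Poly_Mapping.lookup p m) \<otimes>\<^bsub>?R\<^esub> mpoly_mon a \<in> ?I"
        by (intro I.I_l_closed)
      then show ?thesis by (simp add: poly_ring_def mpoly_mon_def mult_single an(2))
    qed
    have "(\<Sum>m\<in>F. Poly_Mapping.single m (Poly_Mapping.lookup p m)) \<in> ?I"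
      if "finite F" "F \<subseteq> Poly_Mapping.keys p" for F
      using that
    proof (induction F rule: finite_induct)
      case empty
      show ?case using I.zero_closed by (simp add: poly_ring_def)
    next
      case (insert m F)
      then show ?case using I.a_closed[OF term_in[of m]] by (simp add: poly_ring_def)
    qed
    then show "p \<in> ?I" using poly_mapping_sum_single[of p] by (metis finite_keys order_refl)
  qed
qed

lemma ex1_min_mon_gens:
  fixes A :: "'v monomial set"
  assumes A: "\<And>m. m \<in> A \<Longrightarrow> Poly_Mapping.keys m \<subseteq> V"
  shows "\<exists>!B. is_min_mon_gens V (genideal (poly_ring V) (mpoly_mon ` A :: ('v, 'k::field) mpoly set)) B"
proof -
  define le where "le a m \<longleftrightarrow> (\<exists>n. m = n + a)" for a m :: "'v monomial"
  define gen where "gen B = genideal (poly_ring V) (mpoly_mon ` B :: ('v, 'k) mpoly set)" for B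
  have le_refl: "le m m" for m unfolding le_def by (rule exI[of _ 0]) simp
  have le_trans: "le a c" if "le a b" "le b c" for a b c
    using that unfolding le_def by (metis add.assoc)
  have le_lookup: "Poly_Mapping.lookup a v \<le> Poly_Mapping.lookup m v" if "le a m" for a m v
    using that unfolding le_def by (auto simp: lookup_add)
  have antisym: "a = m" if "le a m" "le m a" for a m
    using le_lookup[OF that(1)] le_lookup[OF that(2)] by (auto intro!: poly_mapping_eqI le_antisym)
  have mon_in_gen: "mpoly_mon m \<in> gen B \<longleftrightarrow> Poly_Mapping.keys m \<subseteq> V \<and> (\<exists>b\<in>B. le b m)"
    if "\<forall>b\<in>B. Poly_Mapping.keys b \<subseteq> V" for B m
    unfolding gen_def le_def using that
    by (subst genideal_mon) (auto simp: mpoly_mon_def poly_ring_def)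
  have gen_eqI: "gen B = gen C"
    if "\<forall>b\<in>B. Poly_Mapping.keys b \<subseteq> V" "\<forall>c\<in>C. Poly_Mapping.keys c \<subseteq> V"
      "\<forall>b\<in>B. \<exists>c\<in>C. le c b" "\<forall>c\<in>C. \<exists>b\<in>B. le b c" for B C
  proof -
    have "(\<exists>b\<in>B. le b m) \<longleftrightarrow> (\<exists>c\<in>C. le c m)" for m
      using that(3,4) le_trans by blast
    then show ?thesis
      using that(1,2) unfolding gen_def le_def by (subst (1 2) genideal_mon) auto
  qed
  define M where "M = {a \<in> A. \<forall>b\<in>A. le b a \<longrightarrow> b = a}"
  have ex_min: "\<exists>b\<in>M. le b a" if a: "a \<in> A" for a
  proof -
    define d where "d m = (\<Sum>v\<in>Poly_Mapping.keys a. Poly_Mapping.lookup m v)" for m :: "'v monomial"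
    obtain b where b: "b \<in> A" "le b a" and least: "\<And>c. c \<in> A \<Longrightarrow> le c a \<Longrightarrow> d b \<le> d c"
      using ex_has_least_nat[of "\<lambda>b. b \<in> A \<and> le b a" a d] a le_refl by blast
    have "c = b" if c: "c \<in> A" "le c b" for c
    proof -
      have ca: "le c a" using le_trans[OF c(2) b(2)] .
      have "\<forall>v\<in>Poly_Mapping.keys a. Poly_Mapping.lookup c v = Poly_Mapping.lookup b v"
      proof (rule ccontr)
        assume "\<not> ?thesis"
        then have "\<exists>v\<in>Poly_Mapping.keys a. Poly_Mapping.lookup c v < Poly_Mapping.lookup b v"
          using le_lookup[OF c(2)] by (meson order_le_neq_trans)
        then have "d c < d b"
          unfolding d_def using le_lookup[OF c(2)] by (intro sum_strict_mono_ex1) auto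
        then show False using least[OF c(1) ca] by simp
      qed
      moreover have "Poly_Mapping.lookup c v = Poly_Mapping.lookup b v" if "v \<notin> Poly_Mapping.keys a" for v
        using that le_lookup[OF ca, of v] le_lookup[OF b(2), of v] by (simp add: in_keys_iff)
      ultimately show ?thesis by (intro poly_mapping_eqI) blast
    qed
    then show ?thesis using b unfolding M_def by blast
  qed
  have M_V: "\<forall>m\<in>M. Poly_Mapping.keys m \<subseteq> V" and A_V: "\<forall>m\<in>A. Poly_Mapping.keys m \<subseteq> V"
    using A unfolding M_def by blast+
  have gen_M: "gen M = gen A"
    by (rule gen_eqI[OF M_V A_V]) (use ex_min le_refl in \<open>auto simp: M_def\<close>)
  have in_M: "M \<subseteq> B" if B: "\<forall>b\<in>B. Poly_Mapping.keys b \<subseteq> V" "gen B = gen A" for B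
  proof
    fix m assume m: "m \<in> M"
    then have "mpoly_mon m \<in> gen B" using mon_in_gen[OF A_V] le_refl A_V B(2) unfolding M_def by blast
    then obtain b where b: "b \<in> B" "le b m" using mon_in_gen[OF B(1)] by blast
    then have "mpoly_mon b \<in> gen A" using mon_in_gen[OF B(1)] B le_refl by blast
    then obtain a where a: "a \<in> A" "le a b" using mon_in_gen[OF A_V] by blast
    then have "a = m" using m le_trans b(2) unfolding M_def by blast
    then show "m \<in> B" using a b antisym by blast
  qed
  show ?thesis
  proof (rule ex1I[of _ M])
    show "is_min_mon_gens V (genideal (poly_ring V) (mpoly_mon ` A :: ('v, 'k) mpoly set)) M"
      unfolding is_min_mon_gens_def gen_def[symmetric] using M_V gen_M in_M by blast
  next
    fix B assume "is_min_mon_gens V (genideal (poly_ring V) (mpoly_mon ` A :: ('v, 'k) mpoly set)) B"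
    then have B: "\<forall>b\<in>B. Poly_Mapping.keys b \<subseteq> V" "gen B = gen A" "\<forall>C. C \<subset> B \<longrightarrow> gen C \<noteq> gen A"
      unfolding is_min_mon_gens_def gen_def[symmetric] by auto
    then show "B = M" using in_M[OF B(1,2)] gen_M by blast
  qed
qed

definition taylor :: "'v set \<Rightarrow> ('v, 'k::field) mpoly set \<Rightarrow> 'v monomial set set" where
  "taylor V I = Pow (Gens V I)"

definition scarf :: "'v set \<Rightarrow> ('v, 'k::field) mpoly set \<Rightarrow> 'v monomial set set" where
  "scarf V I = {\<sigma> \<in> taylor V I. \<forall>\<tau>\<in>taylor V I. \<tau> \<noteq> \<sigma> \<longrightarrow> mlcm \<tau> \<noteq> mlcm \<sigma>}"

definition is_subcomplex :: "'v monomial set set \<Rightarrow> 'v monomial set set \<Rightarrow> bool" where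
  "is_subcomplex \<Delta> \<Gamma> \<longleftrightarrow> \<Delta> \<subseteq> \<Gamma> \<and> (\<forall>\<sigma>\<in>\<Delta>. Pow \<sigma> \<subseteq> \<Delta>)"


section \<open>The homogenized simplicial chain complex\<close>

text \<open>
  An element of the free module with basis \<open>e\<^sub>\<sigma>\<close> (\<open>\<sigma> \<in> \<Delta>\<close>, \<open>dim \<sigma> = i\<close>, i.e. \<open>card \<sigma> = i + 1\<close>) is
  represented by its coefficient function, extended by \<open>0\<close> to all other sets of monomials.
\<close>

definition chains ::
  "'v set \<Rightarrow> 'v monomial set set \<Rightarrow> nat \<Rightarrow> ('v monomial set \<Rightarrow> ('v, 'k::field) mpoly) set" where
  "chains V \<Delta> i = {c. (\<forall>\<sigma>. c \<sigma> \<in> carrier (poly_ring V)) \<and>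
                     (\<forall>\<sigma>. c \<sigma> \<noteq> 0 \<longrightarrow> \<sigma> \<in> \<Delta> \<and> card \<sigma> = i + 1)}"

text \<open>
  The sign of the facet \<open>\<sigma> - {u}\<close> of \<open>\<sigma>\<close> is \<open>(-1)\<^sup>j\<close>, where \<open>j\<close> is the position of \<open>u\<close> in \<open>\<sigma>\<close>
  with respect to the (lexicographic) linear order on monomials induced by the order of the
  variables. The difference of exponent vectors is the quotient of the labels.
\<close>

definition boundary ::
  "'v::linorder monomial set set \<Rightarrow> ('v monomial set \<Rightarrow> ('v, 'k::field) mpoly) \<Rightarrow>
     'v monomial set \<Rightarrow> ('v, 'k) mpoly" where
  "boundary \<Delta> c \<tau> =
     (\<Sum>\<sigma>\<in>\<Delta>. \<Sum>u\<in>\<sigma>. if \<sigma> - {u} = \<tau>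
        then (-1) ^ card {w \<in> \<sigma>. w < u} * mpoly_mon (mlcm \<sigma> - mlcm (\<sigma> - {u})) * c \<sigma> else 0)"

definition augmentation ::
  "'v monomial set set \<Rightarrow> ('v monomial set \<Rightarrow> ('v, 'k::field) mpoly) \<Rightarrow> ('v, 'k) mpoly" where
  "augmentation \<Delta> c = (\<Sum>u\<in>{u. {u} \<in> \<Delta>}. c {u} * mpoly_mon u)"

definition supports_free_resolution ::
  "'v::linorder set \<Rightarrow> 'v monomial set set \<Rightarrow> ('v, 'k::field) mpoly set \<Rightarrow> bool" where
  "supports_free_resolution V \<Delta> I \<longleftrightarrow>
     is_subcomplex \<Delta> (taylor V I) \<and>
     (let F = chains V \<Delta> :: nat \<Rightarrow> ('v monomial set \<Rightarrow> ('v, 'k) mpoly) set in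
        augmentation \<Delta> ` F 0 = I \<and>
        {c \<in> F 0. augmentation \<Delta> c = 0} = boundary \<Delta> ` F 1 \<and>
        (\<forall>i. {c \<in> F (i + 1). boundary \<Delta> c = (\<lambda>_. 0)} = boundary \<Delta> ` F (i + 2)))"

text \<open>Minimality: the differentials map into the maximal ideal \<open>(x\<^sub>v | v \<in> V)\<close> times the target.\<close>

definition supports_minimal_free_resolution ::
  "'v::linorder set \<Rightarrow> 'v monomial set set \<Rightarrow> ('v, 'k::field) mpoly set \<Rightarrow> bool" where
  "supports_minimal_free_resolution V \<Delta> I \<longleftrightarrow>
     supports_free_resolution V \<Delta> I \<and>
     (\<forall>i. \<forall>c \<in> chains V \<Delta> (i + 1). \<forall>\<tau>.
        (boundary \<Delta> c \<tau> :: ('v, 'k) mpoly) \<in>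
          genideal (poly_ring V) {mpoly_mon (Poly_Mapping.single v 1) | v. v \<in> V})"


section \<open>Graphs and edge ideals\<close>

text \<open>
  A finite simple graph is a \<open>pair_graph\<close> \<open>G\<close>: each edge \<open>{u, v}\<close> is represented by the two arcs
  \<open>(u, v)\<close> and \<open>(v, u)\<close>. The predicate \<open>Digraph_Component.forest\<close> is not suitable for such graphs,
  since it regards \<open>u, v, u\<close> as a cycle; cycles of undirected graphs have length at least \<open>3\<close>.
\<close>

definition undirected_forest :: "'v pair_pre_digraph \<Rightarrow> bool" where
  "undirected_forest G \<longleftrightarrow> \<not> (\<exists>p. pre_digraph.cycle (with_proj G) p \<and> 3 \<le> length p)"

text \<open>Two edges are in the same connected component iff one end of each are.\<close>

definition gap_free :: "'v pair_pre_digraph \<Rightarrow> bool" where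
  "gap_free G \<longleftrightarrow>
     (\<forall>x1 x2 y1 y2. (x1, x2) \<in> parcs G \<and> (y1, y2) \<in> parcs G \<and> reachable (with_proj G) x1 y1 \<longrightarrow>
        (\<exists>x\<in>{x1, x2}. \<exists>y\<in>{y1, y2}. (x, y) \<in> parcs G))"

definition is_isolated_vertex :: "'v pair_pre_digraph \<Rightarrow> bool" where
  "is_isolated_vertex G \<longleftrightarrow> (\<exists>a. pverts G = {a} \<and> parcs G = {})"

definition is_edge :: "'v pair_pre_digraph \<Rightarrow> bool" where
  "is_edge G \<longleftrightarrow> (\<exists>a b. a \<noteq> b \<and> pverts G = {a, b} \<and> parcs G = {(a, b), (b, a)})"

definition is_path2 :: "'v pair_pre_digraph \<Rightarrow> bool" where
  "is_path2 G \<longleftrightarrow> (\<exists>a b c. distinct [a, b, c] \<and> pverts G = {a, b, c} \<and>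
     parcs G = {(a, b), (b, a), (b, c), (c, b)})"

definition edge_ideal :: "'v pair_pre_digraph \<Rightarrow> ('v, 'k::field) mpoly set" where
  "edge_ideal G = genideal (poly_ring (pverts G))
     {mpoly_mon (Poly_Mapping.single u 1) * mpoly_mon (Poly_Mapping.single v 1) | u v. (u, v) \<in> parcs G}"

text \<open>
  \<open>ideals_set R\<close> is the semiring of ideals of \<open>R\<close>, whose multiplication is the ideal product, so
  its powers are the usual powers of ideals.
\<close>

definition ideal_power :: "'v set \<Rightarrow> ('v, 'k::field) mpoly set \<Rightarrow> nat \<Rightarrow> ('v, 'k) mpoly set" where
  "ideal_power V I t = I [^]\<^bsub>ideals_set (poly_ring V)\<^esub> t"

end

theory Submission
  imports Defs
begin

text \<open>
  A multigraded complex is exact as soon as it is exact in every multidegree.  In multidegree \<open>m\<close>, the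
  homogenized chain complex of a simplicial complex \<open>\<Delta>\<close> of monomials is the augmented simplicial
  chain complex, over the field, of the subcomplex \<open>\<Delta>\<^sub>m\<close> of those faces whose label divides \<open>m\<close>.
  Thus \<open>\<Delta>\<close> supports a free resolution of a monomial ideal \<open>I\<close> if \<open>\<Delta>\<^sub>m\<close> is acyclic for every
  monomial \<open>m\<close> in \<open>I\<close> (\<open>supports_resolution_if_acyclic\<close>), and conversely a resolution makes every
  \<open>\<Delta>\<^sub>m\<close> exact in dimension at least \<open>0\<close> (\<open>resolution_strand_exact\<close>).  This turns the theorem into combinatorics, because
  Scarf faces have a divisibility description: a set \<open>\<sigma>\<close> of generators is a Scarf face iff no
  generator \<open>u\<close> divides \<open>lcm (\<sigma> - {u})\<close> (\<open>scarf_eq_scarf_faces\<close>).  In particular a Scarf resolution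
  is always minimal.

  Acyclicity is shown with two homotopies: a cone is acyclic, and a vertex \<open>v\<close> may be deleted if every
  face through \<open>v\<close> can be enlarged by a fixed vertex \<open>u \<noteq> v\<close>.  Non-acyclicity is detected in low
  dimension: either \<open>\<Delta>\<^sub>m\<close> has an isolated vertex without being a point, or it contains a circuit
  through an edge that lies in no 2-face.

  First powers.  If the Scarf complex resolves the edge ideal, a suitable \<open>m\<close> excludes each of the
  following: triangles (three isolated points), 4-cycles and 5-cycles (unfilled circuits), and paths
  \<open>a - b - c - d - e\<close> whose end edges form a gap (an unfilled 4-circuit).  The last exclusion makes the
  graph gap-free, by induction along a path joining two edges.  A gap-free graph has no chordless cycle
  of length 6 or more, so no cycle at all remains.  Conversely, let \<open>G\<close> be a gap-free forest and let
  \<open>m\<close> be divisible by an edge.  Among the edges of one component that divide \<open>m\<close>, some edge \<open>e\<close> meets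
  all others (\<open>dominating_edge\<close>: take an edge meeting as many as possible), and \<open>\<Delta>\<^sub>m\<close> is a cone
  with apex \<open>e\<close>.

  Higher powers.  For \<open>t \<ge> 2\<close> triangles remain obstructions, and now so do three edges at a vertex and
  paths with three edges.  A connected graph without these has at most two edges.  Conversely,
  the \<open>t\<close>-th power is zero or principal for a vertex or an edge, and for the path \<open>a - b - c\<close> it is
  \<open>b\<^sup>t (a, c)\<^sup>t\<close>, whose Scarf complex is a path on the generators \<open>a\<^sup>i b\<^sup>t c\<^sup>t\<^sup>-\<^sup>i\<close>; its restriction
  to any \<open>m\<close> is a subpath, hence collapsible.
\<close>

section \<open>Simplicial chains over a field\<close>

definition face_sign :: "'a::linorder \<Rightarrow> 'a set \<Rightarrow> 'k::field" where
  "face_sign u \<tau> = (-1) ^ card {w \<in> \<tau>. w < u}"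

text \<open>
  The index \<open>j\<close> counts vertices, so it exceeds the dimension by one and the empty face is the unique
  face of index \<open>0\<close>.  Chains are extended by \<open>0\<close>, which lets one boundary operator serve all complexes
  on a given vertex set.
\<close>

definition scalar_chains :: "'a set set \<Rightarrow> nat \<Rightarrow> ('a set \<Rightarrow> 'k::field) set" where
  "scalar_chains K j = {c. \<forall>\<sigma>. c \<sigma> \<noteq> 0 \<longrightarrow> \<sigma> \<in> K \<and> card \<sigma> = j}"

text \<open>
  The augmented simplicial boundary of the full simplex on \<open>X\<close>: its value at the empty face is the
  augmentation.
\<close>

definition scalar_boundary :: "'a::linorder set \<Rightarrow> ('a set \<Rightarrow> 'k::field) \<Rightarrow> 'a set \<Rightarrow> 'k" where
  "scalar_boundary X c \<tau> = (\<Sum>u\<in>X - \<tau>. face_sign u \<tau> * c (insert u \<tau>))"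

text \<open>
  Exterior multiplication by the vertex \<open>u\<close> from the left.
\<close>

definition wedge :: "'a::linorder \<Rightarrow> ('a set \<Rightarrow> 'k::field) \<Rightarrow> 'a set \<Rightarrow> 'k" where
  "wedge u c \<sigma> = (if u \<in> \<sigma> then face_sign u (\<sigma> - {u}) * c (\<sigma> - {u}) else 0)"

text \<open>
  Vanishing of all reduced homology, including degree \<open>-1\<close>: for \<open>j = 0\<close> the condition forces a complex
  containing the empty face to have a vertex.  The type argument names the coefficient field.
\<close>

definition acyclic_complex :: "'k::field itself \<Rightarrow> 'a::linorder set \<Rightarrow> 'a set set \<Rightarrow> bool" where
  "acyclic_complex _ X K \<longleftrightarrow>
     (\<forall>j. \<forall>c \<in> scalar_chains K j. scalar_boundary X c = (\<lambda>_. 0 :: 'k) \<longrightarrow> (\<exists>d \<in> scalar_chains K (Suc j). scalar_boundary X d = c))"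

lemma face_sign_square [simp]: "face_sign u \<tau> * face_sign u \<tau> = (1 :: 'k::field)"
  by (cases "even (card {w \<in> \<tau>. w < u})") (simp_all add: face_sign_def)

lemma face_sign_insert:
  assumes "finite \<tau>" "w \<notin> \<tau>"
  shows "face_sign u (insert w \<tau>) = (if w < u then - face_sign u \<tau> else face_sign u \<tau> :: 'k::field)"
proof -
  have "{x \<in> insert w \<tau>. x < u} = (if w < u then insert w {x \<in> \<tau>. x < u} else {x \<in> \<tau>. x < u})"
    by auto
  then show ?thesis using assms by (simp add: face_sign_def)
qed

text \<open>
  Passing \<open>u\<close> and \<open>w\<close> through each other reverses the sign, since exactly one of them precedes the other.
  The two lemmas below state this in the forms needed for the homotopy formula and for
  \<open>\<partial>\<^sup>2 = 0\<close>.
\<close>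

lemma face_sign_swap:
  assumes "finite \<tau>" "u \<noteq> w" "u \<notin> \<tau>" "w \<notin> \<tau>"
  shows "face_sign w (insert u \<tau>) * face_sign u (insert w \<tau>) =
    - (face_sign u \<tau> * face_sign w \<tau> :: 'k::field)"
  using assms by (cases u w rule: linorder_cases) (auto simp: face_sign_insert dest: order.asym)

lemma face_sign_commute:
  assumes "finite \<tau>" "u \<noteq> w" "u \<notin> \<tau>" "w \<notin> \<tau>"
  shows "face_sign u \<tau> * face_sign w (insert u \<tau>) =
    - (face_sign w \<tau> * face_sign u (insert w \<tau>) :: 'k::field)"
  using assms by (cases u w rule: linorder_cases) (auto simp: face_sign_insert dest: order.asym)

lemma scalar_chains_outside: "c \<in> scalar_chains K j \<Longrightarrow> \<sigma> \<notin> K \<Longrightarrow> c \<sigma> = 0"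
  by (auto simp: scalar_chains_def)

lemma scalar_boundary_outside:
  assumes "c \<in> scalar_chains K j" "\<And>\<sigma>. \<sigma> \<in> K \<Longrightarrow> \<sigma> \<subseteq> X" "\<not> \<tau> \<subseteq> X"
  shows "scalar_boundary X c \<tau> = 0"
  unfolding scalar_boundary_def
proof (rule sum.neutral, rule ballI)
  fix u assume "u \<in> X - \<tau>"
  have "insert u \<tau> \<notin> K" using assms(2,3) by blast
  then show "face_sign u \<tau> * c (insert u \<tau>) = 0" using scalar_chains_outside[OF assms(1)] by simp
qed

lemma scalar_boundary_scalar_chains:
  assumes "c \<in> scalar_chains K (Suc j)" "finite X" "\<And>\<sigma>. \<sigma> \<in> K \<Longrightarrow> \<sigma> \<subseteq> X"
    "\<And>\<sigma> \<tau>. \<sigma> \<in> K \<Longrightarrow> \<tau> \<subseteq> \<sigma> \<Longrightarrow> \<tau> \<in> K"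
  shows "scalar_boundary X c \<in> scalar_chains K j"
  unfolding scalar_chains_def
proof (intro CollectI allI impI)
  fix \<tau> assume "scalar_boundary X c \<tau> \<noteq> 0"
  then obtain u where u: "u \<in> X - \<tau>" "c (insert u \<tau>) \<noteq> 0"
    unfolding scalar_boundary_def by (metis (no_types, lifting) mult_zero_right sum.neutral)
  then have "insert u \<tau> \<in> K" "card (insert u \<tau>) = Suc j" using assms(1) by (auto simp: scalar_chains_def)
  moreover have "finite \<tau>" using calculation(1) assms(2,3) by (meson finite_insert finite_subset)
  ultimately show "\<tau> \<in> K \<and> card \<tau> = j" using u(1) assms(4)[OF _ subset_insertI] by auto
qed

lemma scalar_boundary_diff: "scalar_boundary X (\<lambda>\<sigma>. c \<sigma> - d \<sigma>) \<tau> = scalar_boundary X c \<tau> - scalar_boundary X d \<tau>"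
  by (simp add: scalar_boundary_def right_diff_distrib sum_subtractf)

lemma scalar_boundary_add: "scalar_boundary X (\<lambda>\<sigma>. c \<sigma> + d \<sigma>) \<tau> = scalar_boundary X c \<tau> + scalar_boundary X d \<tau>"
  by (simp add: scalar_boundary_def distrib_left sum.distrib)

lemma sum_antisym_eq_0:
  fixes f :: "'a \<Rightarrow> 'a \<Rightarrow> 'b::ab_group_add"
  assumes "finite A" "\<And>u w. u \<in> A \<Longrightarrow> w \<in> A \<Longrightarrow> u \<noteq> w \<Longrightarrow> f u w = - f w u"
  shows "(\<Sum>u\<in>A. \<Sum>w\<in>A - {u}. f u w) = 0"
  using assms
proof (induction A rule: finite_induct)
  case (insert x A)
  have *: "(\<Sum>w\<in>insert x A - {u}. f u w) = f u x + (\<Sum>w\<in>A - {u}. f u w)" if "u \<in> A" for u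
  proof -
    have "insert x A - {u} = insert x (A - {u})" using insert.hyps that by auto
    then show ?thesis using insert.hyps by simp
  qed
  have "(\<Sum>u\<in>insert x A. \<Sum>w\<in>insert x A - {u}. f u w) =
      (\<Sum>w\<in>insert x A - {x}. f x w) + (\<Sum>u\<in>A. \<Sum>w\<in>insert x A - {u}. f u w)"
    using insert.hyps by (intro sum.insert)
  also have "\<dots> = (\<Sum>w\<in>A. f x w) + (\<Sum>u\<in>A. f u x + (\<Sum>w\<in>A - {u}. f u w))"
    using insert.hyps by (intro arg_cong2[of _ _ _ _ "(+)"] sum.cong *) auto
  also have "\<dots> = (\<Sum>w\<in>A. f x w + f w x)"
    using insert.IH[OF insert.prems] by (simp add: sum.distrib)
  also have "\<dots> = 0"
  proof (rule sum.neutral, rule ballI)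
    fix w assume "w \<in> A"
    then have "f x w = - f w x" using insert.hyps by (intro insert.prems) auto
    then show "f x w + f w x = 0" by (simp only: left_minus)
  qed
  finally show ?case .
qed simp

lemma scalar_boundary_sdiff:
  assumes "c \<in> scalar_chains K j" "finite X" "\<And>\<sigma>. \<sigma> \<in> K \<Longrightarrow> \<sigma> \<subseteq> X"
  shows "scalar_boundary X (scalar_boundary X c) \<tau> = (0 :: 'k::field)"
proof (cases "\<tau> \<subseteq> X")
  case True
  have "scalar_boundary X (scalar_boundary X c) \<tau> = (\<Sum>u\<in>X - \<tau>. \<Sum>w\<in>(X - \<tau>) - {u}.
      face_sign u \<tau> * (face_sign w (insert u \<tau>) * c (insert u (insert w \<tau>))))"
    unfolding scalar_boundary_def sum_distrib_left
    by (intro sum.cong) (auto simp: insert_commute)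
  also have "\<dots> = 0"
  proof (rule sum_antisym_eq_0)
    fix u w assume *: "u \<in> X - \<tau>" "w \<in> X - \<tau>" "u \<noteq> w"
    have "finite \<tau>" using True assms(2) finite_subset by blast
    from face_sign_commute[OF this, of u w, where 'k='k] *
    show "face_sign u \<tau> * (face_sign w (insert u \<tau>) * c (insert u (insert w \<tau>))) =
      - (face_sign w \<tau> * (face_sign u (insert w \<tau>) * c (insert w (insert u \<tau>))))"
      by (simp add: insert_commute flip: mult.assoc)
  qed (use assms(2) in simp)
  finally show ?thesis .
next
  case False
  have "scalar_boundary X c (insert u \<tau>) = 0" for u
    by (rule scalar_boundary_outside[OF assms(1,3)]) (use False in auto)
  then show ?thesis by (simp add: scalar_boundary_def[of X "scalar_boundary X c"])
qed

text \<open>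
  The Leibniz rule \<open>\<partial>(u \<and> c) = c - u \<and> \<partial>c\<close>.  Both acyclicity criteria below are instances of it.
\<close>

lemma scalar_boundary_wedge:
  assumes "c \<in> scalar_chains K j" "finite X" "\<And>\<sigma>. \<sigma> \<in> K \<Longrightarrow> \<sigma> \<subseteq> X" "u \<in> X"
  shows "scalar_boundary X (wedge u c) \<tau> = c \<tau> - (wedge u (scalar_boundary X c) \<tau> :: 'k::field)"
proof (cases "\<tau> \<subseteq> X")
  case False
  have "wedge u c (insert w \<tau>) = 0" if "w \<in> X" for w
  proof -
    have "insert w \<tau> - {u} \<notin> K" using False that assms(3,4) by blast
    then show ?thesis using scalar_chains_outside[OF assms(1)] by (simp add: wedge_def)
  qed
  moreover have "wedge u (scalar_boundary X c) \<tau> = 0"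
    unfolding wedge_def using scalar_boundary_outside[OF assms(1,3), of "\<tau> - {u}"] False assms(4) by auto
  moreover have "c \<tau> = 0" using scalar_chains_outside[OF assms(1)] assms(3) False by blast
  ultimately show ?thesis by (simp add: scalar_boundary_def[of X "wedge u c"])
next
  case True
  then have fin: "finite \<tau>" using assms(2) finite_subset by blast
  show ?thesis
  proof (cases "u \<in> \<tau>")
    case False
    have "scalar_boundary X (wedge u c) \<tau> = (\<Sum>w\<in>X - \<tau>. if w = u then c \<tau> else 0)"
      unfolding scalar_boundary_def wedge_def using False
      by (intro sum.cong) (auto simp flip: mult.assoc)
    then show ?thesis using False assms(2,4) by (simp add: wedge_def)
  next
    case True
    define \<rho> where "\<rho> = \<tau> - {u}"
    have \<tau>: "\<tau> = insert u \<rho>" and u: "u \<notin> \<rho>" and fin: "finite \<rho>"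
      using True fin by (auto simp: \<rho>_def)
    \<comment> \<open>The terms \<open>w \<noteq> u\<close> of both sides; they have opposite signs by \<open>face_sign_swap\<close>, and the
      term \<open>w = u\<close> on the right cancels \<open>c \<tau>\<close>.\<close>
    let ?s = "\<Sum>w\<in>X - \<tau>. face_sign u \<rho> * face_sign w \<rho> * c (insert w \<rho>)"
    have "face_sign w \<tau> * wedge u c (insert w \<tau>) = - (face_sign u \<rho> * face_sign w \<rho> * c (insert w \<rho>))"
      if "w \<in> X - \<tau>" for w
    proof -
      have "w \<noteq> u" "w \<notin> \<rho>" using that \<tau> by auto
      then have "insert w \<tau> - {u} = insert w \<rho>" using u by (auto simp: \<tau>)
      then show ?thesis
        using face_sign_swap[OF fin, of u w, where 'k='k] u \<open>w \<noteq> u\<close> \<open>w \<notin> \<rho>\<close>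
        by (simp add: wedge_def \<tau> flip: mult.assoc)
    qed
    then have "scalar_boundary X (wedge u c) \<tau> = - ?s"
      unfolding scalar_boundary_def by (simp add: sum_negf)
    moreover have "wedge u (scalar_boundary X c) \<tau> = c \<tau> + ?s"
    proof -
      have "X - \<rho> = insert u (X - \<tau>)" using \<tau> u assms(4) by auto
      then have "scalar_boundary X c \<rho> = face_sign u \<rho> * c \<tau> + (\<Sum>w\<in>X - \<tau>. face_sign w \<rho> * c (insert w \<rho>))"
        using True assms(2) by (simp add: scalar_boundary_def \<tau>[symmetric])
      then have "face_sign u \<rho> * scalar_boundary X c \<rho> = c \<tau> + ?s"
        by (simp add: distrib_left sum_distrib_left flip: mult.assoc)
      then show ?thesis using True by (simp add: wedge_def \<rho>_def)
    qed
    ultimately show ?thesis by simp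
  qed
qed

text \<open>
  If \<open>\<partial>c = 0\<close>, the Leibniz rule gives \<open>c = \<partial>(u \<and> c)\<close>, and \<open>u \<and> c\<close> is again supported on the cone.
\<close>

lemma cone_acyclic:
  assumes "finite X" "\<And>\<sigma>. \<sigma> \<in> K \<Longrightarrow> \<sigma> \<subseteq> X" "u \<in> X" "\<And>\<sigma>. \<sigma> \<in> K \<Longrightarrow> insert u \<sigma> \<in> K"
  shows "acyclic_complex TYPE('k::field) X K"
  unfolding acyclic_complex_def
proof (intro allI ballI impI)
  fix j and c :: "'a set \<Rightarrow> 'k" assume c: "c \<in> scalar_chains K j" "scalar_boundary X c = (\<lambda>_. 0)"
  have "wedge u c \<in> scalar_chains K (Suc j)"
    unfolding scalar_chains_def
  proof (intro CollectI allI impI)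
    fix \<sigma> assume "wedge u c \<sigma> \<noteq> 0"
    then have u: "u \<in> \<sigma>" "c (\<sigma> - {u}) \<noteq> 0" by (auto simp: wedge_def split: if_splits)
    then have "\<sigma> - {u} \<in> K" "card (\<sigma> - {u}) = j" using c(1) by (auto simp: scalar_chains_def)
    moreover have "insert u (\<sigma> - {u}) = \<sigma>" "finite (\<sigma> - {u})"
      using u(1) calculation(1) assms(1,2) finite_subset by blast+
    ultimately show "\<sigma> \<in> K \<and> card \<sigma> = Suc j"
      using assms(4)[of "\<sigma> - {u}"] card.insert_remove[of "\<sigma> - {u}" u] by auto
  qed
  moreover have "scalar_boundary X (wedge u c) = c"
    by (rule ext) (simp add: scalar_boundary_wedge[OF c(1) assms(1,2,3)] c(2) wedge_def)
  ultimately show "\<exists>d\<in>scalar_chains K (Suc j). scalar_boundary X d = c" by blast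
qed

text \<open>
  Deleting a dominated vertex (an elementary strong collapse).  Let \<open>c\<^sub>v\<close> be the part of a cycle \<open>c\<close>
  supported on the faces through \<open>v\<close>.  Then \<open>u \<and> c\<^sub>v\<close> is supported on the complex by domination, and
  by the Leibniz rule \<open>c - \<partial>(u \<and> c\<^sub>v)\<close> no longer involves \<open>v\<close>: a face of it through \<open>v\<close> could only come from
  \<open>u \<and> \<partial>c\<^sub>v\<close>, but \<open>\<partial>c\<^sub>v\<close> agrees with \<open>\<partial>c = 0\<close> on faces through \<open>v\<close>.
\<close>

lemma dominated_acyclic:
  assumes "finite X" "\<And>\<sigma>. \<sigma> \<in> K \<Longrightarrow> \<sigma> \<subseteq> X" "\<And>\<sigma> \<tau>. \<sigma> \<in> K \<Longrightarrow> \<tau> \<subseteq> \<sigma> \<Longrightarrow> \<tau> \<in> K"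
    and "u \<in> X" "u \<noteq> v" and dom: "\<And>\<sigma>. \<sigma> \<in> K \<Longrightarrow> v \<in> \<sigma> \<Longrightarrow> insert u \<sigma> \<in> K"
    and del: "acyclic_complex TYPE('k::field) X {\<sigma> \<in> K. v \<notin> \<sigma>}"
  shows "acyclic_complex TYPE('k) X K"
  unfolding acyclic_complex_def
proof (intro allI ballI impI)
  fix j and c :: "'a set \<Rightarrow> 'k" assume c: "c \<in> scalar_chains K j" "scalar_boundary X c = (\<lambda>_. 0)"
  define cv where "cv \<sigma> = (if v \<in> \<sigma> then c \<sigma> else 0)" for \<sigma>
  have cv: "cv \<in> scalar_chains K j" using c(1) by (auto simp: scalar_chains_def cv_def)
  define d where "d = wedge u cv"
  have d: "d \<in> scalar_chains K (Suc j)"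
    unfolding scalar_chains_def
  proof (intro CollectI allI impI)
    fix \<sigma> assume "d \<sigma> \<noteq> 0"
    then have u: "u \<in> \<sigma>" "c (\<sigma> - {u}) \<noteq> 0" "v \<in> \<sigma> - {u}"
      by (auto simp: wedge_def d_def cv_def split: if_splits)
    then have "\<sigma> - {u} \<in> K" "card (\<sigma> - {u}) = j" using c(1) by (auto simp: scalar_chains_def)
    moreover have "insert u (\<sigma> - {u}) = \<sigma>" "finite (\<sigma> - {u})"
      using u(1) calculation(1) assms(1,2) finite_subset by blast+
    ultimately show "\<sigma> \<in> K \<and> card \<sigma> = Suc j"
      using dom[of "\<sigma> - {u}"] u(3) card.insert_remove[of "\<sigma> - {u}" u] by auto
  qed
  define e where "e \<sigma> = c \<sigma> - scalar_boundary X d \<sigma>" for \<sigma>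
  have sd: "scalar_boundary X d \<sigma> = cv \<sigma> - wedge u (scalar_boundary X cv) \<sigma>" for \<sigma>
    unfolding d_def by (rule scalar_boundary_wedge[OF cv assms(1,2,4)])
  have "scalar_boundary X cv \<tau> = 0" if "v \<in> \<tau>" for \<tau>
  proof -
    have "scalar_boundary X cv \<tau> = scalar_boundary X c \<tau>" using that by (simp add: scalar_boundary_def cv_def)
    then show ?thesis by (simp add: c(2))
  qed
  then have e_v: "e \<sigma> = 0" if "v \<in> \<sigma>" for \<sigma>
    using that \<open>u \<noteq> v\<close> by (simp add: e_def sd cv_def wedge_def)
  have "e \<in> scalar_chains {\<sigma> \<in> K. v \<notin> \<sigma>} j"
    unfolding scalar_chains_def
  proof (intro CollectI allI impI)
    fix \<sigma> assume *: "e \<sigma> \<noteq> 0"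
    then have "c \<sigma> \<noteq> 0 \<or> scalar_boundary X d \<sigma> \<noteq> 0" by (auto simp: e_def)
    moreover have "scalar_boundary X d \<in> scalar_chains K j" by (rule scalar_boundary_scalar_chains[OF d assms(1,2,3)])
    ultimately have "\<sigma> \<in> K \<and> card \<sigma> = j" using c(1) by (auto simp: scalar_chains_def)
    then show "\<sigma> \<in> {\<sigma> \<in> K. v \<notin> \<sigma>} \<and> card \<sigma> = j" using e_v * by auto
  qed
  moreover have "scalar_boundary X e = (\<lambda>_. 0)"
    by (rule ext) (simp add: e_def[abs_def] scalar_boundary_diff c(2) scalar_boundary_sdiff[OF d assms(1,2)])
  ultimately obtain f where f: "f \<in> scalar_chains {\<sigma> \<in> K. v \<notin> \<sigma>} (Suc j)" "scalar_boundary X f = e"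
    using del unfolding acyclic_complex_def by blast
  have "(\<lambda>\<sigma>. d \<sigma> + f \<sigma>) \<in> scalar_chains K (Suc j)"
    unfolding scalar_chains_def
  proof (intro CollectI allI impI)
    fix \<sigma> assume "d \<sigma> + f \<sigma> \<noteq> 0"
    then have "d \<sigma> \<noteq> 0 \<or> f \<sigma> \<noteq> 0" by auto
    then show "\<sigma> \<in> K \<and> card \<sigma> = Suc j" using d f(1) by (auto simp: scalar_chains_def)
  qed
  moreover have "scalar_boundary X (\<lambda>\<sigma>. d \<sigma> + f \<sigma>) = c"
    by (rule ext) (simp add: scalar_boundary_add f(2) e_def)
  ultimately show "\<exists>d\<in>scalar_chains K (Suc j). scalar_boundary X d = c" by blast
qed

text \<open>
  The end point of a path is dominated by its neighbour.
\<close>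

lemma path_complex_acyclic:
  fixes g :: "nat \<Rightarrow> 'a::linorder"
  assumes fin: "finite X" and g: "inj g" and "lo \<le> hi" and X: "g ` {lo..hi} \<subseteq> X"
  shows "acyclic_complex TYPE('k::field) X {\<sigma>. \<sigma> \<subseteq> g ` {lo..hi} \<and> (\<exists>i. \<sigma> \<subseteq> {g i, g (Suc i)})}"
  using \<open>lo \<le> hi\<close> X
proof (induction hi rule: dec_induct)
  case base
  then show ?case by (intro cone_acyclic[OF fin, of _ "g lo"]) auto
next
  case (step n)
  let ?K = "\<lambda>n. {\<sigma>. \<sigma> \<subseteq> g ` {lo..n} \<and> (\<exists>i. \<sigma> \<subseteq> {g i, g (Suc i)})}"
  have img: "g ` {lo..Suc n} = insert (g (Suc n)) (g ` {lo..n})"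
    using step.hyps(1) by (simp add: atLeastAtMostSuc_conv)
  have new: "g (Suc n) \<notin> g ` {lo..n}" using g by (auto simp: inj_eq)
  have "{\<sigma> \<in> ?K (Suc n). g (Suc n) \<notin> \<sigma>} = ?K n" unfolding img using new by auto
  then have del: "acyclic_complex TYPE('k) X {\<sigma> \<in> ?K (Suc n). g (Suc n) \<notin> \<sigma>}"
    using step.IH step.prems img by auto
  have dom: "insert (g n) \<sigma> \<in> ?K (Suc n)" if \<sigma>: "\<sigma> \<in> ?K (Suc n)" "g (Suc n) \<in> \<sigma>" for \<sigma>
  proof -
    obtain i where i: "\<sigma> \<subseteq> {g i, g (Suc i)}" and sub: "\<sigma> \<subseteq> g ` {lo..Suc n}" using \<sigma>(1) by blast
    have "i = n \<or> i = Suc n" using i \<sigma>(2) g by (auto simp: inj_eq)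
    moreover have "g (Suc (Suc n)) \<notin> \<sigma>" using sub g by (auto simp: inj_eq)
    ultimately have "\<sigma> \<subseteq> {g n, g (Suc n)}" using i by auto
    then show ?thesis using sub step.hyps(1) by auto
  qed
  have closed: "\<tau> \<in> ?K (Suc n)" if "\<sigma> \<in> ?K (Suc n)" "\<tau> \<subseteq> \<sigma>" for \<sigma> \<tau>
    using that by blast
  show ?case
    by (rule dominated_acyclic[OF fin _ closed _ _ dom del])
      (use step.prems step.hyps(1) g in \<open>auto simp: inj_eq\<close>)
qed

section \<open>Divisibility of monomials\<close>

text \<open>
  Divisibility of monomials, written on exponent vectors; the order \<open>\<le>\<close> on exponent vectors is
  lexicographic and cannot be used for this.
\<close>

definition mdvd :: "'v monomial \<Rightarrow> 'v monomial \<Rightarrow> bool" (infix "mdvd" 50) where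
  "a mdvd m \<longleftrightarrow> (\<forall>v. Poly_Mapping.lookup a v \<le> Poly_Mapping.lookup m v)"

lemma mdvd_refl [simp]: "a mdvd a" by (simp add: mdvd_def)

lemma mdvd_trans [trans]: "a mdvd b \<Longrightarrow> b mdvd c \<Longrightarrow> a mdvd c"
  unfolding mdvd_def by (meson order_trans)

lemma mdvd_antisym: "a mdvd b \<Longrightarrow> b mdvd a \<Longrightarrow> a = b"
  unfolding mdvd_def by (intro poly_mapping_eqI) (simp add: order_antisym)

lemma mdvd_add_diff: "a mdvd m \<Longrightarrow> m - a + a = m"
  by (rule poly_mapping_eqI) (simp add: lookup_add lookup_minus mdvd_def)

lemma mdvd_add [simp]: "a mdvd n + a"
  by (simp add: mdvd_def lookup_add)

lemma mdvd_iff_add: "a mdvd m \<longleftrightarrow> (\<exists>n. m = n + a)"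
  by (metis mdvd_add mdvd_add_diff)

lemma zero_mdvd [simp]: "0 mdvd m" by (simp add: mdvd_def)

lemma mdvd_zero_iff [simp]: "m mdvd 0 \<longleftrightarrow> m = 0"
  using mdvd_antisym[of m 0] by auto

lemma mdvd_keys: "a mdvd m \<Longrightarrow> Poly_Mapping.keys a \<subseteq> Poly_Mapping.keys m"
  by (auto simp: mdvd_def in_keys_iff) (meson less_le_trans)

lemma keys_diff_monomial: "Poly_Mapping.keys (m - a :: 'v monomial) \<subseteq> Poly_Mapping.keys m"
  by (auto simp: in_keys_iff lookup_minus)

lemma lookup_mlcm_le_iff:
  "finite \<sigma> \<Longrightarrow> Poly_Mapping.lookup (mlcm \<sigma>) v \<le> n \<longleftrightarrow> (\<forall>u\<in>\<sigma>. Poly_Mapping.lookup u v \<le> n)"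
  by (simp add: lookup_mlcm)

lemma le_lookup_mlcm_iff:
  assumes "finite \<sigma>" "0 < n"
  shows "n \<le> Poly_Mapping.lookup (mlcm \<sigma>) v \<longleftrightarrow> (\<exists>u\<in>\<sigma>. n \<le> Poly_Mapping.lookup u v)"
proof -
  have "k \<le> n - 1 \<longleftrightarrow> \<not> n \<le> k" for k using assms(2) by arith
  then show ?thesis using lookup_mlcm_le_iff[OF assms(1), of v "n - 1"] by auto
qed

lemma mlcm_mdvd_iff: "finite \<sigma> \<Longrightarrow> mlcm \<sigma> mdvd m \<longleftrightarrow> (\<forall>u\<in>\<sigma>. u mdvd m)"
  by (auto simp: mdvd_def lookup_mlcm_le_iff)

lemma mlcm_empty [simp]: "mlcm {} = 0" by (simp add: mlcm_def)

lemma mlcm_singleton [simp]: "mlcm {u} = u"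
  by (rule poly_mapping_eqI) (simp add: lookup_mlcm)

lemma mlcm_mono: "finite \<tau> \<Longrightarrow> \<sigma> \<subseteq> \<tau> \<Longrightarrow> mlcm \<sigma> mdvd mlcm \<tau>"
  using mlcm_mdvd_iff[of \<tau> "mlcm \<tau>"] by (auto simp: mlcm_mdvd_iff finite_subset)

lemma mem_mdvd_mlcm: "finite \<sigma> \<Longrightarrow> u \<in> \<sigma> \<Longrightarrow> u mdvd mlcm \<sigma>"
  using mlcm_mdvd_iff[of \<sigma> "mlcm \<sigma>"] by auto

lemma keys_mlcm: "finite \<sigma> \<Longrightarrow> Poly_Mapping.keys (mlcm \<sigma>) = (\<Union>u\<in>\<sigma>. Poly_Mapping.keys u)"
  using le_lookup_mlcm_iff[of \<sigma> 1] by (auto simp: in_keys_iff Suc_le_eq)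

lemma lookup_monomial_times:
  fixes p :: "('v, 'k::field) mpoly"
  shows "Poly_Mapping.lookup (mpoly_mon a * p) k =
    (if a mdvd k then Poly_Mapping.lookup p (k - a) else 0)"
proof -
  have "mpoly_mon a * p =
      (\<Sum>m\<in>Poly_Mapping.keys p. Poly_Mapping.single (a + m) (Poly_Mapping.lookup p m))"
    by (subst poly_mapping_sum_single[of p, symmetric])
      (simp add: sum_distrib_left mpoly_mon_def mult_single)
  then have "Poly_Mapping.lookup (mpoly_mon a * p) k =
      (\<Sum>m\<in>Poly_Mapping.keys p. if a + m = k then Poly_Mapping.lookup p m else 0)"
    by (simp add: lookup_sum lookup_single when_def cong: if_cong)
  also have "\<dots> = (\<Sum>m\<in>Poly_Mapping.keys p. if m = k - a \<and> a mdvd k then Poly_Mapping.lookup p m else 0)"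
  proof (rule sum.cong[OF refl])
    fix m
    have "a + m = k \<longleftrightarrow> m = k - a \<and> a mdvd k"
      using mdvd_add_diff[of a k] mdvd_add[of a m] by (auto simp: add.commute)
    then show "(if a + m = k then Poly_Mapping.lookup p m else 0) =
      (if m = k - a \<and> a mdvd k then Poly_Mapping.lookup p m else 0)" by simp
  qed
  also have "\<dots> = (if a mdvd k then Poly_Mapping.lookup p (k - a) else 0)"
    by (auto simp: in_keys_iff)
  finally show ?thesis .
qed

section \<open>Multigraded strands\<close>

definition polys :: "'v set \<Rightarrow> ('v, 'k::field) mpoly set" where
  "polys V = {p. \<forall>m\<in>Poly_Mapping.keys p. Poly_Mapping.keys m \<subseteq> V}"

lemma carrier_poly_ring: "carrier (poly_ring V) = polys V"
  by (simp add: poly_ring_def polys_def)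

lemma polys_zero [simp]: "0 \<in> polys V" by (simp add: polys_def)

lemma polys_add: "p \<in> polys V \<Longrightarrow> q \<in> polys V \<Longrightarrow> p + q \<in> polys V"
  using keys_add[of p q] by (auto simp: polys_def)

lemma polys_mult: "p \<in> polys V \<Longrightarrow> q \<in> polys V \<Longrightarrow> p * q \<in> polys V"
  by (auto simp: polys_def dest!: subsetD[OF keys_mult] subsetD[OF keys_add] dest: subsetD)

lemma polys_sum: "(\<And>i. i \<in> A \<Longrightarrow> f i \<in> polys V) \<Longrightarrow> sum f A \<in> polys V"
  by (induction A rule: infinite_finite_induct) (auto intro: polys_add)

lemma polys_sign: "p \<in> polys V \<Longrightarrow> (- 1) ^ n * p \<in> polys V"
  by (cases "even n") (auto simp: polys_def in_keys_iff)

lemma polys_single: "Poly_Mapping.keys m \<subseteq> V \<Longrightarrow> Poly_Mapping.single m a \<in> polys V"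
  by (simp add: polys_def)

text \<open>
  The free modules of the resolution together with the coefficient ring itself, placed at the empty
  face.  The augmentation then becomes the last boundary map.
\<close>

definition aug_chains :: "'v set \<Rightarrow> 'v monomial set set \<Rightarrow> nat \<Rightarrow> ('v monomial set \<Rightarrow> ('v, 'k::field) mpoly) set" where
  "aug_chains V \<Delta> j = {c. (\<forall>\<sigma>. c \<sigma> \<in> polys V) \<and> (\<forall>\<sigma>. c \<sigma> \<noteq> 0 \<longrightarrow> \<sigma> \<in> \<Delta> \<and> card \<sigma> = j)}"

lemma chains_eq_aug_chains: "chains V \<Delta> i = aug_chains V \<Delta> (Suc i)"
  by (simp add: chains_def aug_chains_def carrier_poly_ring)

text \<open>
  The component of multidegree \<open>m\<close>: the basis element of \<open>\<sigma>\<close> has multidegree \<open>mlcm \<sigma>\<close>, so its coefficient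
  contributes through the monomial \<open>m - mlcm \<sigma>\<close>.
\<close>

definition strand :: "'v monomial \<Rightarrow> ('v monomial set \<Rightarrow> ('v, 'k::field) mpoly) \<Rightarrow> 'v monomial set \<Rightarrow> 'k" where
  "strand m c \<sigma> = (if mlcm \<sigma> mdvd m then Poly_Mapping.lookup (c \<sigma>) (m - mlcm \<sigma>) else 0)"

definition below :: "'v monomial set set \<Rightarrow> 'v monomial \<Rightarrow> 'v monomial set set" where
  "below \<Delta> m = {\<sigma> \<in> \<Delta>. mlcm \<sigma> mdvd m}"

lemma strand_scalar_chains: "c \<in> aug_chains V \<Delta> j \<Longrightarrow> strand m c \<in> scalar_chains (below \<Delta> m) j"
  by (auto simp: aug_chains_def scalar_chains_def strand_def below_def split: if_splits) (metis lookup_zero)+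

text \<open>
  The coefficient of \<open>k\<close> at the face \<open>\<sigma>\<close> is visible in multidegree \<open>k + mlcm \<sigma>\<close>.
\<close>

lemma strands_determine:
  assumes "\<And>m. strand m c = strand m d"
  shows "c = d"
proof (rule ext, rule poly_mapping_eqI)
  fix \<sigma> k
  have "strand (k + mlcm \<sigma>) c \<sigma> = strand (k + mlcm \<sigma>) d \<sigma>" by (simp add: assms)
  then show "Poly_Mapping.lookup (c \<sigma>) k = Poly_Mapping.lookup (d \<sigma>) k" by (simp add: strand_def)
qed

text \<open>
  Collecting, for a fixed face \<open>\<tau>\<close>, the faces of which \<open>\<tau>\<close> is a facet.
\<close>

lemma boundary_eq:
  fixes c :: "'v::linorder monomial set \<Rightarrow> ('v, 'k::field) mpoly"
  assumes fin: "finite X" and sub: "\<Delta> \<subseteq> Pow X" and c: "\<And>\<sigma>. c \<sigma> \<noteq> 0 \<Longrightarrow> \<sigma> \<in> \<Delta>"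
  shows "boundary \<Delta> c \<tau> = (\<Sum>u\<in>X - \<tau>. (- 1) ^ card {w \<in> \<tau>. w < u} *
      mpoly_mon (mlcm (insert u \<tau>) - mlcm \<tau>) * c (insert u \<tau>))"
proof -
  define h :: "'v monomial set \<Rightarrow> 'v monomial \<Rightarrow> ('v, 'k) mpoly" where
    "h \<sigma> u = (- 1) ^ card {w \<in> \<sigma>. w < u} * mpoly_mon (mlcm \<sigma> - mlcm (\<sigma> - {u})) * c \<sigma>" for \<sigma> u
  have fin\<Delta>: "finite \<Delta>" using fin sub finite_subset by blast
  have "boundary \<Delta> c \<tau> = (\<Sum>\<sigma>\<in>\<Delta>. \<Sum>u\<in>X. if u \<in> \<sigma> \<and> \<sigma> - {u} = \<tau> then h \<sigma> u else 0)"
    unfolding boundary_def h_def[symmetric]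
  proof (rule sum.cong[OF refl])
    fix \<sigma> assume "\<sigma> \<in> \<Delta>"
    then have *: "\<sigma> \<subseteq> X" using sub by blast
    show "(\<Sum>u\<in>\<sigma>. if \<sigma> - {u} = \<tau> then h \<sigma> u else 0) =
        (\<Sum>u\<in>X. if u \<in> \<sigma> \<and> \<sigma> - {u} = \<tau> then h \<sigma> u else 0)"
      using * fin by (intro sum.mono_neutral_cong_left) auto
  qed
  also have "\<dots> = (\<Sum>u\<in>X. \<Sum>\<sigma>\<in>\<Delta>. if u \<in> \<sigma> \<and> \<sigma> - {u} = \<tau> then h \<sigma> u else 0)"
    by (rule sum.swap)
  also have "\<dots> = (\<Sum>u\<in>X. \<Sum>\<sigma>\<in>\<Delta>. if \<sigma> = insert u \<tau> then (if u \<notin> \<tau> then h (insert u \<tau>) u else 0) else 0)"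
  proof (intro sum.cong refl)
    fix u \<sigma>
    have "u \<in> \<sigma> \<and> \<sigma> - {u} = \<tau> \<longleftrightarrow> \<sigma> = insert u \<tau> \<and> u \<notin> \<tau>" by auto
    then show "(if u \<in> \<sigma> \<and> \<sigma> - {u} = \<tau> then h \<sigma> u else 0) =
        (if \<sigma> = insert u \<tau> then (if u \<notin> \<tau> then h (insert u \<tau>) u else 0) else 0)" by simp
  qed
  also have "\<dots> = (\<Sum>u\<in>X. if u \<notin> \<tau> then h (insert u \<tau>) u else 0)"
  proof (intro sum.cong refl)
    fix u
    have "h (insert u \<tau>) u = 0" if "insert u \<tau> \<notin> \<Delta>"
      using c[of "insert u \<tau>"] that by (auto simp: h_def)
    then show "(\<Sum>\<sigma>\<in>\<Delta>. if \<sigma> = insert u \<tau> then (if u \<notin> \<tau> then h (insert u \<tau>) u else 0) else 0) =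
        (if u \<notin> \<tau> then h (insert u \<tau>) u else 0)"
      using fin\<Delta> by auto
  qed
  also have "\<dots> = (\<Sum>u\<in>X - \<tau>. h (insert u \<tau>) u)"
    using fin by (simp add: sum.If_cases Diff_eq Collect_neg_eq)
  also have "\<dots> = (\<Sum>u\<in>X - \<tau>. (- 1) ^ card {w \<in> \<tau>. w < u} *
      mpoly_mon (mlcm (insert u \<tau>) - mlcm \<tau>) * c (insert u \<tau>))"
  proof (intro sum.cong refl)
    fix u assume "u \<in> X - \<tau>"
    then have "{w \<in> insert u \<tau>. w < u} = {w \<in> \<tau>. w < u}" "insert u \<tau> - {u} = \<tau>" by auto
    then show "h (insert u \<tau>) u = (- 1) ^ card {w \<in> \<tau>. w < u} *
      mpoly_mon (mlcm (insert u \<tau>) - mlcm \<tau>) * c (insert u \<tau>)" by (simp add: h_def)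
  qed
  finally show ?thesis .
qed

lemma lookup_sign_times:
  "Poly_Mapping.lookup ((- 1) ^ n * p) k = (- 1) ^ n * (Poly_Mapping.lookup p k :: 'k::field)"
  by (cases "even n") simp_all

text \<open>
  The monomial coefficients of the homogenized boundary exactly compensate the difference of
  multidegrees, so in each multidegree only the simplicial signs remain.
\<close>

lemma strand_boundary:
  fixes c :: "'v::linorder monomial set \<Rightarrow> ('v, 'k::field) mpoly"
  assumes fin: "finite X" and sub: "\<Delta> \<subseteq> Pow X" and c: "c \<in> aug_chains V \<Delta> j"
  shows "strand m (boundary \<Delta> c) = scalar_boundary X (strand m c)"
proof
  fix \<tau>
  have c': "\<sigma> \<in> \<Delta>" if "c \<sigma> \<noteq> 0" for \<sigma> using c that by (auto simp: aug_chains_def)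
  have finD: "finite \<sigma>" if "\<sigma> \<in> \<Delta>" for \<sigma> using that fin sub finite_subset by blast
  have div: "mlcm \<tau> mdvd mlcm (insert u \<tau>)" if "insert u \<tau> \<in> \<Delta>" for u
    using finD[OF that] by (intro mlcm_mono) auto
  show "strand m (boundary \<Delta> c) \<tau> = scalar_boundary X (strand m c) \<tau>"
  proof (cases "mlcm \<tau> mdvd m")
    case True
    have "Poly_Mapping.lookup ((- 1) ^ card {w \<in> \<tau>. w < u} *
        mpoly_mon (mlcm (insert u \<tau>) - mlcm \<tau>) * c (insert u \<tau>)) (m - mlcm \<tau>) =
        face_sign u \<tau> * strand m c (insert u \<tau>)" for u
    proof (cases "insert u \<tau> \<in> \<Delta>")
      case in\<Delta>: True
      have "mlcm (insert u \<tau>) - mlcm \<tau> mdvd m - mlcm \<tau> \<longleftrightarrow> mlcm (insert u \<tau>) mdvd m"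
        using True div[OF in\<Delta>] by (simp add: mdvd_def lookup_minus) (metis diff_le_mono le_diff_iff)
      moreover have "m - mlcm \<tau> - (mlcm (insert u \<tau>) - mlcm \<tau>) = m - mlcm (insert u \<tau>)"
        using div[OF in\<Delta>] by (intro poly_mapping_eqI) (simp add: mdvd_def lookup_minus)
      ultimately show ?thesis
        by (simp add: mult.assoc lookup_sign_times lookup_monomial_times strand_def face_sign_def)
    next
      case False
      then have "c (insert u \<tau>) = 0" using c' by blast
      then show ?thesis by (simp add: strand_def)
    qed
    then show ?thesis
      using True by (simp add: strand_def[of m "boundary \<Delta> c"] boundary_eq[OF fin sub c'] lookup_sum scalar_boundary_def)
  next
    case False
    have "strand m c (insert u \<tau>) = 0" for u
    proof (cases "insert u \<tau> \<in> \<Delta>")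
      case True
      then show ?thesis using div[OF True] False mdvd_trans by (auto simp: strand_def)
    next
      case False
      then have "c (insert u \<tau>) = 0" using c' by blast
      then show ?thesis by (simp add: strand_def)
    qed
    then show ?thesis using False by (simp add: strand_def[of m "boundary \<Delta> c"] scalar_boundary_def)
  qed
qed

lemma boundary_aug_chains:
  fixes c :: "'v::linorder monomial set \<Rightarrow> ('v, 'k::field) mpoly"
  assumes fin: "finite X" and sub: "\<Delta> \<subseteq> Pow X" and closed: "\<And>\<sigma>. \<sigma> \<in> \<Delta> \<Longrightarrow> Pow \<sigma> \<subseteq> \<Delta>"
    and V: "\<And>u. u \<in> X \<Longrightarrow> Poly_Mapping.keys u \<subseteq> V" and c: "c \<in> aug_chains V \<Delta> (Suc j)"
  shows "boundary \<Delta> c \<in> aug_chains V \<Delta> j"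
proof -
  have c': "\<sigma> \<in> \<Delta>" "card \<sigma> = Suc j" if "c \<sigma> \<noteq> 0" for \<sigma> using c that by (auto simp: aug_chains_def)
  have eq: "boundary \<Delta> c \<tau> = (\<Sum>u\<in>X - \<tau>. (- 1) ^ card {w \<in> \<tau>. w < u} *
      mpoly_mon (mlcm (insert u \<tau>) - mlcm \<tau>) * c (insert u \<tau>))" for \<tau>
    by (rule boundary_eq[OF fin sub c'(1)])
  have "boundary \<Delta> c \<tau> \<in> polys V" for \<tau>
    unfolding eq
  proof (rule polys_sum)
    fix u assume u: "u \<in> X - \<tau>"
    show "(- 1) ^ card {w \<in> \<tau>. w < u} * mpoly_mon (mlcm (insert u \<tau>) - mlcm \<tau>) * c (insert u \<tau>) \<in> polys V"
    proof (cases "insert u \<tau> \<in> \<Delta>")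
      case True
      then have *: "insert u \<tau> \<subseteq> X" using sub by blast
      have "Poly_Mapping.keys (mlcm (insert u \<tau>)) \<subseteq> V"
        using V * keys_mlcm[OF finite_subset[OF * fin]] by auto
      then have "Poly_Mapping.keys (mlcm (insert u \<tau>) - mlcm \<tau>) \<subseteq> V"
        by (rule order_trans[OF keys_diff_monomial])
      then show ?thesis using c unfolding mult.assoc mpoly_mon_def
        by (intro polys_sign polys_mult polys_single) (auto simp: aug_chains_def)
    next
      case False
      then have "c (insert u \<tau>) = 0" using c' by blast
      then show ?thesis by simp
    qed
  qed
  moreover have "\<tau> \<in> \<Delta> \<and> card \<tau> = j" if "boundary \<Delta> c \<tau> \<noteq> 0" for \<tau>
  proof -
    obtain u where u: "u \<in> X - \<tau>" "c (insert u \<tau>) \<noteq> 0"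
      using \<open>boundary \<Delta> c \<tau> \<noteq> 0\<close> unfolding eq by (metis (no_types, lifting) mult_zero_right sum.neutral)
    then have "insert u \<tau> \<in> \<Delta>" "card (insert u \<tau>) = Suc j" using c' by auto
    moreover have "finite \<tau>" using calculation(2) card_ge_0_finite[of "insert u \<tau>"] by simp
    ultimately show ?thesis using u(1) closed by auto
  qed
  ultimately show ?thesis by (auto simp: aug_chains_def)
qed

lemma augmentation_eq_boundary:
  fixes c :: "'v::linorder monomial set \<Rightarrow> ('v, 'k::field) mpoly"
  assumes fin: "finite X" and sub: "\<Delta> \<subseteq> Pow X" and c: "c \<in> aug_chains V \<Delta> j"
  shows "augmentation \<Delta> c = boundary \<Delta> c {}"
proof -
  have c': "\<sigma> \<in> \<Delta>" if "c \<sigma> \<noteq> 0" for \<sigma> using c that by (auto simp: aug_chains_def)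
  have "augmentation \<Delta> c = (\<Sum>u\<in>X. c {u} * mpoly_mon u)"
    unfolding augmentation_def
  proof (rule sum.mono_neutral_left[OF fin])
    show "{u. {u} \<in> \<Delta>} \<subseteq> X" using sub by blast
    show "\<forall>i\<in>X - {u. {u} \<in> \<Delta>}. c {i} * mpoly_mon i = 0" using c' by fastforce
  qed
  then show ?thesis by (simp add: boundary_eq[OF fin sub c'] mult.commute)
qed

lemma strand_zero [simp]: "strand m (\<lambda>_. 0) = (\<lambda>_. 0)"
  by (auto simp: strand_def)

lemma boundary_boundary:
  fixes c :: "'v::linorder monomial set \<Rightarrow> ('v, 'k::field) mpoly"
  assumes fin: "finite X" and sub: "\<Delta> \<subseteq> Pow X" and closed: "\<And>\<sigma>. \<sigma> \<in> \<Delta> \<Longrightarrow> Pow \<sigma> \<subseteq> \<Delta>"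
    and V: "\<And>u. u \<in> X \<Longrightarrow> Poly_Mapping.keys u \<subseteq> V" and c: "c \<in> aug_chains V \<Delta> (Suc j)"
  shows "boundary \<Delta> (boundary \<Delta> c) = (\<lambda>_. 0)"
proof (rule strands_determine)
  fix m
  have "\<And>\<sigma>. \<sigma> \<in> below \<Delta> m \<Longrightarrow> \<sigma> \<subseteq> X" using sub by (auto simp: below_def)
  then have "scalar_boundary X (scalar_boundary X (strand m c)) = (\<lambda>_. 0)"
    by (intro ext scalar_boundary_sdiff[OF strand_scalar_chains[OF c] fin])
  then show "strand m (boundary \<Delta> (boundary \<Delta> c)) = strand m (\<lambda>_. 0)"
    by (simp add: strand_boundary[OF fin sub boundary_aug_chains[OF assms]] strand_boundary[OF fin sub c])
qed

text \<open>
  The inverse of taking strands: a scalar chain placed in multidegree \<open>m\<close>.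
\<close>

definition homogenize :: "'v monomial \<Rightarrow> ('v monomial set \<Rightarrow> 'k::field) \<Rightarrow> 'v monomial set \<Rightarrow> ('v, 'k) mpoly" where
  "homogenize m c \<sigma> = Poly_Mapping.single (m - mlcm \<sigma>) (c \<sigma>)"

lemma homogenize_aug_chains:
  assumes "c \<in> scalar_chains (below \<Delta> m) j" "Poly_Mapping.keys m \<subseteq> V"
  shows "homogenize m c \<in> aug_chains V \<Delta> j"
proof -
  have "homogenize m c \<sigma> \<in> polys V" for \<sigma>
    unfolding homogenize_def
    by (intro polys_single order_trans[OF keys_diff_monomial] assms(2))
  then show ?thesis using assms(1)
    by (auto simp: aug_chains_def homogenize_def scalar_chains_def below_def) (metis single_zero)+
qed

lemma strand_homogenize:
  assumes "c \<in> scalar_chains (below \<Delta> m) j"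
  shows "strand m' (homogenize m c) \<sigma> = (if m' = m then c \<sigma> else 0)"
proof (cases "c \<sigma> = 0")
  case False
  then have m: "mlcm \<sigma> mdvd m" using assms by (auto simp: scalar_chains_def below_def)
  then have "mlcm \<sigma> mdvd m' \<Longrightarrow> m - mlcm \<sigma> = m' - mlcm \<sigma> \<longleftrightarrow> m' = m"
    by (metis mdvd_add_diff)
  then show ?thesis using m by (auto simp: strand_def homogenize_def lookup_single when_def)
qed (simp add: strand_def homogenize_def)

text \<open>
  A scalar cycle below \<open>m\<close> is homogenized to a cycle of the resolution; the multidegree-\<open>m\<close> part of any
  chain that bounds it is a scalar chain bounding the original cycle.
\<close>

lemma resolution_strand_exact:
  fixes I :: "('v::linorder, 'k::field) mpoly set"
  assumes res: "supports_free_resolution V \<Delta> I" and fin: "finite (Gens V I)"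
    and m: "Poly_Mapping.keys m \<subseteq> V"
    and c: "c \<in> scalar_chains (below \<Delta> m) (Suc j)" "scalar_boundary (Gens V I) c = (\<lambda>_. 0 :: 'k)"
  shows "\<exists>d \<in> scalar_chains (below \<Delta> m) (Suc (Suc j)). scalar_boundary (Gens V I) d = c"
proof -
  let ?X = "Gens V I"
  have sub: "\<Delta> \<subseteq> Pow ?X"
    using res by (auto simp: supports_free_resolution_def is_subcomplex_def taylor_def)
  define C where "C = homogenize m c"
  have C: "C \<in> aug_chains V \<Delta> (Suc j)" unfolding C_def by (rule homogenize_aug_chains[OF c(1) m])
  have bC: "boundary \<Delta> C = (\<lambda>_. 0)"
  proof (rule strands_determine)
    fix m'
    have "strand m' C = (if m' = m then c else (\<lambda>_. 0))"
      unfolding C_def by (rule ext) (simp add: strand_homogenize[OF c(1)])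
    then have "scalar_boundary ?X (strand m' C) = (\<lambda>_. 0)" using c(2) by (auto simp: scalar_boundary_def)
    then show "strand m' (boundary \<Delta> C) = strand m' (\<lambda>_. 0)"
      by (simp add: strand_boundary[OF fin sub C])
  qed
  have "C \<in> boundary \<Delta> ` aug_chains V \<Delta> (Suc (Suc j))"
  proof (cases j)
    case 0
    have "augmentation \<Delta> C = 0" by (simp add: augmentation_eq_boundary[OF fin sub C] bC)
    moreover have "{c \<in> chains V \<Delta> 0. augmentation \<Delta> c = (0 :: ('v, 'k) mpoly)} = boundary \<Delta> ` chains V \<Delta> 1"
      using res unfolding supports_free_resolution_def Let_def by blast
    ultimately show ?thesis using C by (auto simp: chains_eq_aug_chains 0)
  next
    case (Suc i)
    have "{c \<in> chains V \<Delta> (i + 1). boundary \<Delta> c = (\<lambda>_. 0 :: ('v, 'k) mpoly)} = boundary \<Delta> ` chains V \<Delta> (i + 2)"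
      using res unfolding supports_free_resolution_def Let_def by blast
    then show ?thesis using C bC by (auto simp: chains_eq_aug_chains Suc)
  qed
  then obtain D where D: "D \<in> aug_chains V \<Delta> (Suc (Suc j))" "boundary \<Delta> D = C" by blast
  have "scalar_boundary ?X (strand m D) = strand m C"
    by (simp add: strand_boundary[OF fin sub D(1), symmetric] D(2))
  also have "\<dots> = c" unfolding C_def by (rule ext) (simp add: strand_homogenize[OF c(1)])
  finally show ?thesis using strand_scalar_chains[OF D(1)] by blast
qed

text \<open>
  Only finitely many multidegrees occur in a chain, so chains bounding its strands can be homogenized
  and added.
\<close>

lemma exact_if_strands_exact:
  fixes c :: "'v::linorder monomial set \<Rightarrow> ('v, 'k::field) mpoly"
  assumes fin: "finite X" and sub: "\<Delta> \<subseteq> Pow X"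
    and V: "\<And>u. u \<in> X \<Longrightarrow> Poly_Mapping.keys u \<subseteq> V" and c: "c \<in> aug_chains V \<Delta> j"
    and ex: "\<And>m \<sigma>. Poly_Mapping.keys m \<subseteq> V \<Longrightarrow> strand m c \<sigma> \<noteq> 0 \<Longrightarrow>
      \<exists>d \<in> scalar_chains (below \<Delta> m) (Suc j). scalar_boundary X d = strand m c"
  shows "\<exists>d \<in> aug_chains V \<Delta> (Suc j). boundary \<Delta> d = c"
proof -
  \<comment> \<open>The multidegrees in which \<open>c\<close> is nonzero.\<close>
  define M where "M = (\<Union>\<sigma>\<in>\<Delta>. (\<lambda>k. k + mlcm \<sigma>) ` Poly_Mapping.keys (c \<sigma>))"
  have fin\<Delta>: "finite \<Delta>" using fin sub finite_subset by blast
  then have finM: "finite M" by (auto simp: M_def)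
  have MV: "Poly_Mapping.keys m \<subseteq> V" if "m \<in> M" for m
  proof -
    obtain \<sigma> k where *: "\<sigma> \<in> \<Delta>" "k \<in> Poly_Mapping.keys (c \<sigma>)" "m = k + mlcm \<sigma>"
      using \<open>m \<in> M\<close> by (auto simp: M_def)
    then have "\<sigma> \<subseteq> X" using sub by blast
    then have "finite \<sigma>" using fin finite_subset by blast
    then have "Poly_Mapping.keys (mlcm \<sigma>) \<subseteq> V" using V \<open>\<sigma> \<subseteq> X\<close> by (auto simp: keys_mlcm)
    moreover have "Poly_Mapping.keys k \<subseteq> V" using c *(2) by (auto simp: aug_chains_def polys_def)
    ultimately show ?thesis using keys_add[of k "mlcm \<sigma>"] *(3) by blast
  qed
  have M: "m \<in> M" if nz: "strand m c \<sigma> \<noteq> 0" for m \<sigma>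
  proof -
    have *: "mlcm \<sigma> mdvd m" "m - mlcm \<sigma> \<in> Poly_Mapping.keys (c \<sigma>)"
      using nz by (auto simp: strand_def in_keys_iff split: if_splits)
    then have "c \<sigma> \<noteq> 0" by auto
    then have "\<sigma> \<in> \<Delta>" using c by (auto simp: aug_chains_def)
    then show ?thesis unfolding M_def using *
      by (intro UN_I[of \<sigma>] image_eqI[of _ _ "m - mlcm \<sigma>"]) (simp_all add: mdvd_add_diff)
  qed
  have "\<forall>m\<in>M. \<exists>d \<in> scalar_chains (below \<Delta> m) (Suc j). scalar_boundary X d = strand m c"
  proof
    fix m assume "m \<in> M"
    then obtain \<sigma> k where *: "\<sigma> \<in> \<Delta>" "k \<in> Poly_Mapping.keys (c \<sigma>)" "m = k + mlcm \<sigma>"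
      by (auto simp: M_def)
    then have "strand m c \<sigma> \<noteq> 0" by (simp add: strand_def in_keys_iff)
    then show "\<exists>d \<in> scalar_chains (below \<Delta> m) (Suc j). scalar_boundary X d = strand m c"
      using ex MV[OF \<open>m \<in> M\<close>] by blast
  qed
  then obtain D where D: "\<And>m. m \<in> M \<Longrightarrow> D m \<in> scalar_chains (below \<Delta> m) (Suc j)"
    "\<And>m. m \<in> M \<Longrightarrow> scalar_boundary X (D m) = strand m c"
    by metis
  define d where "d \<sigma> = (\<Sum>m\<in>M. homogenize m (D m) \<sigma>)" for \<sigma>
  have hD: "homogenize m (D m) \<in> aug_chains V \<Delta> (Suc j)" if "m \<in> M" for m
    using homogenize_aug_chains[OF D(1) MV] that by blast
  have d: "d \<in> aug_chains V \<Delta> (Suc j)"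
    unfolding aug_chains_def
  proof (intro CollectI conjI allI impI)
    fix \<sigma>
    show "d \<sigma> \<in> polys V" unfolding d_def using hD by (intro polys_sum) (auto simp: aug_chains_def)
  next
    fix \<sigma> assume "d \<sigma> \<noteq> 0"
    then obtain m where "m \<in> M" "homogenize m (D m) \<sigma> \<noteq> 0"
      unfolding d_def by (meson sum.neutral)
    then show "\<sigma> \<in> \<Delta>" "card \<sigma> = Suc j" using hD by (auto simp: aug_chains_def)
  qed
  have sd: "strand m d = (if m \<in> M then D m else (\<lambda>_. 0))" for m
  proof
    fix \<sigma>
    have "strand m d \<sigma> = (\<Sum>m'\<in>M. strand m (homogenize m' (D m')) \<sigma>)"
      by (simp add: strand_def d_def lookup_sum)
    also have "\<dots> = (\<Sum>m'\<in>M. if m' = m then D m \<sigma> else 0)"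
      by (rule sum.cong[OF refl]) (auto simp: strand_homogenize[OF D(1)])
    also have "\<dots> = (if m \<in> M then D m else (\<lambda>_. 0)) \<sigma>" using finM by simp
    finally show "strand m d \<sigma> = (if m \<in> M then D m else (\<lambda>_. 0)) \<sigma>" .
  qed
  have "boundary \<Delta> d = c"
  proof (rule strands_determine)
    fix m
    show "strand m (boundary \<Delta> d) = strand m c"
    proof (cases "m \<in> M")
      case True
      then show ?thesis by (simp add: strand_boundary[OF fin sub d] sd D(2))
    next
      case False
      then have "strand m c = (\<lambda>_. 0)" using M by blast
      then show ?thesis using False by (auto simp: strand_boundary[OF fin sub d] sd scalar_boundary_def)
    qed
  qed
  then show ?thesis using d by blast
qed

text \<open>
  All three exactness conditions come from one statement about augmented chains.  In index \<open>0\<close> an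
  element of \<open>I\<close>, viewed as a chain on the empty face, is a boundary; this is surjectivity onto \<open>I\<close>.
\<close>

lemma supports_resolution_if_acyclic:
  fixes I :: "('v::linorder, 'k::field) mpoly set"
  assumes X: "Gens V I = X" and I: "I = genideal (poly_ring V) (mpoly_mon ` X)" and fin: "finite X"
    and V: "\<And>u. u \<in> X \<Longrightarrow> Poly_Mapping.keys u \<subseteq> V"
    and sub: "\<Delta> \<subseteq> Pow X" and closed: "\<And>\<sigma>. \<sigma> \<in> \<Delta> \<Longrightarrow> Pow \<sigma> \<subseteq> \<Delta>" and empty: "{} \<in> \<Delta>"
    and acyclic: "\<And>m u. Poly_Mapping.keys m \<subseteq> V \<Longrightarrow> u \<in> X \<Longrightarrow> u mdvd m \<Longrightarrow>
      acyclic_complex TYPE('k) X (below \<Delta> m)"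
  shows "supports_free_resolution V \<Delta> I"
proof -
  have I': "I = {p \<in> polys V. \<forall>m\<in>Poly_Mapping.keys p. \<exists>a\<in>X. a mdvd m}"
    unfolding I mdvd_iff_add using genideal_mon[of X V, OF V] by (simp add: carrier_poly_ring)
  have finD: "finite \<sigma>" if "\<sigma> \<in> \<Delta>" for \<sigma> using that fin sub finite_subset by blast
  have exact: "\<exists>d \<in> aug_chains V \<Delta> (Suc j). boundary \<Delta> d = c"
    if c: "c \<in> aug_chains V \<Delta> j" "boundary \<Delta> c = (\<lambda>_. 0)" "j = 0 \<Longrightarrow> c {} \<in> I" for j and c :: "_ \<Rightarrow> ('v, 'k) mpoly"
  proof (rule exact_if_strands_exact[OF fin sub V c(1)])
    fix m \<sigma> assume m: "Poly_Mapping.keys m \<subseteq> V" and nz: "strand m c \<sigma> \<noteq> 0"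
    have *: "mlcm \<sigma> mdvd m" "m - mlcm \<sigma> \<in> Poly_Mapping.keys (c \<sigma>)"
      using nz by (auto simp: strand_def in_keys_iff split: if_splits)
    then have "c \<sigma> \<noteq> 0" by auto
    then have \<sigma>: "\<sigma> \<in> \<Delta>" "card \<sigma> = j" using c by (auto simp: aug_chains_def)
    have "\<exists>u\<in>X. u mdvd m"
    proof (cases "\<sigma> = {}")
      case True
      then show ?thesis using c(3) \<sigma>(2) *(2) by (auto simp: I')
    next
      case False
      then obtain u where u: "u \<in> \<sigma>" by blast
      then have "u mdvd m" using *(1) mlcm_mdvd_iff[OF finD[OF \<sigma>(1)]] by blast
      then show ?thesis using u \<sigma>(1) sub by blast
    qed
    then have "acyclic_complex TYPE('k) X (below \<Delta> m)" using acyclic m by blast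
    moreover have "scalar_boundary X (strand m c) = (\<lambda>_. 0)"
      by (simp add: strand_boundary[OF fin sub c(1), symmetric] c(2))
    ultimately show "\<exists>d \<in> scalar_chains (below \<Delta> m) (Suc j). scalar_boundary X d = strand m c"
      unfolding acyclic_complex_def using strand_scalar_chains[OF c(1)] by blast
  qed auto
  note bh = boundary_aug_chains[OF fin sub closed V, where 'k='k]
    and bb = boundary_boundary[OF fin sub closed V, where 'k='k]
    and aug = augmentation_eq_boundary[OF fin sub, where 'k='k]
  have ex: "{c \<in> aug_chains V \<Delta> (Suc j). boundary \<Delta> c = (\<lambda>_. 0 :: ('v, 'k) mpoly)} =
      boundary \<Delta> ` aug_chains V \<Delta> (Suc (Suc j))" for j
  proof (intro equalityI subsetI)
    fix c :: "_ \<Rightarrow> ('v, 'k) mpoly" assume "c \<in> {c \<in> aug_chains V \<Delta> (Suc j). boundary \<Delta> c = (\<lambda>_. 0)}"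
    then show "c \<in> boundary \<Delta> ` aug_chains V \<Delta> (Suc (Suc j))" using exact[of c "Suc j"] by auto
  qed (use bh bb in auto)
  have "{c \<in> aug_chains V \<Delta> 1. augmentation \<Delta> c = (0 :: ('v, 'k) mpoly)} =
      {c \<in> aug_chains V \<Delta> 1. boundary \<Delta> c = (\<lambda>_. 0 :: ('v, 'k) mpoly)}"
  proof (intro Collect_cong conj_cong refl iffI)
    fix c :: "_ \<Rightarrow> ('v, 'k) mpoly" assume c: "c \<in> aug_chains V \<Delta> 1" "augmentation \<Delta> c = 0"
    have b: "boundary \<Delta> c \<in> aug_chains V \<Delta> 0" using c(1) by (intro bh) simp_all
    have "boundary \<Delta> c \<tau> = 0" for \<tau>
    proof (cases "\<tau> \<in> \<Delta> \<and> card \<tau> = 0")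
      case True
      then show ?thesis using finD[of \<tau>] c aug[OF c(1)] by auto
    next
      case False
      then show ?thesis using b by (auto simp: aug_chains_def)
    qed
    then show "boundary \<Delta> c = (\<lambda>_. 0)" by blast
  qed (use aug in auto)
  then have ex0: "{c \<in> aug_chains V \<Delta> 1. augmentation \<Delta> c = (0 :: ('v, 'k) mpoly)} = boundary \<Delta> ` aug_chains V \<Delta> 2"
    using ex[of 0] by (simp add: numeral_2_eq_2)
  have "augmentation \<Delta> ` aug_chains V \<Delta> 1 = I"
  proof (intro equalityI subsetI)
    fix p assume "p \<in> I"
    define c where "c \<sigma> = (if \<sigma> = {} then p else 0)" for \<sigma> :: "'v monomial set"
    have c: "c \<in> aug_chains V \<Delta> 0" using \<open>p \<in> I\<close> empty by (auto simp: aug_chains_def c_def I')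
    have "boundary \<Delta> c = (\<lambda>_. 0)"
    proof
      fix \<tau>
      have "\<And>\<sigma>. c \<sigma> \<noteq> 0 \<Longrightarrow> \<sigma> \<in> \<Delta>" using c by (auto simp: aug_chains_def)
      from boundary_eq[OF fin sub, of c, OF this] show "boundary \<Delta> c \<tau> = 0" by (simp add: c_def)
    qed
    then obtain d where d: "d \<in> aug_chains V \<Delta> 1" "boundary \<Delta> d = c"
      using exact[OF c] \<open>p \<in> I\<close> by (auto simp: c_def)
    then have "augmentation \<Delta> d = p" using aug[OF d(1)] by (simp add: c_def)
    then show "p \<in> augmentation \<Delta> ` aug_chains V \<Delta> 1" using d(1) by blast
  next
    fix p :: "('v, 'k) mpoly" assume "p \<in> augmentation \<Delta> ` aug_chains V \<Delta> 1"
    then obtain c where c: "c \<in> aug_chains V \<Delta> 1" "p = augmentation \<Delta> c" by blast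
    have "boundary \<Delta> c \<in> aug_chains V \<Delta> 0" using c(1) by (intro bh) simp_all
    then have "p \<in> polys V" using c(2) aug[OF c(1)] by (simp add: aug_chains_def)
    moreover have "\<exists>a\<in>X. a mdvd m" if m: "m \<in> Poly_Mapping.keys p" for m
    proof -
      obtain u where u: "{u} \<in> \<Delta>" "m \<in> Poly_Mapping.keys (c {u} * mpoly_mon u)"
        using m keys_sum[of "\<lambda>u. c {u} * mpoly_mon u" "{u. {u} \<in> \<Delta>}"] unfolding c(2) augmentation_def by auto
      have "u mdvd m"
        using u(2) by (simp add: mult.commute[of _ "mpoly_mon u"] in_keys_iff lookup_monomial_times split: if_splits)
      then show ?thesis using u(1) sub by blast
    qed
    ultimately show "p \<in> I" by (auto simp: I')
  qed
  moreover have "is_subcomplex \<Delta> (taylor V I)"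
    using sub closed by (simp add: is_subcomplex_def taylor_def X)
  ultimately show ?thesis
    using ex ex0 by (simp add: supports_free_resolution_def Let_def chains_eq_aug_chains numeral_2_eq_2)
qed

section \<open>Scarf complexes\<close>

lemma genideal_mon_polys:
  assumes "\<And>a. a \<in> A \<Longrightarrow> Poly_Mapping.keys a \<subseteq> V"
  shows "genideal (poly_ring V) (mpoly_mon ` A) =
    {p \<in> polys V :: ('v, 'k::field) mpoly set. \<forall>m\<in>Poly_Mapping.keys p. \<exists>a\<in>A. a mdvd m}"
  using genideal_mon[of A V, OF assms, where 'k='k] by (simp add: carrier_poly_ring mdvd_iff_add)

definition antichain :: "'v monomial set \<Rightarrow> bool" where
  "antichain B \<longleftrightarrow> (\<forall>u\<in>B. \<forall>w\<in>B. u mdvd w \<longrightarrow> u = w)"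

text \<open>
  A generator outside \<open>B' \<subset> B\<close> is not divisible by any element of \<open>B'\<close>, hence does not lie in the ideal
  generated by \<open>B'\<close>.
\<close>

lemma Gens_antichain:
  assumes V: "\<And>u. u \<in> B \<Longrightarrow> Poly_Mapping.keys u \<subseteq> V" and anti: "antichain B"
  shows "Gens V (genideal (poly_ring V) (mpoly_mon ` B) :: ('v, 'k::field) mpoly set) = B"
proof -
  let ?I = "\<lambda>B. genideal (poly_ring V) (mpoly_mon ` B) :: ('v, 'k) mpoly set"
  have gen: "?I B' = {p \<in> polys V. \<forall>m\<in>Poly_Mapping.keys p. \<exists>a\<in>B'. a mdvd m}" if "B' \<subseteq> B" for B'
    using V that by (intro genideal_mon_polys) blast
  have "?I B' \<noteq> ?I B" if "B' \<subset> B" for B'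
  proof -
    obtain u where u: "u \<in> B" "u \<notin> B'" using \<open>B' \<subset> B\<close> by blast
    have k: "Poly_Mapping.keys (mpoly_mon u :: ('v, 'k) mpoly) = {u}" by (simp add: mpoly_mon_def)
    have "mpoly_mon u \<in> ?I B"
      using u V[of u] by (auto simp: gen k polys_def intro!: bexI[of _ u])
    moreover have "mpoly_mon u \<notin> ?I B'"
      using u \<open>B' \<subset> B\<close> anti by (auto simp: gen k antichain_def)
    ultimately show ?thesis by blast
  qed
  then have "is_min_mon_gens V (?I B) B" using V by (auto simp: is_min_mon_gens_def)
  moreover have "\<exists>!B'. is_min_mon_gens V (?I B) B'" using V by (rule ex1_min_mon_gens)
  ultimately show ?thesis unfolding Gens_def by (intro the1_equality)
qed

text \<open>
  For \<open>u \<in> \<sigma>\<close> the condition says that removing \<open>u\<close> changes the label, for \<open>u \<notin> \<sigma>\<close> that adding \<open>u\<close> changes it.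
\<close>

definition scarf_faces :: "'v monomial set \<Rightarrow> 'v monomial set set" where
  "scarf_faces B = {\<sigma>. \<sigma> \<subseteq> B \<and> (\<forall>u\<in>B. \<not> u mdvd mlcm (\<sigma> - {u}))}"

lemma mlcm_insert_absorb:
  assumes "finite \<sigma>" "u mdvd mlcm \<sigma>"
  shows "mlcm (insert u \<sigma>) = mlcm \<sigma>"
proof (rule mdvd_antisym)
  show "mlcm (insert u \<sigma>) mdvd mlcm \<sigma>"
    using assms mem_mdvd_mlcm[OF assms(1)] by (auto simp: mlcm_mdvd_iff)
  show "mlcm \<sigma> mdvd mlcm (insert u \<sigma>)" using assms(1) by (intro mlcm_mono) auto
qed

text \<open>
  If \<open>u\<close> divides \<open>mlcm (\<sigma> - {u})\<close>, then \<open>\<sigma> - {u}\<close> and \<open>insert u \<sigma>\<close> have the label of \<open>\<sigma>\<close>, and one of them differs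
  from \<open>\<sigma>\<close>.  Conversely, if \<open>\<tau>\<close> has the label of \<open>\<sigma>\<close>, an element of \<open>\<tau> - \<sigma>\<close> divides \<open>mlcm \<sigma>\<close>; and once
  \<open>\<tau> \<subseteq> \<sigma>\<close>, an element \<open>u\<close> of \<open>\<sigma> - \<tau>\<close> divides \<open>mlcm \<tau>\<close> and hence \<open>mlcm (\<sigma> - {u})\<close>.
\<close>

lemma scarf_eq_scarf_faces:
  fixes I :: "('v, 'k::field) mpoly set"
  assumes fin: "finite (Gens V I)"
  shows "scarf V I = scarf_faces (Gens V I)"
proof (intro equalityI subsetI)
  fix \<sigma> assume "\<sigma> \<in> scarf V I"
  then have \<sigma>: "\<sigma> \<subseteq> Gens V I" and uniq: "\<And>\<tau>. \<tau> \<subseteq> Gens V I \<Longrightarrow> mlcm \<tau> = mlcm \<sigma> \<Longrightarrow> \<tau> = \<sigma>"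
    by (auto simp: scarf_def taylor_def)
  have "\<not> u mdvd mlcm (\<sigma> - {u})" if u: "u \<in> Gens V I" for u
  proof
    assume "u mdvd mlcm (\<sigma> - {u})"
    moreover have "finite (\<sigma> - {u})" using \<sigma> fin finite_subset by blast
    ultimately have eq: "mlcm (insert u \<sigma>) = mlcm (\<sigma> - {u})" using mlcm_insert_absorb[of "\<sigma> - {u}" u] by simp
    show False
    proof (cases "u \<in> \<sigma>")
      case True
      then have "mlcm (\<sigma> - {u}) = mlcm \<sigma>" using eq by (simp add: insert_absorb)
      then have "\<sigma> - {u} = \<sigma>" using \<sigma> by (intro uniq) auto
      then show False using True by blast
    next
      case False
      then have "mlcm (insert u \<sigma>) = mlcm \<sigma>" using eq by simp
      then have "insert u \<sigma> = \<sigma>" using \<sigma> u by (intro uniq) auto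
      then show False using False by blast
    qed
  qed
  then show "\<sigma> \<in> scarf_faces (Gens V I)" using \<sigma> by (simp add: scarf_faces_def)
next
  fix \<sigma> assume "\<sigma> \<in> scarf_faces (Gens V I)"
  then have \<sigma>: "\<sigma> \<subseteq> Gens V I" and not: "\<And>u. u \<in> Gens V I \<Longrightarrow> \<not> u mdvd mlcm (\<sigma> - {u})"
    by (auto simp: scarf_faces_def)
  have fin\<sigma>: "finite \<sigma>" using \<sigma> fin finite_subset by blast
  have "\<tau> = \<sigma>" if \<tau>: "\<tau> \<subseteq> Gens V I" "mlcm \<tau> = mlcm \<sigma>" for \<tau>
  proof -
    have fin\<tau>: "finite \<tau>" using \<tau>(1) fin finite_subset by blast
    have "\<tau> \<subseteq> \<sigma>"
    proof
      fix u assume u: "u \<in> \<tau>"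
      then have "u mdvd mlcm \<sigma>" using mem_mdvd_mlcm[OF fin\<tau>] \<tau>(2) by simp
      then show "u \<in> \<sigma>" using not[of u] u \<tau>(1) by (cases "u \<in> \<sigma>") auto
    qed
    moreover have "\<sigma> \<subseteq> \<tau>"
    proof
      fix u assume u: "u \<in> \<sigma>"
      show "u \<in> \<tau>"
      proof (rule ccontr)
        assume "u \<notin> \<tau>"
        then have "mlcm \<tau> mdvd mlcm (\<sigma> - {u})" using fin\<sigma> \<open>\<tau> \<subseteq> \<sigma>\<close> by (intro mlcm_mono) auto
        moreover have "u mdvd mlcm \<tau>" using mem_mdvd_mlcm[OF fin\<sigma> u] \<tau>(2) by simp
        ultimately show False using not[of u] u \<sigma> mdvd_trans by blast
      qed
    qed
    ultimately show ?thesis by blast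
  qed
  then show "\<sigma> \<in> scarf V I" using \<sigma> by (auto simp: scarf_def taylor_def)
qed

lemma scarf_faces_sub: "scarf_faces B \<subseteq> Pow B" by (auto simp: scarf_faces_def)

lemma scarf_faces_closed:
  assumes fin: "finite B" and \<sigma>: "\<sigma> \<in> scarf_faces B" and "\<tau> \<subseteq> \<sigma>"
  shows "\<tau> \<in> scarf_faces B"
proof -
  have "\<not> u mdvd mlcm (\<tau> - {u})" if u: "u \<in> B" for u
  proof -
    have "finite \<sigma>" using \<sigma> fin finite_subset by (auto simp: scarf_faces_def)
    then have "mlcm (\<tau> - {u}) mdvd mlcm (\<sigma> - {u})" using \<open>\<tau> \<subseteq> \<sigma>\<close> by (intro mlcm_mono) auto
    then show ?thesis using \<sigma> u mdvd_trans unfolding scarf_faces_def by blast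
  qed
  then show ?thesis using assms by (auto simp: scarf_faces_def)
qed

lemma empty_scarf_face: "0 \<notin> B \<Longrightarrow> {} \<in> scarf_faces B"
  by (auto simp: scarf_faces_def)

lemma pair_scarf_face_iff:
  assumes "antichain B" "0 \<notin> B" "u \<in> B" "w \<in> B"
  shows "{u, w} \<in> scarf_faces B \<longleftrightarrow> (\<forall>z\<in>B. z mdvd mlcm {u, w} \<longrightarrow> z = u \<or> z = w)"
proof
  assume f: "{u, w} \<in> scarf_faces B"
  show "\<forall>z\<in>B. z mdvd mlcm {u, w} \<longrightarrow> z = u \<or> z = w"
  proof (intro ballI impI, rule ccontr)
    fix z assume z: "z \<in> B" "z mdvd mlcm {u, w}" "\<not> (z = u \<or> z = w)"
    then have "{u, w} - {z} = {u, w}" by blast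
    then show False using f z by (auto simp: scarf_faces_def)
  qed
next
  assume *: "\<forall>z\<in>B. z mdvd mlcm {u, w} \<longrightarrow> z = u \<or> z = w"
  have "\<not> z mdvd mlcm ({u, w} - {z})" if z: "z \<in> B" for z
  proof
    assume d: "z mdvd mlcm ({u, w} - {z})"
    then have "z mdvd mlcm {u, w}" using mlcm_mono[of "{u, w}" "{u, w} - {z}"] mdvd_trans by blast
    then have "z = u \<or> z = w" using * z by blast
    then have "{u, w} - {z} = {} \<or> {u, w} - {z} = {u} \<or> {u, w} - {z} = {w}" by blast
    then have "z = 0 \<or> (\<exists>x\<in>B. x \<noteq> z \<and> z mdvd x)"
      using d assms(3,4) \<open>z = u \<or> z = w\<close> by (elim disjE) auto
    then show False using assms(1,2) z by (auto simp: antichain_def)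
  qed
  then show "{u, w} \<in> scarf_faces B" using assms by (simp add: scarf_faces_def)
qed

lemma not_scarf_face:
  assumes fin: "finite B" and "\<rho> \<subseteq> \<sigma>" "u \<in> B" "u mdvd mlcm \<rho>" "u \<notin> \<rho>"
  shows "\<sigma> \<notin> scarf_faces B"
proof
  assume \<sigma>: "\<sigma> \<in> scarf_faces B"
  then have "finite \<sigma>" using fin finite_subset by (auto simp: scarf_faces_def)
  then have "mlcm \<rho> mdvd mlcm (\<sigma> - {u})" using assms(2,5) by (intro mlcm_mono) auto
  then show False using \<sigma> assms(3,4) mdvd_trans unfolding scarf_faces_def by blast
qed

text \<open>
  A Scarf face and its facets have distinct labels, so every coefficient of the boundary is a
  nonconstant monomial.
\<close>

lemma scarf_resolution_minimal:
  fixes I :: "('v::linorder, 'k::field) mpoly set"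
  assumes fin: "finite (Gens V I)" and V: "\<And>u. u \<in> Gens V I \<Longrightarrow> Poly_Mapping.keys u \<subseteq> V"
  shows "supports_minimal_free_resolution V (scarf V I) I \<longleftrightarrow> supports_free_resolution V (scarf V I) I"
proof -
  let ?B = "Gens V I"
  let ?\<Delta> = "scarf V I"
  note sc = scarf_eq_scarf_faces[OF fin]
  have sub: "?\<Delta> \<subseteq> Pow ?B" unfolding sc by (rule scarf_faces_sub)
  have closed: "Pow \<sigma> \<subseteq> ?\<Delta>" if "\<sigma> \<in> ?\<Delta>" for \<sigma>
    using that scarf_faces_closed[OF fin, of \<sigma>] unfolding sc by blast
  \<comment> \<open>The variables, which generate the maximal ideal.\<close>
  define A where "A = (\<lambda>v. Poly_Mapping.single v 1 :: 'v monomial) ` V"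
  have A: "\<And>a. a \<in> A \<Longrightarrow> Poly_Mapping.keys a \<subseteq> V" by (auto simp: A_def)
  have A_dvd: "\<exists>a\<in>A. a mdvd m" if "Poly_Mapping.keys m \<subseteq> V" "m \<noteq> 0" for m
  proof -
    obtain v where v: "v \<in> Poly_Mapping.keys m" using \<open>m \<noteq> 0\<close> keys_eq_empty[of m] by blast
    then have "Poly_Mapping.single v 1 mdvd m"
      by (auto simp: mdvd_def lookup_single when_def in_keys_iff)
    then show ?thesis using v that(1) by (auto simp: A_def)
  qed
  have set: "{mpoly_mon (Poly_Mapping.single v 1) | v. v \<in> V} = (mpoly_mon ` A :: ('v, 'k) mpoly set)"
    by (auto simp: A_def)
  have "(boundary ?\<Delta> c \<tau> :: ('v, 'k) mpoly) \<in> genideal (poly_ring V) (mpoly_mon ` A)"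
    if c: "c \<in> chains V ?\<Delta> (i + 1)" for i c \<tau>
  proof -
    have c': "c \<in> aug_chains V ?\<Delta> (Suc (Suc i))" using c by (simp add: chains_eq_aug_chains)
    have c'': "\<And>\<sigma>. c \<sigma> \<noteq> 0 \<Longrightarrow> \<sigma> \<in> ?\<Delta>" using c' by (auto simp: aug_chains_def)
    have eq: "boundary ?\<Delta> c \<tau> = (\<Sum>u\<in>?B - \<tau>. (- 1) ^ card {w \<in> \<tau>. w < u} *
        mpoly_mon (mlcm (insert u \<tau>) - mlcm \<tau>) * c (insert u \<tau>))"
      by (rule boundary_eq[OF fin sub c''])
    have "boundary ?\<Delta> c \<in> aug_chains V ?\<Delta> (Suc i)"
      by (rule boundary_aug_chains[OF fin sub closed V c'])
    then have poly: "boundary ?\<Delta> c \<tau> \<in> polys V" by (simp add: aug_chains_def)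
    have "\<exists>a\<in>A. a mdvd m" if m: "m \<in> Poly_Mapping.keys (boundary ?\<Delta> c \<tau>)" for m
    proof -
      obtain u where u: "u \<in> ?B - \<tau>" "m \<in> Poly_Mapping.keys ((- 1) ^ card {w \<in> \<tau>. w < u} *
          mpoly_mon (mlcm (insert u \<tau>) - mlcm \<tau>) * c (insert u \<tau>))"
        using m keys_sum[of "\<lambda>u. (- 1) ^ card {w \<in> \<tau>. w < u} *
          mpoly_mon (mlcm (insert u \<tau>) - mlcm \<tau>) * c (insert u \<tau>)" "?B - \<tau>"] unfolding eq by blast
      then have "c (insert u \<tau>) \<noteq> 0" by auto
      then have in\<Delta>: "insert u \<tau> \<in> ?\<Delta>" by (rule c'')
      then have *: "insert u \<tau> \<subseteq> ?B" using sub by blast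
      have fin\<tau>: "finite (insert u \<tau>)" by (rule finite_subset[OF * fin])
      define q where "q = mlcm (insert u \<tau>) - mlcm \<tau>"
      have "q \<noteq> 0"
      proof
        assume "q = 0"
        then have "mlcm (insert u \<tau>) = mlcm \<tau>"
          using mdvd_add_diff[of "mlcm \<tau>" "mlcm (insert u \<tau>)"] mlcm_mono[of "insert u \<tau>" \<tau>] fin\<tau>
            subset_insertI[of \<tau> u] unfolding q_def by auto
        then have "u mdvd mlcm \<tau>" using mem_mdvd_mlcm[of "insert u \<tau>" u] fin\<tau> by auto
        then have "insert u \<tau> \<notin> scarf_faces ?B"
          using u(1) by (intro not_scarf_face[OF fin, of \<tau> _ u]) auto
        then show False using in\<Delta> by (simp add: scarf_eq_scarf_faces[OF fin])
      qed
      moreover have "Poly_Mapping.keys q \<subseteq> V"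
      proof -
        have "Poly_Mapping.keys (mlcm (insert u \<tau>)) \<subseteq> V" using V * keys_mlcm[OF fin\<tau>] by auto
        then show ?thesis unfolding q_def by (rule order_trans[OF keys_diff_monomial])
      qed
      ultimately obtain a where a: "a \<in> A" "a mdvd q" using A_dvd by blast
      have "q mdvd m"
        using u(2) unfolding q_def[symmetric] mult.assoc
        by (auto simp: in_keys_iff lookup_sign_times lookup_monomial_times split: if_splits)
      then show ?thesis using a mdvd_trans by blast
    qed
    moreover have "genideal (poly_ring V) (mpoly_mon ` A) =
        {p \<in> polys V :: ('v, 'k) mpoly set. \<forall>m\<in>Poly_Mapping.keys p. \<exists>a\<in>A. a mdvd m}"
      using A by (rule genideal_mon_polys)
    ultimately show ?thesis using poly by blast
  qed
  then show ?thesis unfolding supports_minimal_free_resolution_def set by blast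
qed

section \<open>Powers of monomial ideals\<close>

fun mon_pow :: "'v monomial set \<Rightarrow> nat \<Rightarrow> 'v monomial set" where
  "mon_pow E 0 = {0}"
| "mon_pow E (Suc t) = {p + e | p e. p \<in> mon_pow E t \<and> e \<in> E}"

lemma mon_pow_keys:
  assumes "\<And>e. e \<in> E \<Longrightarrow> Poly_Mapping.keys e \<subseteq> V"
  shows "p \<in> mon_pow E t \<Longrightarrow> Poly_Mapping.keys p \<subseteq> V"
proof (induction t arbitrary: p)
  case (Suc t)
  then obtain q e where "p = q + e" "q \<in> mon_pow E t" "e \<in> E" by auto
  then show ?case using Suc.IH[of q] assms[of e] keys_add[of q e] by blast
qed auto

lemma mon_pow_one [simp]: "mon_pow E (Suc 0) = E" by auto

lemma finite_mon_pow: "finite E \<Longrightarrow> finite (mon_pow E t)"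
proof (induction t)
  case (Suc t)
  have "mon_pow E (Suc t) = (\<lambda>(p, e). p + e) ` (mon_pow E t \<times> E)" by auto
  then show ?case using Suc by simp
qed simp

lemma ideal_prod_mon:
  fixes A B :: "'v monomial set"
  assumes A: "\<And>a. a \<in> A \<Longrightarrow> Poly_Mapping.keys a \<subseteq> V" and B: "\<And>b. b \<in> B \<Longrightarrow> Poly_Mapping.keys b \<subseteq> V"
  shows "ideal_prod (poly_ring V) (genideal (poly_ring V) (mpoly_mon ` A))
      (genideal (poly_ring V) (mpoly_mon ` B)) =
    (genideal (poly_ring V) (mpoly_mon ` {a + b | a b. a \<in> A \<and> b \<in> B}) :: ('v, 'k::field) mpoly set)"
    (is "ideal_prod ?R ?IA ?IB = ?IC")
proof -
  interpret cring ?R by (rule cring_poly_ring)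
  let ?C = "{a + b | a b. a \<in> A \<and> b \<in> B}"
  have C: "\<And>c. c \<in> ?C \<Longrightarrow> Poly_Mapping.keys c \<subseteq> V" using A B keys_add by fast
  have subset: "mpoly_mon ` D \<subseteq> carrier ?R" if "\<And>d. d \<in> D \<Longrightarrow> Poly_Mapping.keys d \<subseteq> V" for D
    using that by (auto simp: carrier_poly_ring mpoly_mon_def intro!: polys_single)
  have idA: "ideal ?IA ?R" and idB: "ideal ?IB ?R" and idC: "ideal ?IC ?R"
    by (rule genideal_ideal, rule subset, fact)+
  have gen: "genideal ?R (mpoly_mon ` D) =
      {p \<in> polys V. \<forall>m\<in>Poly_Mapping.keys p. \<exists>d\<in>D. d mdvd m}"
    if "\<And>d. d \<in> D \<Longrightarrow> Poly_Mapping.keys d \<subseteq> V" for D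
    using that by (rule genideal_mon_polys)
  have gA: "?IA = {p \<in> polys V. \<forall>m\<in>Poly_Mapping.keys p. \<exists>d\<in>A. d mdvd m}"
    and gB: "?IB = {p \<in> polys V. \<forall>m\<in>Poly_Mapping.keys p. \<exists>d\<in>B. d mdvd m}"
    and gC: "?IC = {p \<in> polys V. \<forall>m\<in>Poly_Mapping.keys p. \<exists>d\<in>?C. d mdvd m}"
    by (rule gen, fact)+
  show ?thesis
  proof
    show "ideal_prod ?R ?IA ?IB \<subseteq> ?IC"
    proof
      fix p assume "p \<in> ideal_prod ?R ?IA ?IB"
      then show "p \<in> ?IC"
      proof induction
        case (prod i j)
        have "i * j \<in> polys V"
          using prod unfolding gA gB by (intro polys_mult) simp_all
        moreover have "\<exists>c\<in>?C. c mdvd m" if m: "m \<in> Poly_Mapping.keys (i * j)" for m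
        proof -
          obtain k l where kl: "m = k + l" "k \<in> Poly_Mapping.keys i" "l \<in> Poly_Mapping.keys j"
            using m keys_mult[of i j] by blast
          then obtain a b where ab: "a \<in> A" "a mdvd k" "b \<in> B" "b mdvd l"
            using prod unfolding gA gB by blast
          then have "a + b mdvd m" by (simp add: kl(1) mdvd_def lookup_add add_mono)
          then show ?thesis using ab by blast
        qed
        ultimately have "i * j \<in> ?IC" unfolding gC by blast
        then show ?case by (simp add: poly_ring_def)
      next
        case (sum s1 s2)
        then show ?case using idC by (simp add: additive_subgroup.a_closed ideal.axioms(1))
      qed
    qed
    have "mpoly_mon ` ?C \<subseteq> ideal_prod ?R ?IA ?IB"
    proof
      fix p :: "('v, 'k) mpoly" assume "p \<in> mpoly_mon ` ?C"
      then obtain a b where ab: "a \<in> A" "b \<in> B" "p = mpoly_mon (a + b)" by blast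
      have "mpoly_mon a \<in> ?IA" "mpoly_mon b \<in> ?IB"
        using genideal_self[OF subset] A B ab(1,2) by blast+
      then have "mpoly_mon a \<otimes>\<^bsub>?R\<^esub> mpoly_mon b \<in> ideal_prod ?R ?IA ?IB" by (rule ideal_prod.prod)
      then show "p \<in> ideal_prod ?R ?IA ?IB" by (simp add: ab(3) poly_ring_def mpoly_mon_def mult_single)
    qed
    then show "?IC \<subseteq> ideal_prod ?R ?IA ?IB"
      by (rule genideal_minimal[OF ideal_prod_is_ideal[OF idA idB]])
  qed
qed

lemma ideal_power_mon:
  assumes E: "\<And>e. e \<in> E \<Longrightarrow> Poly_Mapping.keys e \<subseteq> V"
  shows "ideal_power V (genideal (poly_ring V) (mpoly_mon ` E)) t =
    (genideal (poly_ring V) (mpoly_mon ` mon_pow E t) :: ('v, 'k::field) mpoly set)"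
proof (induction t)
  case 0
  have "genideal (poly_ring V) (mpoly_mon ` mon_pow E 0) = (polys V :: ('v, 'k) mpoly set)"
    using genideal_mon_polys[of "mon_pow E 0" V, where 'k='k] by auto
  then show ?case by (simp add: ideal_power_def ideals_set_def nat_pow_def carrier_poly_ring)
next
  case (Suc t)
  have "ideal_power V (genideal (poly_ring V) (mpoly_mon ` E)) (Suc t) =
      ideal_prod (poly_ring V) (ideal_power V (genideal (poly_ring V) (mpoly_mon ` E)) t)
        (genideal (poly_ring V) (mpoly_mon ` E) :: ('v, 'k) mpoly set)"
    by (simp add: ideal_power_def ideals_set_def nat_pow_def)
  also have "\<dots> = genideal (poly_ring V) (mpoly_mon ` mon_pow E (Suc t))"
    unfolding Suc using ideal_prod_mon[OF mon_pow_keys[OF E] E] by simp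
  finally show ?case .
qed

section \<open>Obstructions to Scarf resolutions\<close>

definition basis_chain :: "'a set \<Rightarrow> 'a set \<Rightarrow> 'k::field" where
  "basis_chain \<sigma> = (\<lambda>\<tau>. if \<tau> = \<sigma> then 1 else 0)"

lemma scalar_boundary_basis_chain_eq_0:
  assumes "\<And>u. u \<in> X - \<tau> \<Longrightarrow> insert u \<tau> \<noteq> \<sigma>"
  shows "scalar_boundary X (basis_chain \<sigma>) \<tau> = (0 :: 'k::field)"
  unfolding scalar_boundary_def basis_chain_def
  by (intro sum.neutral ballI) (simp only: assms if_False mult_zero_right)

lemma scalar_boundary_vertex:
  assumes "finite X" "p \<in> X"
  shows "scalar_boundary X (basis_chain {p}) = (\<lambda>\<tau>. if \<tau> = {} then 1 else 0 :: 'k::field)"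
proof
  fix \<tau>
  show "scalar_boundary X (basis_chain {p}) \<tau> = (if \<tau> = {} then 1 else 0 :: 'k)"
  proof (cases "\<tau> = {}")
    case True
    have "scalar_boundary X (basis_chain {p}) {} = (\<Sum>u\<in>X. if u = p then 1 else 0 :: 'k)"
      by (simp add: scalar_boundary_def basis_chain_def face_sign_def)
    then show ?thesis using True assms by simp
  next
    case False
    then have "insert u \<tau> \<noteq> {p}" if "u \<in> X - \<tau>" for u using that by blast
    then have "scalar_boundary X (basis_chain {p}) \<tau> = (0 :: 'k)" by (rule scalar_boundary_basis_chain_eq_0)
    then show ?thesis using False by simp
  qed
qed

lemma scalar_boundary_edge:
  assumes "finite X" "x \<in> X" "y \<in> X" "x \<noteq> y"
  shows "scalar_boundary X (basis_chain {x, y}) =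
    (\<lambda>\<tau>. face_sign x {y} * basis_chain {y} \<tau> + (face_sign y {x} * basis_chain {x} \<tau> :: 'k::field))"
proof
  fix \<tau>
  consider "\<tau> = {x}" | "\<tau> = {y}" | "\<tau> \<noteq> {x}" "\<tau> \<noteq> {y}" by blast
  then show "scalar_boundary X (basis_chain {x, y}) \<tau> =
      face_sign x {y} * basis_chain {y} \<tau> + (face_sign y {x} * basis_chain {x} \<tau> :: 'k)"
  proof cases
    case 1
    have "scalar_boundary X (basis_chain {x, y}) \<tau> = (\<Sum>u\<in>X - {x}. if u = y then face_sign y {x} else 0 :: 'k)"
      unfolding scalar_boundary_def basis_chain_def 1 using assms(4)
      by (intro sum.cong) (auto simp: doubleton_eq_iff)
    then show ?thesis using assms 1 by (simp add: basis_chain_def)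
  next
    case 2
    have "scalar_boundary X (basis_chain {x, y}) \<tau> = (\<Sum>u\<in>X - {y}. if u = x then face_sign x {y} else 0 :: 'k)"
      unfolding scalar_boundary_def basis_chain_def 2 using assms(4)
      by (intro sum.cong) (auto simp: doubleton_eq_iff)
    then show ?thesis using assms 2 by (simp add: basis_chain_def)
  next
    case 3
    have "insert u \<tau> \<noteq> {x, y}" if "u \<in> X - \<tau>" for u
    proof
      assume eq: "insert u \<tau> = {x, y}"
      then have "\<tau> = {x, y} - {u}" "u \<in> {x, y}" using that by auto
      then show False using 3 assms(4) by (auto simp: insert_Diff_if split: if_splits)
    qed
    then have "scalar_boundary X (basis_chain {x, y}) \<tau> = (0 :: 'k)"
      by (rule scalar_boundary_basis_chain_eq_0)
    then show ?thesis using 3 by (simp add: basis_chain_def)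
  qed
qed

text \<open>
  The edges of a path, with signs that orient them consistently, telescope to the difference of the
  end points.
\<close>

lemma path_chain:
  assumes fin: "finite X" and sub: "\<And>\<sigma>. \<sigma> \<in> A \<Longrightarrow> \<sigma> \<subseteq> X"
    and path: "(\<lambda>x y. x \<noteq> y \<and> {x, y} \<in> A)\<^sup>*\<^sup>* p q"
  shows "\<exists>c \<in> scalar_chains A 2. scalar_boundary X c = (\<lambda>\<tau>. basis_chain {q} \<tau> - (basis_chain {p} \<tau> :: 'k::field))"
  using path
proof (induction rule: rtranclp_induct)
  case base
  show ?case by (rule bexI[of _ "\<lambda>_. 0"]) (auto simp: scalar_boundary_def scalar_chains_def)
next
  case (step y z)
  then obtain c where c: "c \<in> scalar_chains A 2"
    "scalar_boundary X c = (\<lambda>\<tau>. basis_chain {y} \<tau> - (basis_chain {p} \<tau> :: 'k))" by blast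
  have yz: "y \<noteq> z" "{y, z} \<in> A" "y \<in> X" "z \<in> X" using step.hyps(2) sub by auto
  define e :: 'k where "e = face_sign y {z}"
  have e: "e * face_sign y {z} = 1" "e * face_sign z {y} = - 1"
    using face_sign_swap[of "{}" z y, where 'k='k] yz(1) by (auto simp: e_def face_sign_def[of _ "{}"])
  let ?c = "\<lambda>\<sigma>. c \<sigma> + e * basis_chain {y, z} \<sigma>"
  have "?c \<in> scalar_chains A 2"
    using c(1) yz by (auto simp: scalar_chains_def basis_chain_def)
  moreover have "scalar_boundary X ?c = (\<lambda>\<tau>. basis_chain {z} \<tau> - basis_chain {p} \<tau>)"
  proof
    fix \<tau>
    have "scalar_boundary X ?c \<tau> = scalar_boundary X c \<tau> + e * scalar_boundary X (basis_chain {y, z}) \<tau>"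
      by (simp add: scalar_boundary_add) (simp add: scalar_boundary_def sum_distrib_left mult.left_commute)
    also have "\<dots> = basis_chain {z} \<tau> - basis_chain {p} \<tau>"
      using e by (simp add: c(2) scalar_boundary_edge[OF fin yz(3,4,1)] distrib_left flip: mult.assoc)
    finally show "scalar_boundary X ?c \<tau> = basis_chain {z} \<tau> - basis_chain {p} \<tau>" .
  qed
  ultimately show ?case by blast
qed

text \<open>
  The difference of the vertices \<open>p\<close> and \<open>q\<close> is a reduced cycle, but no boundary has a nonzero coefficient
  at the isolated vertex \<open>p\<close>.
\<close>

lemma isolated_vertex_obstruction:
  fixes I :: "('v::linorder, 'k::field) mpoly set"
  assumes res: "supports_free_resolution V \<Delta> I" and fin: "finite (Gens V I)"
    and m: "Poly_Mapping.keys m \<subseteq> V"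
    and pq: "{p} \<in> \<Delta>" "{q} \<in> \<Delta>" "p \<noteq> q" "p mdvd m" "q mdvd m"
    and iso: "\<And>w. w \<noteq> p \<Longrightarrow> w mdvd m \<Longrightarrow> {p, w} \<notin> \<Delta>"
  shows False
proof -
  let ?X = "Gens V I"
  have sub: "\<Delta> \<subseteq> Pow ?X"
    using res by (auto simp: supports_free_resolution_def is_subcomplex_def taylor_def)
  define c where "c \<sigma> = basis_chain {p} \<sigma> - (basis_chain {q} \<sigma> :: 'k)" for \<sigma>
  have "c \<in> scalar_chains (below \<Delta> m) (Suc 0)"
    using pq by (auto simp: scalar_chains_def c_def basis_chain_def below_def split: if_splits)
  moreover have "scalar_boundary ?X c = (\<lambda>_. 0)"
  proof
    fix \<tau>
    have "p \<in> ?X" "q \<in> ?X" using pq(1,2) sub by auto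
    then show "scalar_boundary ?X c \<tau> = 0" by (simp add: c_def[abs_def] scalar_boundary_diff scalar_boundary_vertex[OF fin])
  qed
  ultimately obtain d where d: "d \<in> scalar_chains (below \<Delta> m) (Suc (Suc 0))" "scalar_boundary ?X d = c"
    using resolution_strand_exact[OF res fin m] by blast
  have "d (insert w {p}) = 0" if "w \<in> ?X - {p}" for w
  proof (rule ccontr)
    assume "d (insert w {p}) \<noteq> 0"
    then have *: "{p, w} \<in> \<Delta>" "mlcm {p, w} mdvd m"
      using d(1) by (auto simp: scalar_chains_def below_def insert_commute)
    then have "w mdvd m" by (simp add: mlcm_mdvd_iff)
    then show False using iso * that by auto
  qed
  then have "scalar_boundary ?X d {p} = 0" by (simp add: scalar_boundary_def)
  then show False using d(2) pq(3) by (simp add: c_def basis_chain_def)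
qed

text \<open>
  A path from \<open>p\<close> to \<open>q\<close> avoiding the edge \<open>{p, q}\<close> closes up with this edge to a cycle.  Its coefficient
  at \<open>{p, q}\<close> is nonzero, whereas boundaries vanish there because no 2-face contains \<open>{p, q}\<close>.
\<close>

lemma unfilled_cycle_obstruction:
  fixes I :: "('v::linorder, 'k::field) mpoly set"
  assumes res: "supports_free_resolution V \<Delta> I" and fin: "finite (Gens V I)"
    and m: "Poly_Mapping.keys m \<subseteq> V"
    and pq: "p \<noteq> q" "{p, q} \<in> below \<Delta> m"
    and path: "(\<lambda>x y. x \<noteq> y \<and> {x, y} \<in> below \<Delta> m - {{p, q}})\<^sup>*\<^sup>* p q"
    and unfilled: "\<And>r. r mdvd m \<Longrightarrow> r \<noteq> p \<Longrightarrow> r \<noteq> q \<Longrightarrow> {p, q, r} \<notin> \<Delta>"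
  shows False
proof -
  let ?X = "Gens V I"
  have sub: "\<Delta> \<subseteq> Pow ?X"
    using res by (auto simp: supports_free_resolution_def is_subcomplex_def taylor_def)
  have bsub: "\<And>\<sigma>. \<sigma> \<in> below \<Delta> m \<Longrightarrow> \<sigma> \<subseteq> ?X" using sub by (auto simp: below_def)
  obtain c where c: "c \<in> scalar_chains (below \<Delta> m - {{p, q}}) 2"
    "scalar_boundary ?X c = (\<lambda>\<tau>. basis_chain {q} \<tau> - (basis_chain {p} \<tau> :: 'k))"
    using path_chain[OF fin _ path, where 'k='k] bsub by blast
  \<comment> \<open>The edge \<open>{p, q}\<close> itself is a path from \<open>p\<close> to \<open>q\<close>.\<close>
  obtain c' where c': "c' \<in> scalar_chains {{p, q}} 2"
    "scalar_boundary ?X c' = (\<lambda>\<tau>. basis_chain {q} \<tau> - (basis_chain {p} \<tau> :: 'k))"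
    using path_chain[OF fin, of "{{p, q}}" p q, where 'k='k] bsub[OF pq(2)] pq(1) by blast
  have "c' {p, q} \<noteq> 0"
  proof
    assume "c' {p, q} = 0"
    then have "c' = (\<lambda>_. 0)" using c'(1) by (auto simp: scalar_chains_def)
    then have "basis_chain {q} {q} - (basis_chain {p} {q} :: 'k) = 0"
      using fun_cong[OF c'(2), of "{q}"] by (simp add: scalar_boundary_def)
    then show False using pq(1) by (simp add: basis_chain_def)
  qed
  moreover have "c {p, q} = 0" using c(1) by (auto simp: scalar_chains_def)
  ultimately have nz: "c {p, q} - c' {p, q} \<noteq> 0" by simp
  have "(\<lambda>\<sigma>. c \<sigma> - c' \<sigma>) \<in> scalar_chains (below \<Delta> m) (Suc (Suc 0))"
    unfolding scalar_chains_def
  proof (intro CollectI allI impI)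
    fix \<sigma> assume "c \<sigma> - c' \<sigma> \<noteq> 0"
    then have "c \<sigma> \<noteq> 0 \<or> c' \<sigma> \<noteq> 0" by auto
    then show "\<sigma> \<in> below \<Delta> m \<and> card \<sigma> = Suc (Suc 0)"
      using c(1) c'(1) pq(2) by (auto simp: scalar_chains_def)
  qed
  moreover have "scalar_boundary ?X (\<lambda>\<sigma>. c \<sigma> - c' \<sigma>) = (\<lambda>_. 0)"
    by (rule ext) (simp add: scalar_boundary_diff c(2) c'(2))
  ultimately obtain d where d: "d \<in> scalar_chains (below \<Delta> m) (Suc (Suc (Suc 0)))"
    "scalar_boundary ?X d = (\<lambda>\<sigma>. c \<sigma> - c' \<sigma>)"
    using resolution_strand_exact[OF res fin m] by blast
  have "d (insert r {p, q}) = 0" if "r \<in> ?X - {p, q}" for r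
  proof (rule ccontr)
    assume "d (insert r {p, q}) \<noteq> 0"
    then have *: "{p, q, r} \<in> \<Delta>" "mlcm {p, q, r} mdvd m"
      using d(1) by (auto simp: scalar_chains_def below_def insert_commute)
    then have "r mdvd m" by (simp add: mlcm_mdvd_iff)
    then show False using unfilled * that by auto
  qed
  then have "scalar_boundary ?X d {p, q} = 0" by (simp add: scalar_boundary_def)
  then show False using d(2) nz by simp
qed

text \<open>
  When the least common multiples of the pairs \<open>{p, q}\<close> and \<open>{p, r}\<close> are divisible by the third
  generator, neither pair is a Scarf face, so \<open>p\<close> is isolated below \<open>m\<close>.
\<close>

lemma three_generators_obstruction:
  fixes I :: "('v::linorder, 'k::field) mpoly set"
  assumes res: "supports_free_resolution V (scarf_faces B) I" and B: "Gens V I = B" "finite B"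
    "antichain B" "0 \<notin> B" and m: "Poly_Mapping.keys m \<subseteq> V"
    and pqr: "p \<in> B" "q \<in> B" "r \<in> B" "p \<noteq> q" "p \<noteq> r" "q \<noteq> r" "p mdvd m" "q mdvd m"
    and only: "\<And>z. z \<in> B \<Longrightarrow> z mdvd m \<Longrightarrow> z = p \<or> z = q \<or> z = r"
    and lcms: "r mdvd mlcm {p, q}" "q mdvd mlcm {p, r}"
  shows False
proof (rule isolated_vertex_obstruction[OF res _ m, of p q])
  note pair = pair_scarf_face_iff[OF B(3,4)]
  have "{u} \<in> scarf_faces B" if "u \<in> B" for u
    using pair[OF that that] B(3) that by (auto simp: antichain_def)
  then show "{p} \<in> scarf_faces B" "{q} \<in> scarf_faces B" using pqr by blast+
  fix w assume w: "w \<noteq> p" "w mdvd m"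
  show "{p, w} \<notin> scarf_faces B"
  proof
    assume f: "{p, w} \<in> scarf_faces B"
    then have wB: "w \<in> B" by (auto simp: scarf_faces_def)
    then have "w = q \<or> w = r" using only w by blast
    then show False using pair[OF pqr(1) wB] f lcms pqr by auto
  qed
qed (use B pqr in auto)

text \<open>
  The Scarf complex below \<open>m\<close> is the unfilled 4-circuit \<open>p, q, r, s\<close>.
\<close>

lemma four_generators_obstruction:
  fixes I :: "('v::linorder, 'k::field) mpoly set"
  assumes res: "supports_free_resolution V (scarf_faces B) I" and B: "Gens V I = B" "finite B"
    "antichain B" "0 \<notin> B" and m: "Poly_Mapping.keys m \<subseteq> V"
    and pqrs: "p \<in> B" "q \<in> B" "r \<in> B" "s \<in> B" "distinct [p, q, r, s]"
      "p mdvd m" "q mdvd m" "r mdvd m" "s mdvd m"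
    and only: "\<And>z. z \<in> B \<Longrightarrow> z mdvd m \<Longrightarrow> z = p \<or> z = q \<or> z = r \<or> z = s"
    and faces: "\<not> r mdvd mlcm {p, q}" "\<not> s mdvd mlcm {p, q}" "\<not> s mdvd mlcm {q, r}" "\<not> p mdvd mlcm {q, r}"
      "\<not> p mdvd mlcm {r, s}" "\<not> q mdvd mlcm {r, s}" "\<not> q mdvd mlcm {s, p}" "\<not> r mdvd mlcm {s, p}"
    and diagonals: "q mdvd mlcm {p, r}" "p mdvd mlcm {q, s}"
  shows False
proof -
  have face: "{x, y} \<in> below (scarf_faces B) m"
    if xy: "x \<in> B" "y \<in> B" "x mdvd m" "y mdvd m" and no: "\<And>z. z \<in> {p, q, r, s} - {x, y} \<Longrightarrow> \<not> z mdvd mlcm {x, y}" for x y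
  proof -
    have lcm: "mlcm {x, y} mdvd m" using xy by (simp add: mlcm_mdvd_iff)
    have "z = x \<or> z = y" if z: "z \<in> B" "z mdvd mlcm {x, y}" for z
    proof (rule ccontr)
      assume "\<not> (z = x \<or> z = y)"
      moreover have "z \<in> {p, q, r, s}" using only[OF z(1) mdvd_trans[OF z(2) lcm]] by blast
      ultimately show False using no[of z] z(2) by blast
    qed
    then have "{x, y} \<in> scarf_faces B" using pair_scarf_face_iff[OF B(3,4) xy(1,2)] by blast
    then show ?thesis using lcm by (simp add: below_def)
  qed
  have pq: "{p, q} \<in> below (scarf_faces B) m" and qr: "{q, r} \<in> below (scarf_faces B) m"
    and rs: "{r, s} \<in> below (scarf_faces B) m" and sp: "{s, p} \<in> below (scarf_faces B) m"
    using pqrs faces by (auto intro!: face)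
  define R where "R = (\<lambda>x y. x \<noteq> y \<and> {x, y} \<in> below (scarf_faces B) m - {{p, q}})"
  have "R p s" "R s r" "R r q"
    using pqrs(5) sp rs qr by (auto simp: R_def insert_commute doubleton_eq_iff)
  then have "R\<^sup>*\<^sup>* p q" by (meson converse_rtranclp_into_rtranclp rtranclp.rtrancl_refl)
  moreover have "{p, q, z} \<notin> scarf_faces B" if z: "z mdvd m" "z \<noteq> p" "z \<noteq> q" for z
  proof
    assume f: "{p, q, z} \<in> scarf_faces B"
    then have "z \<in> B" by (auto simp: scarf_faces_def)
    then have "z = r \<or> z = s" using only z by blast
    moreover have "{p, q, r} \<notin> scarf_faces B"
      using pqrs diagonals by (intro not_scarf_face[OF B(2), of "{p, r}" _ q]) auto
    moreover have "{p, q, s} \<notin> scarf_faces B"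
      using pqrs diagonals by (intro not_scarf_face[OF B(2), of "{q, s}" _ p]) auto
    ultimately show False using f by blast
  qed
  ultimately show False
    using unfilled_cycle_obstruction[OF res _ m, of p q] B(1,2) pqrs(5) pq unfolding R_def by auto
qed

section \<open>Powers of edge ideals\<close>

definition edge_mon :: "'v \<Rightarrow> 'v \<Rightarrow> 'v monomial" where
  "edge_mon u v = Poly_Mapping.single u 1 + Poly_Mapping.single v 1"

lemma lookup_edge_mon:
  "Poly_Mapping.lookup (edge_mon u v) x = (if x = u then 1 else 0) + (if x = v then 1 else 0)"
  by (simp add: edge_mon_def lookup_add lookup_single when_def)

lemma keys_edge_mon [simp]: "Poly_Mapping.keys (edge_mon u v) = {u, v}"
  by (auto simp: in_keys_iff lookup_edge_mon split: if_splits)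

lemma edge_mon_commute: "edge_mon u v = edge_mon v u"
  by (simp add: edge_mon_def add.commute)

lemma edge_mon_eq_iff: "edge_mon u v = edge_mon x y \<longleftrightarrow> u = x \<and> v = y \<or> u = y \<and> v = x"
proof
  assume "edge_mon u v = edge_mon x y"
  then have "{u, v} = {x, y}" using keys_edge_mon by metis
  then show "u = x \<and> v = y \<or> u = y \<and> v = x" by (auto simp: doubleton_eq_iff)
qed (auto simp: edge_mon_commute)

lemma edge_mon_mdvd_mlcm_iff:
  assumes "finite \<sigma>" "u \<noteq> v"
  shows "edge_mon u v mdvd mlcm \<sigma> \<longleftrightarrow> {u, v} \<subseteq> (\<Union>p\<in>\<sigma>. Poly_Mapping.keys p)"
proof -
  have "edge_mon u v mdvd n \<longleftrightarrow> {u, v} \<subseteq> Poly_Mapping.keys n" for n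
    using assms(2) by (auto simp: mdvd_def lookup_edge_mon in_keys_iff Suc_le_eq split: if_splits)
  then show ?thesis by (simp add: keys_mlcm[OF assms(1)])
qed

lemma sum_lookup_edge_mon:
  "finite S \<Longrightarrow> (\<Sum>x\<in>S. Poly_Mapping.lookup (edge_mon u v) x) =
    (if u \<in> S then 1 else 0) + (if v \<in> S then 1 else 0)"
  by (simp add: lookup_edge_mon sum.distrib)

lemma mon_pow_add: "p \<in> mon_pow E s \<Longrightarrow> q \<in> mon_pow E t \<Longrightarrow> p + q \<in> mon_pow E (s + t)"
proof (induction t arbitrary: q)
  case (Suc t)
  then obtain q' e where "q = q' + e" "q' \<in> mon_pow E t" "e \<in> E" by auto
  then have "p + q' \<in> mon_pow E (s + t)" "p + q = (p + q') + e" using Suc by (auto simp: add.assoc)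
  then show ?case using \<open>e \<in> E\<close> by auto
qed simp

lemma mon_pow_edge_mon:
  "edge_mon u v \<in> E \<Longrightarrow> Poly_Mapping.single u t + Poly_Mapping.single v t \<in> mon_pow E t"
proof (induction t)
  case (Suc t)
  have "Poly_Mapping.single u (Suc t) + Poly_Mapping.single v (Suc t) =
      (Poly_Mapping.single u t + Poly_Mapping.single v t) + edge_mon u v"
    by (rule poly_mapping_eqI) (auto simp: edge_mon_def lookup_add lookup_single when_def)
  then show ?case using Suc by auto
qed simp

text \<open>
  A weight that is constant on the factors inside \<open>W\<close> is multiplied by the number of factors.  With
  vertex sets such as the colour classes of a bipartite graph, this pins down the exponents of the
  generators of a power.
\<close>

lemma mon_pow_weight:
  assumes w: "\<And>e. e \<in> E \<Longrightarrow> Poly_Mapping.keys e \<subseteq> W \<Longrightarrow> (\<Sum>v\<in>S. Poly_Mapping.lookup e v) = k"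
  shows "p \<in> mon_pow E t \<Longrightarrow> Poly_Mapping.keys p \<subseteq> W \<Longrightarrow> (\<Sum>v\<in>S. Poly_Mapping.lookup p v) = t * k"
proof (induction t arbitrary: p)
  case (Suc t)
  then obtain q e where qe: "p = q + e" "q \<in> mon_pow E t" "e \<in> E" by auto
  have "Poly_Mapping.keys q \<subseteq> Poly_Mapping.keys p" "Poly_Mapping.keys e \<subseteq> Poly_Mapping.keys p"
    by (auto simp: qe(1) in_keys_iff lookup_add)
  then have "Poly_Mapping.keys q \<subseteq> W" "Poly_Mapping.keys e \<subseteq> W" using Suc.prems(2) by auto
  then show ?case using Suc.IH[OF qe(2)] w[OF qe(3)] by (simp add: qe(1) lookup_add sum.distrib)
qed simp

locale edge_ideal_graph = pair_graph G for G :: "'v::linorder pair_pre_digraph"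
begin

abbreviation adj :: "'v \<Rightarrow> 'v \<Rightarrow> bool" where
  "adj u v \<equiv> (u, v) \<in> parcs G"

definition edges :: "'v monomial set" where
  "edges = {edge_mon u v | u v. adj u v}"

abbreviation gens :: "nat \<Rightarrow> 'v monomial set" where
  "gens t \<equiv> mon_pow edges t"

text \<open>
  The type argument fixes the coefficient field, which the graph does not determine.
\<close>

definition pow_ideal :: "'k::field itself \<Rightarrow> nat \<Rightarrow> ('v, 'k) mpoly set" where
  "pow_ideal _ t = genideal (poly_ring (pverts G)) (mpoly_mon ` gens t)"

definition scarf_resolved :: "'k::field itself \<Rightarrow> nat \<Rightarrow> bool" where
  "scarf_resolved K t \<longleftrightarrow> supports_free_resolution (pverts G) (scarf_faces (gens t)) (pow_ideal K t)"

lemma adj_sym: "adj u v \<Longrightarrow> adj v u" by (rule arcs_symmetric)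

lemma adj_irrefl [simp]: "\<not> adj u u" using no_loops' by blast

lemma edge_mon_in_edges_iff: "edge_mon u v \<in> edges \<longleftrightarrow> adj u v"
  using adj_sym by (auto simp: edges_def edge_mon_eq_iff)

lemma edges_keys: "e \<in> edges \<Longrightarrow> Poly_Mapping.keys e \<subseteq> pverts G"
  by (auto simp: edges_def dest: in_arcsD1 in_arcsD2)

lemma finite_edges: "finite edges"
proof -
  have "edges = (\<lambda>(u, v). edge_mon u v) ` parcs G" by (auto simp: edges_def)
  then show ?thesis by simp
qed

lemma gens_keys: "p \<in> gens t \<Longrightarrow> Poly_Mapping.keys p \<subseteq> pverts G"
  using edges_keys by (rule mon_pow_keys)

lemma finite_gens: "finite (gens t)" by (rule finite_mon_pow[OF finite_edges])

lemma gens_degree: "p \<in> gens t \<Longrightarrow> (\<Sum>v\<in>pverts G. Poly_Mapping.lookup p v) = t * 2"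
proof (rule mon_pow_weight[where W = UNIV and E = edges])
  fix e assume "e \<in> edges"
  then obtain u v where "e = edge_mon u v" "adj u v" by (auto simp: edges_def)
  then show "(\<Sum>v\<in>pverts G. Poly_Mapping.lookup e v) = 2"
    using in_arcsD1 in_arcsD2 by (auto simp: sum_lookup_edge_mon)
qed auto

text \<open>
  All generators of the \<open>t\<close>-th power have degree \<open>2t\<close>.
\<close>

lemma antichain_gens: "antichain (gens t)"
  unfolding antichain_def
proof (intro ballI impI)
  fix p q assume pq: "p \<in> gens t" "q \<in> gens t" "p mdvd q"
  have "Poly_Mapping.lookup p v = Poly_Mapping.lookup q v" for v
  proof (cases "v \<in> pverts G")
    case True
    have le: "\<And>v. Poly_Mapping.lookup p v \<le> Poly_Mapping.lookup q v" using pq(3) by (simp add: mdvd_def)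
    have "\<not> Poly_Mapping.lookup p v < Poly_Mapping.lookup q v"
    proof
      assume "Poly_Mapping.lookup p v < Poly_Mapping.lookup q v"
      then have "(\<Sum>v\<in>pverts G. Poly_Mapping.lookup p v) < (\<Sum>v\<in>pverts G. Poly_Mapping.lookup q v)"
        using le True by (intro sum_strict_mono_ex1) auto
      then show False using gens_degree pq(1,2) by simp
    qed
    then show ?thesis using le[of v] by simp
  next
    case False
    then have "v \<notin> Poly_Mapping.keys p" "v \<notin> Poly_Mapping.keys q" using gens_keys pq(1,2) by blast+
    then show ?thesis by (simp add: in_keys_iff)
  qed
  then show "p = q" by (rule poly_mapping_eqI)
qed

lemma zero_notin_gens: "0 < t \<Longrightarrow> 0 \<notin> gens t"
  using gens_degree[of 0 t] by auto

lemma Gens_pow_ideal: "Gens (pverts G) (pow_ideal K t) = gens t"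
  unfolding pow_ideal_def using gens_keys antichain_gens by (rule Gens_antichain)

lemma supports_scarf_pow_iff:
  "supports_minimal_free_resolution (pverts G) (scarf (pverts G) (pow_ideal K t)) (pow_ideal K t)
    \<longleftrightarrow> scarf_resolved K t"
  using scarf_resolution_minimal[of "pverts G" "pow_ideal K t"] scarf_eq_scarf_faces[of "pverts G" "pow_ideal K t"]
    gens_keys finite_gens by (simp add: Gens_pow_ideal scarf_resolved_def)

lemma edge_ideal_eq: "edge_ideal G = pow_ideal TYPE('k::field) 1"
proof -
  have "{mpoly_mon (Poly_Mapping.single u 1) * mpoly_mon (Poly_Mapping.single v 1) | u v. adj u v} =
      (mpoly_mon ` edges :: ('v, 'k) mpoly set)"
    by (auto simp: edges_def mpoly_mon_def mult_single edge_mon_def)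
  then show ?thesis by (simp add: edge_ideal_def pow_ideal_def)
qed

lemma ideal_power_eq: "ideal_power (pverts G) (pow_ideal TYPE('k::field) 1) t = pow_ideal TYPE('k) t"
  using ideal_power_mon[of edges "pverts G" t, OF edges_keys, where 'k='k] by (simp add: pow_ideal_def)

lemmas three_gens = three_generators_obstruction[OF _ Gens_pow_ideal finite_gens antichain_gens zero_notin_gens,
    folded scarf_resolved_def]
lemmas four_gens = four_generators_obstruction[OF _ Gens_pow_ideal finite_gens antichain_gens zero_notin_gens,
    folded scarf_resolved_def]
end

section \<open>Obstructions in graphs\<close>

lemma single_Suc: "Poly_Mapping.single v (Suc n) = Poly_Mapping.single v n + Poly_Mapping.single v 1"
  by (simp flip: single_add)

text \<open>
  The monomials \<open>a\<^sup>i b\<^sup>j c\<^sup>k\<close> and \<open>a\<^sup>i b\<^sup>j c\<^sup>k d\<^sup>l\<close>.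
\<close>

definition mono3 :: "'v \<Rightarrow> 'v \<Rightarrow> 'v \<Rightarrow> nat \<Rightarrow> nat \<Rightarrow> nat \<Rightarrow> 'v monomial" where
  "mono3 a b c i j k = Poly_Mapping.single a i + Poly_Mapping.single b j + Poly_Mapping.single c k"

definition mono4 :: "'v \<Rightarrow> 'v \<Rightarrow> 'v \<Rightarrow> 'v \<Rightarrow> nat \<Rightarrow> nat \<Rightarrow> nat \<Rightarrow> nat \<Rightarrow> 'v monomial" where
  "mono4 a b c d i j k l = mono3 a b c i j k + Poly_Mapping.single d l"

lemma lookup_mono3:
  "distinct [a, b, c] \<Longrightarrow> Poly_Mapping.lookup (mono3 a b c i j k) v =
    (if v = a then i else if v = b then j else if v = c then k else 0)"
  by (auto simp: mono3_def lookup_add lookup_single when_def)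

lemma lookup_mono4:
  "distinct [a, b, c, d] \<Longrightarrow> Poly_Mapping.lookup (mono4 a b c d i j k l) v =
    (if v = a then i else if v = b then j else if v = c then k else if v = d then l else 0)"
  by (auto simp: mono4_def lookup_mono3 lookup_add lookup_single when_def)

lemma mono3_expand:
  assumes "distinct [a, b, c]" "Poly_Mapping.keys z \<subseteq> {a, b, c}"
  shows "z = mono3 a b c (Poly_Mapping.lookup z a) (Poly_Mapping.lookup z b) (Poly_Mapping.lookup z c)"
  using assms by (intro poly_mapping_eqI) (auto simp: lookup_mono3 in_keys_iff)

lemma mono4_expand:
  assumes "distinct [a, b, c, d]" "Poly_Mapping.keys z \<subseteq> {a, b, c, d}"
  shows "z = mono4 a b c d (Poly_Mapping.lookup z a) (Poly_Mapping.lookup z b)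
    (Poly_Mapping.lookup z c) (Poly_Mapping.lookup z d)"
  using assms by (intro poly_mapping_eqI) (auto simp: lookup_mono4 in_keys_iff)

lemma mono3_mdvd_iff:
  assumes "distinct [a, b, c]"
  shows "mono3 a b c i j k mdvd mono3 a b c i' j' k' \<longleftrightarrow> i \<le> i' \<and> j \<le> j' \<and> k \<le> k'" (is "?L \<longleftrightarrow> ?R")
proof
  assume L: "?L"
  then have "\<And>v. Poly_Mapping.lookup (mono3 a b c i j k) v \<le> Poly_Mapping.lookup (mono3 a b c i' j' k') v" by (simp add: mdvd_def)
  from this[of a] this[of b] this[of c] show "?R"
    using assms by (auto simp: lookup_mono3[OF assms])
qed (simp add: mdvd_def lookup_mono3[OF assms])

lemma mono4_mdvd_iff:
  assumes "distinct [a, b, c, d]"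
  shows "mono4 a b c d i j k l mdvd mono4 a b c d i' j' k' l' \<longleftrightarrow> i \<le> i' \<and> j \<le> j' \<and> k \<le> k' \<and> l \<le> l'" (is "?L \<longleftrightarrow> ?R")
proof
  assume L: "?L"
  then have "\<And>v. Poly_Mapping.lookup (mono4 a b c d i j k l) v \<le> Poly_Mapping.lookup (mono4 a b c d i' j' k' l') v" by (simp add: mdvd_def)
  from this[of a] this[of b] this[of c] this[of d] show "?R"
    using assms by (auto simp: lookup_mono4[OF assms])
qed (simp add: mdvd_def lookup_mono4[OF assms])

lemma mono3_eq_iff:
  assumes "distinct [a, b, c]"
  shows "mono3 a b c i j k = mono3 a b c i' j' k' \<longleftrightarrow> i = i' \<and> j = j' \<and> k = k'"
  using mono3_mdvd_iff[OF assms, of i j k i' j' k'] mono3_mdvd_iff[OF assms, of i' j' k' i j k] by auto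

lemma mono4_eq_iff:
  assumes "distinct [a, b, c, d]"
  shows "mono4 a b c d i j k l = mono4 a b c d i' j' k' l' \<longleftrightarrow> i = i' \<and> j = j' \<and> k = k' \<and> l = l'"
  using mono4_mdvd_iff[OF assms, of i j k l i' j' k' l'] mono4_mdvd_iff[OF assms, of i' j' k' l' i j k l]
  by auto

lemma lookup_mlcm_pair:
  "Poly_Mapping.lookup (mlcm {p, q}) v = max (Poly_Mapping.lookup p v) (Poly_Mapping.lookup q v)"
  by (simp add: lookup_mlcm)

lemma mlcm_mono3:
  assumes "distinct [a, b, c]"
  shows "mlcm {mono3 a b c i j k, mono3 a b c i' j' k'} = mono3 a b c (max i i') (max j j') (max k k')"
proof (rule poly_mapping_eqI)
  fix v
  consider "v = a" | "v = b" | "v = c" | "v \<notin> {a, b, c}" by blast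
  then show "Poly_Mapping.lookup (mlcm {mono3 a b c i j k, mono3 a b c i' j' k'}) v =
      Poly_Mapping.lookup (mono3 a b c (max i i') (max j j') (max k k')) v"
    unfolding lookup_mlcm_pair lookup_mono3[OF assms] using assms by cases auto
qed

lemma mlcm_mono4:
  assumes "distinct [a, b, c, d]"
  shows "mlcm {mono4 a b c d i j k l, mono4 a b c d i' j' k' l'} =
    mono4 a b c d (max i i') (max j j') (max k k') (max l l')"
proof (rule poly_mapping_eqI)
  fix v
  consider "v = a" | "v = b" | "v = c" | "v = d" | "v \<notin> {a, b, c, d}" by blast
  then show "Poly_Mapping.lookup (mlcm {mono4 a b c d i j k l, mono4 a b c d i' j' k' l'}) v =
      Poly_Mapping.lookup (mono4 a b c d (max i i') (max j j') (max k k') (max l l')) v"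
    unfolding lookup_mlcm_pair lookup_mono4[OF assms] using assms by cases auto
qed

lemma keys_mono3: "Poly_Mapping.keys (mono3 a b c i j k) \<subseteq> {a, b, c}"
  by (auto simp: mono3_def in_keys_iff lookup_add lookup_single when_def split: if_splits)

lemma keys_mono4: "Poly_Mapping.keys (mono4 a b c d i j k l) \<subseteq> {a, b, c, d}"
  by (auto simp: mono4_def mono3_def in_keys_iff lookup_add lookup_single when_def split: if_splits)

context edge_ideal_graph
begin

lemma edge_power_in_gens:
  "adj a b \<Longrightarrow> Poly_Mapping.single a t + Poly_Mapping.single b t \<in> gens t"
  by (rule mon_pow_edge_mon) (simp add: edge_mon_in_edges_iff)

lemma edge_power_times_edge_in_gens:
  assumes "adj a b" "adj u v" "m = Poly_Mapping.single a n + Poly_Mapping.single b n + edge_mon u v" "t = Suc n"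
  shows "m \<in> gens t"
proof -
  have "edge_mon u v \<in> gens 1" using assms(2) by (simp add: edge_mon_in_edges_iff)
  then show ?thesis using mon_pow_add[OF edge_power_in_gens[OF assms(1), of n]] assms(3,4) by fastforce
qed

lemma edge_power_times_two_edges_in_gens:
  assumes "adj a b" "adj u v" "adj x y"
    "m = Poly_Mapping.single a n + Poly_Mapping.single b n + edge_mon u v + edge_mon x y" "t = Suc (Suc n)"
  shows "m \<in> gens t"
proof -
  have "edge_mon x y \<in> gens 1" using assms(3) by (simp add: edge_mon_in_edges_iff)
  then show ?thesis
    using mon_pow_add[OF edge_power_times_edge_in_gens[OF assms(1,2) refl refl]] assms(4,5) by fastforce
qed

lemma gens_weight:
  assumes "finite S" and "\<And>u v. adj u v \<Longrightarrow> u \<in> W \<Longrightarrow> v \<in> W \<Longrightarrow>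
      (if u \<in> S then 1 else 0) + (if v \<in> S then 1 else 0) = (k :: nat)"
    and z: "z \<in> gens t" "Poly_Mapping.keys z \<subseteq> W"
  shows "(\<Sum>v\<in>S. Poly_Mapping.lookup z v) = t * k"
proof (rule mon_pow_weight[OF _ z])
  fix e assume "e \<in> edges" "Poly_Mapping.keys e \<subseteq> W"
  then obtain u v where "e = edge_mon u v" "adj u v" "u \<in> W" "v \<in> W" by (auto simp: edges_def)
  then show "(\<Sum>v\<in>S. Poly_Mapping.lookup e v) = k" using assms(1,2) by (simp add: sum_lookup_edge_mon)
qed

text \<open>
  Below \<open>m = a\<^sup>t b\<^sup>t c\<close> a product of \<open>t\<close> edges has degree \<open>2t\<close>, so it misses \<open>m\<close> by exactly one variable
  \<open>a\<close>, \<open>b\<close> or \<open>c\<close>.  Any two of these three generators have least common multiple \<open>m\<close>.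
\<close>

lemma triangle_obstruction:
  assumes res: "scarf_resolved TYPE('k::field) t" and t: "0 < t" and adj: "adj a b" "adj b c" "adj c a"
  shows False
proof -
  have d: "distinct [a, b, c]" using adj by auto
  obtain s where s: "t = Suc s" using t by (cases t) auto
  show False
  proof (rule three_gens[OF res t, of "mono3 a b c t t 1" "mono3 a b c t t 0" "mono3 a b c s t 1" "mono3 a b c t s 1"])
    show "Poly_Mapping.keys (mono3 a b c t t 1) \<subseteq> pverts G"
      using keys_mono3[of a b c t t 1] adj in_arcsD1 by blast
    show "mono3 a b c t t 0 \<in> gens t"
      using edge_power_in_gens[OF adj(1)] by (simp add: mono3_def)
    show "mono3 a b c s t 1 \<in> gens t"
      by (rule edge_power_times_edge_in_gens[OF adj(1) adj(2), of _ s])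
        (simp_all add: s edge_mon_def mono3_def single_Suc[of _ s] add_ac)
    show "mono3 a b c t s 1 \<in> gens t"
      by (rule edge_power_times_edge_in_gens[OF adj(1) adj(3), of _ s])
        (simp_all add: s edge_mon_def mono3_def single_Suc[of _ s] add_ac)
    fix z assume z: "z \<in> gens t" "z mdvd mono3 a b c t t 1"
    have keys: "Poly_Mapping.keys z \<subseteq> {a, b, c}" using mdvd_keys[OF z(2)] keys_mono3[of a b c t t 1] by blast
    note e = mono3_expand[OF d keys]
    have le: "Poly_Mapping.lookup z a \<le> t" "Poly_Mapping.lookup z b \<le> t" "Poly_Mapping.lookup z c \<le> 1"
      using z(2) by (subst (asm) e, simp only: mono3_mdvd_iff[OF d])+
    have "(\<Sum>v\<in>{a, b, c}. Poly_Mapping.lookup z v) = t * 2"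
      by (rule gens_weight[OF _ _ z(1) keys]) auto
    then have "Poly_Mapping.lookup z a + Poly_Mapping.lookup z b + Poly_Mapping.lookup z c = t * 2"
      using d by simp
    then have "(Poly_Mapping.lookup z a = t \<and> Poly_Mapping.lookup z b = t \<and> Poly_Mapping.lookup z c = 0) \<or>
        (Poly_Mapping.lookup z a = s \<and> Poly_Mapping.lookup z b = t \<and> Poly_Mapping.lookup z c = 1) \<or>
        (Poly_Mapping.lookup z a = t \<and> Poly_Mapping.lookup z b = s \<and> Poly_Mapping.lookup z c = 1)"
      using le s by arith
    then show "z = mono3 a b c t t 0 \<or> z = mono3 a b c s t 1 \<or> z = mono3 a b c t s 1"
      using e by (elim disjE) simp_all
  qed (simp_all add: mono3_eq_iff[OF d] mono3_mdvd_iff[OF d] mlcm_mono3[OF d] s)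
qed

text \<open>
  By \<open>triangle_obstruction\<close> the leaves are pairwise non-adjacent.  Hence a product of \<open>t\<close> edges dividing
  \<open>m = x\<^sup>t a\<^sup>t\<^sup>-\<^sup>1 b c\<close> is \<open>x\<^sup>t\<close> times a monomial of degree \<open>t\<close>, and again it misses \<open>m\<close> by one of the
  variables \<open>a\<close>, \<open>b\<close>, \<open>c\<close>.  The exponent \<open>t - 2\<close> of \<open>a\<close> in one of the generators is why \<open>t \<ge> 2\<close> is needed.
\<close>

lemma claw_obstruction:
  assumes res: "scarf_resolved TYPE('k::field) t" and t: "2 \<le> t"
    and adj: "adj x a" "adj x b" "adj x c" and d: "distinct [a, b, c]"
  shows False
proof -
  obtain s where s: "t = Suc (Suc s)" using that[of "t - 2"] t by arith
  have t0: "0 < t" using t by simp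
  have no: "\<not> adj a b" "\<not> adj b c" "\<not> adj a c" "\<not> adj b a" "\<not> adj c b" "\<not> adj c a"
    using triangle_obstruction[OF res t0] adj adj_sym by blast+
  have dx: "distinct [x, a, b, c]" using d adj by auto
  let ?q = "mono4 x a b c t"
  let ?m = "?q (Suc s) 1 1"
  show False
  proof (rule three_gens[OF res t0, of ?m "?q (Suc s) 1 0" "?q (Suc s) 0 1" "?q s 1 1"])
    show "Poly_Mapping.keys ?m \<subseteq> pverts G"
      using keys_mono4[of x a b c t "Suc s" 1 1] adj in_arcsD1 in_arcsD2 by blast
    show "?q (Suc s) 1 0 \<in> gens t"
      by (rule edge_power_times_edge_in_gens[OF adj(1) adj(2), of _ "Suc s"])
        (simp_all add: s edge_mon_def mono4_def mono3_def single_Suc[of _ s] single_Suc[of _ "Suc s"] add_ac)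
    show "?q (Suc s) 0 1 \<in> gens t"
      by (rule edge_power_times_edge_in_gens[OF adj(1) adj(3), of _ "Suc s"])
        (simp_all add: s edge_mon_def mono4_def mono3_def single_Suc[of _ s] single_Suc[of _ "Suc s"] add_ac)
    show "?q s 1 1 \<in> gens t"
      by (rule edge_power_times_two_edges_in_gens[OF adj(1) adj(2) adj(3), of _ s])
        (simp_all add: s edge_mon_def mono4_def mono3_def single_Suc[of _ s] single_Suc[of _ "Suc s"] add_ac)
    fix z assume z: "z \<in> gens t" "z mdvd ?m"
    have keys: "Poly_Mapping.keys z \<subseteq> {x, a, b, c}" using mdvd_keys[OF z(2)] keys_mono4[of x a b c t "Suc s" 1 1] by blast
    note e = mono4_expand[OF dx keys]
    have le: "Poly_Mapping.lookup z a \<le> Suc s" "Poly_Mapping.lookup z b \<le> 1" "Poly_Mapping.lookup z c \<le> 1"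
      using z(2) by (subst (asm) e, simp only: mono4_mdvd_iff[OF dx])+
    have "(\<Sum>v\<in>{x}. Poly_Mapping.lookup z v) = t * 1"
      by (rule gens_weight[OF _ _ z(1) keys]) (use no dx in auto)
    moreover have "(\<Sum>v\<in>{a, b, c}. Poly_Mapping.lookup z v) = t * 1"
      by (rule gens_weight[OF _ _ z(1) keys]) (use no dx in auto)
    ultimately have "Poly_Mapping.lookup z x = t"
      "Poly_Mapping.lookup z a + Poly_Mapping.lookup z b + Poly_Mapping.lookup z c = t"
      using d by auto
    then have "Poly_Mapping.lookup z x = t \<and>
       ((Poly_Mapping.lookup z a = Suc s \<and> Poly_Mapping.lookup z b = 1 \<and> Poly_Mapping.lookup z c = 0) \<or>
        (Poly_Mapping.lookup z a = Suc s \<and> Poly_Mapping.lookup z b = 0 \<and> Poly_Mapping.lookup z c = 1) \<or>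
        (Poly_Mapping.lookup z a = s \<and> Poly_Mapping.lookup z b = 1 \<and> Poly_Mapping.lookup z c = 1))"
      using le s by arith
    then show "z = ?q (Suc s) 1 0 \<or> z = ?q (Suc s) 0 1 \<or> z = ?q s 1 1"
      using e by (elim conjE disjE) simp_all
  qed (simp_all add: mono4_eq_iff[OF dx] mono4_mdvd_iff[OF dx] mlcm_mono4[OF dx])
qed

text \<open>
  Take \<open>m = a b\<^sup>t c\<^sup>t d\<close>.  Without triangles, the edges among the four vertices join \<open>{a, c}\<close> to \<open>{b, d}\<close>,
  so a generator dividing \<open>m\<close> has degree \<open>t\<close> on both sides and is determined by its exponents at \<open>a\<close>
  and \<open>d\<close>, each \<open>0\<close> or \<open>1\<close>.  The four resulting generators form an unfilled circuit.  The one with both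
  exponents \<open>1\<close> is \<open>(da)(bc)\<^sup>t\<^sup>-\<^sup>1\<close> if \<open>d\<close> and \<open>a\<close> are adjacent, and \<open>(ab)(cd)(bc)\<^sup>t\<^sup>-\<^sup>2\<close> otherwise; this
  is where \<open>t \<ge> 2\<close> or a 4-cycle is needed.
\<close>

lemma square_or_path_obstruction:
  assumes res: "scarf_resolved TYPE('k::field) t" and t: "0 < t"
    and adj: "adj a b" "adj b c" "adj c d" and dist: "distinct [a, b, c, d]"
    and closed: "2 \<le> t \<or> adj d a"
  shows False
proof -
  have no: "\<not> adj a c" "\<not> adj b d" "\<not> adj c a" "\<not> adj d b"
    using triangle_obstruction[OF res t] adj adj_sym by blast+
  obtain s where s: "t = Suc s" using t by (cases t) auto
  let ?q = "mono4 a b c d"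
  show False
  proof (rule four_gens[OF res t, of "?q 1 t t 1" "?q 1 t s 0" "?q 0 t t 0" "?q 0 s t 1" "?q 1 s s 1"])
    show "Poly_Mapping.keys (?q 1 t t 1) \<subseteq> pverts G"
      using keys_mono4[of a b c d 1 t t 1] adj in_arcsD1 in_arcsD2 by blast
    show "?q 1 t s 0 \<in> gens t"
      by (rule edge_power_times_edge_in_gens[OF adj(2) adj(1), of _ s])
        (simp_all add: s edge_mon_def mono4_def mono3_def single_Suc[of _ s] add_ac)
    show "?q 0 t t 0 \<in> gens t"
      using edge_power_in_gens[OF adj(2)] by (simp add: mono4_def mono3_def)
    show "?q 0 s t 1 \<in> gens t"
      by (rule edge_power_times_edge_in_gens[OF adj(2) adj(3), of _ s])
        (simp_all add: s edge_mon_def mono4_def mono3_def single_Suc[of _ s] add_ac)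
    show "?q 1 s s 1 \<in> gens t"
    proof (cases "adj d a")
      case True
      show ?thesis
        by (rule edge_power_times_edge_in_gens[OF adj(2) True, of _ s])
          (simp_all add: s edge_mon_def mono4_def mono3_def single_Suc[of _ s] add_ac)
    next
      case False
      then obtain r where r: "s = Suc r" using closed s by (cases s) auto
      show ?thesis
        by (rule edge_power_times_two_edges_in_gens[OF adj(2) adj(1) adj(3), of _ r])
          (simp_all add: s r edge_mon_def mono4_def mono3_def single_Suc[of _ r] single_Suc[of _ "Suc r"] add_ac)
    qed
    fix z assume z: "z \<in> gens t" "z mdvd ?q 1 t t 1"
    have keys: "Poly_Mapping.keys z \<subseteq> {a, b, c, d}" using mdvd_keys[OF z(2)] keys_mono4[of a b c d 1 t t 1] by blast
    note e = mono4_expand[OF dist keys]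
    have le: "Poly_Mapping.lookup z a \<le> 1" "Poly_Mapping.lookup z d \<le> 1"
      using z(2) by (subst (asm) e, simp only: mono4_mdvd_iff[OF dist])+
    have "(\<Sum>v\<in>{a, c}. Poly_Mapping.lookup z v) = t * 1"
      by (rule gens_weight[OF _ _ z(1) keys]) (use no dist in auto)
    moreover have "(\<Sum>v\<in>{b, d}. Poly_Mapping.lookup z v) = t * 1"
      by (rule gens_weight[OF _ _ z(1) keys]) (use no dist in auto)
    ultimately have "Poly_Mapping.lookup z a + Poly_Mapping.lookup z c = t"
      "Poly_Mapping.lookup z b + Poly_Mapping.lookup z d = t"
      using dist by auto
    then have "Poly_Mapping.lookup z c = t - Poly_Mapping.lookup z a" "Poly_Mapping.lookup z b = t - Poly_Mapping.lookup z d"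
      by auto
    moreover have "Poly_Mapping.lookup z a = 0 \<or> Poly_Mapping.lookup z a = 1" "Poly_Mapping.lookup z d = 0 \<or> Poly_Mapping.lookup z d = 1"
      using le by auto
    ultimately show "z = ?q 1 t s 0 \<or> z = ?q 0 t t 0 \<or> z = ?q 0 s t 1 \<or> z = ?q 1 s s 1"
      using e s by (elim disjE) simp_all
  qed (simp_all add: mono4_eq_iff[OF dist] mono4_mdvd_iff[OF dist] mlcm_mono4[OF dist] s)
qed

text \<open>
  Two edges form a Scarf face iff their end points span no third edge.
\<close>

lemma edge_pair_face_iff:
  assumes "adj u v" "adj w x"
  shows "{edge_mon u v, edge_mon w x} \<in> scarf_faces (gens 1) \<longleftrightarrow>
    (\<forall>y z. adj y z \<and> {y, z} \<subseteq> {u, v, w, x} \<longrightarrow> {y, z} = {u, v} \<or> {y, z} = {w, x})"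
proof -
  have "{edge_mon u v, edge_mon w x} \<in> scarf_faces (gens 1) \<longleftrightarrow>
      (\<forall>e\<in>edges. e mdvd mlcm {edge_mon u v, edge_mon w x} \<longrightarrow> e = edge_mon u v \<or> e = edge_mon w x)"
    using pair_scarf_face_iff[OF antichain_gens zero_notin_gens, of 1 "edge_mon u v" "edge_mon w x"] assms
    by (simp add: edge_mon_in_edges_iff)
  also have "\<dots> \<longleftrightarrow> (\<forall>y z. adj y z \<longrightarrow> edge_mon y z mdvd mlcm {edge_mon u v, edge_mon w x} \<longrightarrow>
      edge_mon y z = edge_mon u v \<or> edge_mon y z = edge_mon w x)"
    by (auto simp: edges_def)
  also have "\<dots> \<longleftrightarrow> (\<forall>y z. adj y z \<and> {y, z} \<subseteq> {u, v, w, x} \<longrightarrow> {y, z} = {u, v} \<or> {y, z} = {w, x})"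
  proof (intro iff_allI)
    fix y z
    have "edge_mon y z mdvd mlcm {edge_mon u v, edge_mon w x} \<longleftrightarrow> {y, z} \<subseteq> {u, v, w, x}" if "adj y z"
    proof -
      have "y \<noteq> z" using that by auto
      then show ?thesis by (simp add: edge_mon_mdvd_mlcm_iff insert_commute)
    qed
    then show "(adj y z \<longrightarrow> edge_mon y z mdvd mlcm {edge_mon u v, edge_mon w x} \<longrightarrow>
        edge_mon y z = edge_mon u v \<or> edge_mon y z = edge_mon w x) \<longleftrightarrow>
      (adj y z \<and> {y, z} \<subseteq> {u, v, w, x} \<longrightarrow> {y, z} = {u, v} \<or> {y, z} = {w, x})"
      by (simp only: edge_mon_eq_iff doubleton_eq_iff) blast
  qed
  finally show ?thesis .
qed

lemma induced_path_face:
  assumes "adj u v" "adj v w" "u \<noteq> w" "\<not> adj u w"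
  shows "{edge_mon u v, edge_mon v w} \<in> scarf_faces (gens 1)"
proof -
  have "\<not> adj w u" using assms(4) adj_sym by blast
  then show ?thesis unfolding edge_pair_face_iff[OF assms(1,2)] using assms by auto
qed

lemma gap_face:
  assumes "adj u v" "adj w x" "\<not> adj u w" "\<not> adj u x" "\<not> adj v w" "\<not> adj v x"
  shows "{edge_mon u v, edge_mon w x} \<in> scarf_faces (gens 1)"
proof -
  have "\<not> adj w u" "\<not> adj x u" "\<not> adj w v" "\<not> adj x v" using assms adj_sym by blast+
  then show ?thesis unfolding edge_pair_face_iff[OF assms(1,2)] using assms by auto
qed

lemma edge_triple_not_face:
  assumes "adj u v" "{u, v} \<subseteq> {w, x, y, z}" "edge_mon u v \<noteq> edge_mon w x" "edge_mon u v \<noteq> edge_mon y z"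
    "edge_mon w x \<in> \<sigma>" "edge_mon y z \<in> \<sigma>"
  shows "\<sigma> \<notin> scarf_faces (gens 1)"
proof (rule not_scarf_face[OF finite_gens, of "{edge_mon w x, edge_mon y z}" _ "edge_mon u v"])
  have "u \<noteq> v" using assms(1) by auto
  then show "edge_mon u v mdvd mlcm {edge_mon w x, edge_mon y z}"
    using assms(2) by (simp add: edge_mon_mdvd_mlcm_iff insert_commute)
  show "edge_mon u v \<notin> {edge_mon w x, edge_mon y z}"
    using assms(3,4) by blast
qed (use assms in \<open>auto simp: edge_mon_in_edges_iff\<close>)

text \<open>
  Let \<open>m\<close> be the product of the five vertices.  Consecutive edges of the path, and also of the pentagon,
  span no third edge and so form Scarf faces; if there is no edge \<open>ea\<close>, the gap formed by \<open>ab\<close> and \<open>de\<close>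
  closes the circuit instead.  The pair \<open>ab\<close>, \<open>bc\<close> lies in no Scarf face with a third edge, because two
  of the three edges involved always cover another edge.
\<close>

lemma pentagon_or_gap_obstruction:
  assumes res: "scarf_resolved TYPE('k::field) 1"
    and adj: "adj a b" "adj b c" "adj c d" "adj d e" and dist: "distinct [a, b, c, d, e]"
    and closed: "adj e a \<or> \<not> adj a d \<and> \<not> adj a e \<and> \<not> adj b d \<and> \<not> adj b e"
  shows False
proof -
  note tri = triangle_obstruction[OF res zero_less_one]
  have no: "\<not> adj a c" "\<not> adj a d" "\<not> adj b d" "\<not> adj b e" "\<not> adj c e"
    using tri closed adj adj_sym by blast+
  then have no': "\<not> adj c a" "\<not> adj d a" "\<not> adj d b" "\<not> adj e b" "\<not> adj e c" using adj_sym by blast+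
  define W where "W = {a, b, c, d, e}"
  define m where "m = mlcm {edge_mon a b, edge_mon c d, edge_mon d e}"
  have keys_m: "Poly_Mapping.keys m = W" by (auto simp: m_def keys_mlcm W_def)
  have m_iff: "edge_mon x y mdvd m \<longleftrightarrow> {x, y} \<subseteq> W" if "adj x y" for x y
  proof -
    have "x \<noteq> y" using that by auto
    then show ?thesis unfolding m_def by (simp add: edge_mon_mdvd_mlcm_iff W_def insert_commute)
  qed
  define \<Delta> where "\<Delta> = scarf_faces (gens 1)"
  have below: "{edge_mon w x, edge_mon y z} \<in> below \<Delta> m"
    if "{edge_mon w x, edge_mon y z} \<in> \<Delta>" "adj w x" "adj y z" "{w, x, y, z} \<subseteq> W" for w x y z
    using that m_iff by (simp add: below_def mlcm_mdvd_iff)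
  have pq: "{edge_mon a b, edge_mon b c} \<in> below \<Delta> m"
    using induced_path_face[of a b c] adj dist no by (intro below) (auto simp: \<Delta>_def W_def)
  have qr: "{edge_mon b c, edge_mon c d} \<in> below \<Delta> m"
    using induced_path_face[of b c d] adj dist no by (intro below) (auto simp: \<Delta>_def W_def)
  have rs: "{edge_mon c d, edge_mon d e} \<in> below \<Delta> m"
    using induced_path_face[of c d e] adj dist no by (intro below) (auto simp: \<Delta>_def W_def)
  define R where "R = (\<lambda>x y. x \<noteq> y \<and> {x, y} \<in> below \<Delta> m - {{edge_mon a b, edge_mon b c}})"
  have R1: "R (edge_mon d e) (edge_mon c d)" and R2: "R (edge_mon c d) (edge_mon b c)"
    using qr rs dist by (auto simp: R_def insert_commute edge_mon_eq_iff doubleton_eq_iff)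
  have R0: "R\<^sup>*\<^sup>* (edge_mon a b) (edge_mon d e)"
  proof (cases "adj e a")
    case True
    have "{edge_mon d e, edge_mon e a} \<in> below \<Delta> m"
      using induced_path_face[of d e a] True adj dist no' by (intro below) (auto simp: \<Delta>_def W_def)
    moreover have "{edge_mon e a, edge_mon a b} \<in> below \<Delta> m"
      using induced_path_face[of e a b] True adj dist no' by (intro below) (auto simp: \<Delta>_def W_def)
    ultimately have "R (edge_mon a b) (edge_mon e a)" "R (edge_mon e a) (edge_mon d e)"
      using dist by (auto simp: R_def insert_commute edge_mon_eq_iff doubleton_eq_iff)
    then show ?thesis by (meson converse_rtranclp_into_rtranclp rtranclp.rtrancl_refl)
  next
    case False
    then have "{edge_mon a b, edge_mon d e} \<in> below \<Delta> m"
      using gap_face[of a b d e] adj closed by (intro below) (auto simp: \<Delta>_def W_def)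
    then have "R (edge_mon a b) (edge_mon d e)"
      using dist by (auto simp: R_def edge_mon_eq_iff doubleton_eq_iff)
    then show ?thesis by blast
  qed
  have path: "R\<^sup>*\<^sup>* (edge_mon a b) (edge_mon b c)"
    using R0 R1 R2 by (meson rtranclp.rtrancl_into_rtrancl)
  have unfilled: "{edge_mon a b, edge_mon b c, r} \<notin> \<Delta>"
    if r: "r mdvd m" "r \<noteq> edge_mon a b" "r \<noteq> edge_mon b c" for r
  proof
    assume f: "{edge_mon a b, edge_mon b c, r} \<in> \<Delta>"
    then have "r \<in> edges" by (auto simp: \<Delta>_def scarf_faces_def)
    then obtain x y where xy: "r = edge_mon x y" "adj x y" by (auto simp: edges_def)
    then have "{x, y} \<subseteq> W" using r(1) m_iff by blast
    then have "x \<in> {a, b, c, d, e}" "y \<in> {a, b, c, d, e}" by (auto simp: W_def)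
    then have "r = edge_mon c d \<or> r = edge_mon d e \<or> r = edge_mon e a"
      using xy r(2,3) no no' by (elim insertE emptyE) (simp_all add: edge_mon_eq_iff)
    then show False
    proof (elim disjE)
      assume r: "r = edge_mon c d"
      then have "{edge_mon a b, edge_mon b c, r} \<notin> scarf_faces (gens 1)"
        using adj dist by (intro edge_triple_not_face[of b c a b c d]) (auto simp: edge_mon_eq_iff)
      then show False using f by (simp add: \<Delta>_def)
    next
      assume "r = edge_mon d e"
      then have "{edge_mon a b, edge_mon b c, r} \<notin> scarf_faces (gens 1)"
        using adj dist by (intro edge_triple_not_face[of c d b c d e]) (auto simp: edge_mon_eq_iff)
      then show False using f by (simp add: \<Delta>_def)
    next
      assume "r = edge_mon e a"
      then have "{edge_mon a b, edge_mon b c, r} \<notin> scarf_faces (gens 1)"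
        using adj dist by (intro edge_triple_not_face[of a b b c e a]) (auto simp: edge_mon_eq_iff)
      then show False using f by (simp add: \<Delta>_def)
    qed
  qed
  show False
  proof (rule unfilled_cycle_obstruction[OF _ _ _ _ pq path[unfolded R_def] unfilled])
    show "supports_free_resolution (pverts G) \<Delta> (pow_ideal TYPE('k) 1)"
      using res by (simp add: scarf_resolved_def \<Delta>_def)
    show "finite (Gens (pverts G) (pow_ideal TYPE('k) 1))" by (simp add: Gens_pow_ideal finite_edges)
    show "Poly_Mapping.keys m \<subseteq> pverts G"
      unfolding keys_m W_def using adj in_arcsD1 in_arcsD2 by blast
    show "edge_mon a b \<noteq> edge_mon b c" using dist by (auto simp: edge_mon_eq_iff)
  qed
qed

section \<open>Gap-free graphs and forests\<close>

text \<open>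
  The absence of 3-, 4- and 5-cycles.  In a gap-free graph this already excludes all cycles.
\<close>

definition short_cycle_free :: bool where
  "short_cycle_free \<longleftrightarrow>
     (\<forall>a b c. adj a b \<and> adj b c \<longrightarrow> \<not> adj c a) \<and>
     (\<forall>a b c d. distinct [a, b, c, d] \<and> adj a b \<and> adj b c \<and> adj c d \<longrightarrow> \<not> adj d a) \<and>
     (\<forall>a b c d e. distinct [a, b, c, d, e] \<and> adj a b \<and> adj b c \<and> adj c d \<and> adj d e \<longrightarrow> \<not> adj e a)"

lemma resolved_short_cycle_free:
  assumes "scarf_resolved TYPE('k::field) 1"
  shows short_cycle_free
  unfolding short_cycle_free_def
  using triangle_obstruction[OF assms zero_less_one] square_or_path_obstruction[OF assms zero_less_one]
    pentagon_or_gap_obstruction[OF assms] by blast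

text \<open>
  Induction along a path from \<open>x1\<close> to \<open>y1\<close>.  If the edges \<open>x1 x2\<close> and \<open>z y2\<close> formed a gap although
  \<open>x1 x2\<close> is joined to the preceding edge \<open>y z\<close>, the joining edge would have to end at \<open>y\<close>, giving a path
  \<open>x' - x - y - z - y2\<close> with a gap between its end edges.
\<close>

lemma resolved_gap_free:
  assumes res: "scarf_resolved TYPE('k::field) 1"
  shows "gap_free G"
proof -
  have "\<exists>x\<in>{x1, x2}. \<exists>y\<in>{y1, y2}. adj x y"
    if x: "adj x1 x2" and y: "adj y1 y2" and "reachable (with_proj G) x1 y1" for x1 x2 y1 y2
    using that(3) y
  proof (induction arbitrary: y2 rule: reachable_induct)
    case base
    then show ?case by blast
  next
    case (step y z)
    have yz: "adj y z" using step.hyps(2) by simp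
    show ?case
    proof (rule ccontr)
      assume gap: "\<not> (\<exists>x\<in>{x1, x2}. \<exists>w\<in>{z, y2}. adj x w)"
      obtain x where "x \<in> {x1, x2}" "adj x y" using step.IH[OF yz] gap by blast
      then obtain x' where x': "{x', x} = {x1, x2}" "adj x' x" "adj x y" using x adj_sym by blast
      have gap': "\<not> adj x z" "\<not> adj x y2" "\<not> adj x' z" "\<not> adj x' y2" using gap x'(1) by blast+
      have "distinct [x', x, y, z, y2]"
        using gap' x' yz step.prems adj_sym by (auto dest: adj_sym)
      then show False
        using pentagon_or_gap_obstruction[OF res x'(2,3) yz step.prems] gap' by blast
    qed
  qed
  then show ?thesis unfolding gap_free_def by blast
qed

lemma forest_short_cycle_free:
  assumes "undirected_forest G"
  shows short_cycle_free
proof -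
  have no: "\<not> cycle p" if "3 \<le> length p" for p
    using assms that unfolding undirected_forest_def by blast
  have "\<not> adj c a" if "adj a b" "adj b c" for a b c
    using no[of "[(a, b), (b, c), (c, a)]"] that in_arcsD1 adj_irrefl
    by (auto simp: cycle_def awalk_def)
  moreover have "\<not> adj d a" if "distinct [a, b, c, d]" "adj a b" "adj b c" "adj c d" for a b c d
    using no[of "[(a, b), (b, c), (c, d), (d, a)]"] that in_arcsD1
    by (auto simp: cycle_def awalk_def)
  moreover have "\<not> adj e a" if "distinct [a, b, c, d, e]" "adj a b" "adj b c" "adj c d" "adj d e" for a b c d e
    using no[of "[(a, b), (b, c), (c, d), (d, e), (e, a)]"] that in_arcsD1
    by (auto simp: cycle_def awalk_def)
  ultimately show ?thesis unfolding short_cycle_free_def by blast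
qed

text \<open>
  In a cycle \<open>u, v1, v2, v3, v4, \<dots>\<close> of length at least 5, gap-freeness joins the edges \<open>u v1\<close> and \<open>v3 v4\<close>,
  and the joining edge closes a cycle of length at most 5.
\<close>

lemma gap_free_forest:
  assumes gf: "gap_free G" and scf: short_cycle_free
  shows "undirected_forest G"
  unfolding undirected_forest_def
proof
  assume "\<exists>p. pre_digraph.cycle (with_proj G) p \<and> 3 \<le> length p"
  then obtain p u where p: "awalk u p u" "distinct (tl (pawalk_verts u p))" "3 \<le> length p"
    by (auto simp: cycle_def)
  have tri: "\<And>a b c. adj a b \<Longrightarrow> adj b c \<Longrightarrow> \<not> adj c a"
    and sq: "\<And>a b c d. distinct [a, b, c, d] \<Longrightarrow> adj a b \<Longrightarrow> adj b c \<Longrightarrow> adj c d \<Longrightarrow> \<not> adj d a"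
    and pent: "\<And>a b c d e. distinct [a, b, c, d, e] \<Longrightarrow> adj a b \<Longrightarrow> adj b c \<Longrightarrow> adj c d \<Longrightarrow> adj d e \<Longrightarrow> \<not> adj e a"
    using scf unfolding short_cycle_free_def by blast+
  from p(3) obtain e1 e2 e3 ps where p3: "p = e1 # e2 # e3 # ps"
    by (metis Suc_le_length_iff numeral_3_eq_3)
  obtain v1 v2 v3 where v: "e1 = (u, v1)" "e2 = (v1, v2)" "e3 = (v2, v3)"
    "adj u v1" "adj v1 v2" "adj v2 v3" "pcas v3 ps u"
    using p(1) unfolding p3 awalk_def by (cases e1, cases e2, cases e3) auto
  show False
  proof (cases ps)
    case Nil
    then have "v3 = u" using v(7) by simp
    then show False using v(4-6) tri by blast
  next
    case (Cons e4 qs)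
    then obtain v4 where v4: "e4 = (v3, v4)" "adj v3 v4" "pcas v4 qs u"
      using p(1) v unfolding p3 awalk_def by (cases e4) auto
    show False
    proof (cases qs)
      case Nil
      then have "v4 = u" using v4(3) by simp
      moreover have "distinct [v1, v2, v3, v4]"
        using p(2) Cons Nil unfolding p3 by (simp add: v(1-3) v4(1))
      ultimately show False using sq[of v1 v2 v3 v4] v(4-6) v4(2) by blast
    next
      case (Cons e5 rs)
      have "u \<in> set (pawalk_verts v rs)" if "pcas v rs u" for v
        using that by (induction rs arbitrary: v) auto
      then have d: "distinct [u, v1, v2, v3, v4]"
        using p(2) v4(3) \<open>ps = e4 # qs\<close> Cons unfolding p3
        by (cases e5) (auto simp: v(1-3) v4(1))
      have "reachable (with_proj G) u v3"
        using v(4-6) by (meson reachable_adjI reachable_trans)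
      then have "\<exists>x\<in>{u, v1}. \<exists>y\<in>{v3, v4}. adj x y"
        using gf v(4) v4(2) unfolding gap_free_def by blast
      then show False
      proof (elim bexE insertE emptyE; hypsubst)
        assume "adj u v3"
        moreover have "distinct [u, v1, v2, v3]" using d by simp
        ultimately show False using sq v(4-6) adj_sym by blast
      next
        assume "adj u v4"
        then show False using pent[OF d] v(4-6) v4(2) adj_sym by blast
      next
        assume "adj v1 v3"
        then show False using tri v(4-6) adj_sym by blast
      next
        assume "adj v1 v4"
        moreover have "distinct [v1, v2, v3, v4]" using d by simp
        ultimately show False using sq v(4-6) v4(2) adj_sym by blast
      qed
    qed
  qed
qed

section \<open>Cones over dominating edges\<close>

lemma scarf_resolvedI:
  assumes t: "0 < t" and acyclic: "\<And>m u. u \<in> gens t \<Longrightarrow> u mdvd m \<Longrightarrow>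
    acyclic_complex TYPE('k::field) (gens t) (below (scarf_faces (gens t)) m)"
  shows "scarf_resolved TYPE('k) t"
  unfolding scarf_resolved_def
proof (rule supports_resolution_if_acyclic[OF Gens_pow_ideal _ finite_gens gens_keys scarf_faces_sub])
  show "pow_ideal TYPE('k) t = genideal (poly_ring (pverts G)) (mpoly_mon ` gens t)"
    by (simp add: pow_ideal_def)
  show "Pow \<sigma> \<subseteq> scarf_faces (gens t)" if "\<sigma> \<in> scarf_faces (gens t)" for \<sigma>
    using scarf_faces_closed[OF finite_gens that] by blast
  show "{} \<in> scarf_faces (gens t)" using zero_notin_gens[OF t] by (rule empty_scarf_face)
qed (use acyclic in auto)

text \<open>
  Among the edges inside \<open>W\<close> in the component of \<open>x0\<close>, take one that meets as many others as possible.
  If it misses an edge \<open>b b'\<close>, gap-freeness provides an edge \<open>a b\<close> joining the two.  This edge meets \<open>b b'\<close>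
  and, in the absence of short cycles, everything that the original edge \<open>a a'\<close> meets, contradicting
  maximality.
\<close>

lemma dominating_edge:
  assumes gf: "gap_free G" and scf: short_cycle_free
    and xy0: "adj x0 y0" "x0 \<in> W" "y0 \<in> W"
  obtains x y where "adj x y" "x \<in> W" "y \<in> W" "reachable (with_proj G) x0 x"
    "\<And>z w. adj z w \<Longrightarrow> z \<in> W \<Longrightarrow> w \<in> W \<Longrightarrow> reachable (with_proj G) x0 z \<Longrightarrow> {x, y} \<inter> {z, w} \<noteq> {}"
proof -
  have tri: "\<And>a b c. adj a b \<Longrightarrow> adj b c \<Longrightarrow> \<not> adj c a"
    and sq: "\<And>a b c d. distinct [a, b, c, d] \<Longrightarrow> adj a b \<Longrightarrow> adj b c \<Longrightarrow> adj c d \<Longrightarrow> \<not> adj d a"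
    and pent: "\<And>a b c d e. distinct [a, b, c, d, e] \<Longrightarrow> adj a b \<Longrightarrow> adj b c \<Longrightarrow> adj c d \<Longrightarrow> adj d e \<Longrightarrow> \<not> adj e a"
    using scf unfolding short_cycle_free_def by blast+
  define F where "F = {(x, y). adj x y \<and> x \<in> W \<and> y \<in> W \<and> reachable (with_proj G) x0 x}"
  define T where "T p = {q \<in> F. {fst p, snd p} \<inter> {fst q, snd q} \<noteq> {}}" for p
  have finF: "finite F" by (rule finite_subset[of _ "parcs G"]) (auto simp: F_def)
  have finT: "finite (T p)" for p using finF by (simp add: T_def)
  have F_sym: "(y, x) \<in> F" if "(x, y) \<in> F" for x y
    using that adj_sym reachable_adj_trans by (auto simp: F_def)
  have F_adj: "adj x y" if "(x, y) \<in> F" for x y using that by (simp add: F_def)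
  have gap: "\<exists>a\<in>{x, y}. \<exists>b\<in>{z, w}. adj a b" if "(x, y) \<in> F" "(z, w) \<in> F" for x y z w
  proof -
    have "reachable (with_proj G) x z"
      using that symmetric_reachable' reachable_trans unfolding F_def by blast
    then show ?thesis using gf that unfolding gap_free_def F_def by blast
  qed
  have "(x0, y0) \<in> F" using xy0 in_arcsD1 by (auto simp: F_def)
  then have "(card \<circ> T) ` F \<noteq> {}" "finite ((card \<circ> T) ` F)" using finF by auto
  then have "Max ((card \<circ> T) ` F) \<in> (card \<circ> T) ` F" by (intro Max_in)
  then obtain x y where xy: "(x, y) \<in> F" "card (T (x, y)) = Max ((card \<circ> T) ` F)" by auto
  have max: "card (T q) \<le> card (T (x, y))" if "q \<in> F" for q
    using that finF unfolding xy(2) by (intro Max_ge) auto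
  have no: False
    if ab: "(a, a') \<in> F" "(b, b') \<in> F" "{a, a'} = {x, y}" "{a, a'} \<inter> {b, b'} = {}" "adj a b" for a a' b b'
  proof -
    have ab_F: "(a, b) \<in> F" using ab by (auto simp: F_def)
    \<comment> \<open>An edge that meets \<open>a a'\<close> but not \<open>a b\<close> has the form \<open>a' v\<close>; joining it to
      the edge \<open>b b'\<close> closes a cycle of length 3, 4 or 5.\<close>
    have touch: "q \<in> T (a, b)" if q: "q \<in> T (x, y)" for q
    proof (rule ccontr)
      assume not: "q \<notin> T (a, b)"
      obtain q1 q2 where q12: "q = (q1, q2)" by (cases q)
      have qF: "(q1, q2) \<in> F" using q q12 by (simp add: T_def)
      have "{a, a'} \<inter> {q1, q2} \<noteq> {}" using q ab(3) by (simp add: T_def q12)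
      moreover have "{a, b} \<inter> {q1, q2} = {}" using not qF by (simp add: T_def q12)
      ultimately obtain v where v: "(a', v) \<in> F" "v \<noteq> a" "v \<noteq> b" using qF F_sym[OF qF] by auto
      have e: "adj a a'" "adj b b'" "adj a' v" by (fact F_adj[OF ab(1)] F_adj[OF ab(2)] F_adj[OF v(1)])+
      have e': "adj a' a" "adj b' b" "adj b a" using e(1,2) ab(5) by (simp_all add: adj_sym)
      have d: "a \<noteq> b" "a \<noteq> b'" "a' \<noteq> b" "a' \<noteq> b'" using ab(4) by auto
      have d': "a \<noteq> a'" "b \<noteq> b'" "v \<noteq> a'" using e adj_irrefl by metis+
      have no1: "\<not> adj a' b" using tri[OF e(1)] e'(3) by blast
      have no2: "\<not> adj a' b'"
        using sq[of a' a b b'] d d' e'(1) ab(5) e(2) adj_sym[of a' b'] by auto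
      have no3: "\<not> adj v b"
        using sq[of v a' a b] d d' v(2,3) adj_sym[OF e(3)] e'(1) ab(5) adj_sym[of v b] by auto
      have "v \<noteq> b'" using no2 e(3) by blast
      then have no4: "\<not> adj v b'"
        using pent[of v a' a b b'] d d' v(2,3) adj_sym[OF e(3)] e'(1) ab(5) e(2) adj_sym[of v b'] by auto
      show False using gap[OF v(1) ab(2)] no1 no2 no3 no4 by blast
    qed
    moreover have "(b, b') \<in> T (a, b)" "(b, b') \<notin> T (x, y)" using ab(2-4) by (auto simp: T_def)
    ultimately have "T (x, y) \<subset> T (a, b)" by blast
    then have "card (T (x, y)) < card (T (a, b))" by (rule psubset_card_mono[OF finT])
    then show False using max[OF ab_F] by simp
  qed
  have "{x, y} \<inter> {z, w} \<noteq> {}" if zw: "(z, w) \<in> F" for z w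
  proof
    assume disj: "{x, y} \<inter> {z, w} = {}"
    obtain a b where ab: "a \<in> {x, y}" "b \<in> {z, w}" "adj a b" using gap[OF xy(1) zw] by blast
    obtain a' where a': "(a, a') \<in> F" "{a, a'} = {x, y}" using ab(1) xy(1) F_sym[OF xy(1)] by auto
    obtain b' where b': "(b, b') \<in> F" "{b, b'} = {z, w}" using ab(2) zw F_sym[OF zw] by auto
    have "{a, a'} \<inter> {b, b'} = {}" unfolding a'(2) b'(2) by (rule disj)
    then show False by (rule no[OF a'(1) b'(1) a'(2) _ ab(3)])
  qed
  then show ?thesis using that[of x y] xy(1) by (auto simp: F_def)
qed

text \<open>
  The Scarf complex below \<open>m\<close> is a cone over a dominating edge \<open>e = xy\<close> inside the support of \<open>m\<close>.  Suppose that adding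
  \<open>e\<close> to a Scarf face \<open>\<sigma>\<close> makes some edge \<open>pq \<noteq> e\<close> covered by the other edges.  Then one end of it, say \<open>p\<close>, is an end
  of \<open>e\<close> not covered by \<open>\<sigma> - {pq}\<close>, while \<open>q\<close> lies on another edge \<open>qw\<close> of \<open>\<sigma>\<close>.  Since \<open>e\<close> meets \<open>qw\<close> and
  \<open>w \<noteq> p\<close>, the vertex \<open>w\<close> is the other end of \<open>e\<close>, and \<open>p\<close>, \<open>q\<close>, \<open>w\<close> form a triangle.
\<close>

lemma gap_free_forest_resolved:
  assumes gf: "gap_free G" and scf: short_cycle_free
  shows "scarf_resolved TYPE('k::field) 1"
proof (rule scarf_resolvedI[OF zero_less_one])
  fix m u assume u: "u \<in> gens 1" "u mdvd m"
  let ?\<Delta> = "scarf_faces (gens 1)"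
  define W where "W = Poly_Mapping.keys m"
  have keys_W: "Poly_Mapping.keys g \<subseteq> W" if "g mdvd m" for g unfolding W_def using that by (rule mdvd_keys)
  from u(1) obtain x0 y0 where u': "u = edge_mon x0 y0" "adj x0 y0" by (auto simp: edges_def)
  then have "x0 \<in> W" "y0 \<in> W" using keys_W[OF u(2)] by auto
  from dominating_edge[OF gf scf u'(2) this] obtain x y where xy: "adj x y" "x \<in> W" "y \<in> W"
    and rx: "reachable (with_proj G) x0 x"
    and dom: "\<And>z w. adj z w \<Longrightarrow> z \<in> W \<Longrightarrow> w \<in> W \<Longrightarrow> reachable (with_proj G) x0 z \<Longrightarrow> {x, y} \<inter> {z, w} \<noteq> {}"
    by blast
  have ry: "reachable (with_proj G) x0 y" using rx xy(1) by (simp add: reachable_adj_trans)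
  define e where "e = edge_mon x y"
  have e: "e \<in> gens 1" by (simp add: e_def edge_mon_in_edges_iff xy(1))
  have e_dvd: "e mdvd m"
    using xy unfolding mdvd_def e_def lookup_edge_mon W_def by (auto simp: in_keys_iff Suc_le_eq)
  show "acyclic_complex TYPE('k) (gens 1) (below ?\<Delta> m)"
  proof (rule cone_acyclic[OF finite_gens _ e])
    show "\<sigma> \<subseteq> gens 1" if "\<sigma> \<in> below ?\<Delta> m" for \<sigma> using that by (auto simp: below_def scarf_faces_def)
    fix \<sigma> assume "\<sigma> \<in> below ?\<Delta> m"
    then have \<sigma>: "\<sigma> \<in> ?\<Delta>" and dvd: "mlcm \<sigma> mdvd m" by (auto simp: below_def)
    have sub: "\<sigma> \<subseteq> gens 1" using \<sigma> by (auto simp: scarf_faces_def)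
    have fin: "finite \<sigma>" by (rule finite_subset[OF sub finite_gens])
    have not: "\<not> g mdvd mlcm (\<sigma> - {g})" if "g \<in> gens 1" for g using \<sigma> that by (auto simp: scarf_faces_def)
    have no: False
      if pq: "adj p q" "edge_mon p q \<noteq> e" and U: "U = (\<Union>g\<in>\<sigma> - {edge_mon p q}. Poly_Mapping.keys g)"
        and p: "p \<notin> U" and cover: "{p, q} \<subseteq> {x, y} \<union> U" for p q U
    proof -
      have "p \<in> {x, y}" using p cover by blast
      then obtain p' where p': "{p, p'} = {x, y}" "adj p' p" using xy(1) adj_sym by blast
      have "p \<noteq> q" using pq(1) by auto
      have "q \<notin> {x, y}"
      proof
        assume "q \<in> {x, y}"
        then have "{p, q} = {x, y}" using \<open>p \<in> {x, y}\<close> \<open>p \<noteq> q\<close> by auto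
        then show False using pq(2) by (auto simp: e_def edge_mon_eq_iff doubleton_eq_iff)
      qed
      then have "q \<in> U" using cover by blast
      then obtain g where g: "g \<in> \<sigma>" "g \<noteq> edge_mon p q" "q \<in> Poly_Mapping.keys g" unfolding U by blast
      have "g \<in> edges" using g(1) sub by auto
      then obtain r s where rs: "g = edge_mon r s" "adj r s" by (auto simp: edges_def)
      then have "q = r \<or> q = s" using g(3) by simp
      then obtain w where w: "g = edge_mon q w" "adj q w"
        using rs adj_sym[OF rs(2)] edge_mon_commute by metis
      have "w \<in> U" unfolding U using g(1,2) w(1) by (intro UN_I[of g]) auto
      then have "w \<noteq> p" using p by blast
      have "g mdvd m" using dvd g(1) by (simp add: mlcm_mdvd_iff[OF fin])
      then have "q \<in> W" "w \<in> W" using keys_W[of g] by (auto simp: w(1))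
      moreover have "reachable (with_proj G) x0 q"
        using \<open>p \<in> {x, y}\<close> rx ry pq(1) reachable_adj_trans by auto
      ultimately have "{x, y} \<inter> {q, w} \<noteq> {}" using dom w(2) by blast
      then have "w \<in> {x, y}" using \<open>q \<notin> {x, y}\<close> by blast
      then have "w = p'" using p'(1) \<open>w \<noteq> p\<close> by blast
      then show False using scf pq(1) w(2) p'(2) unfolding short_cycle_free_def by blast
    qed
    have "insert e \<sigma> \<in> ?\<Delta>"
    proof (cases "e \<in> \<sigma>")
      case True
      then show ?thesis using \<sigma> by (simp add: insert_absorb)
    next
      case False
      have "\<not> f mdvd mlcm (insert e \<sigma> - {f})" if f: "f \<in> gens 1" for f
      proof
        assume dvd_f: "f mdvd mlcm (insert e \<sigma> - {f})"
        show False
        proof (cases "f = e")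
          case True
          then have "insert e \<sigma> - {f} = \<sigma> - {f}" by blast
          then show False using dvd_f not[OF f] by simp
        next
          case False
          from f obtain p q where pq: "f = edge_mon p q" "adj p q" by (auto simp: edges_def)
          then have "p \<noteq> q" by auto
          define U where "U = (\<Union>g\<in>\<sigma> - {f}. Poly_Mapping.keys g)"
          have "insert e \<sigma> - {f} = insert e (\<sigma> - {f})" using False by blast
          then have cover: "{p, q} \<subseteq> {x, y} \<union> U"
            using dvd_f fin unfolding pq(1) edge_mon_mdvd_mlcm_iff[OF finite_Diff[OF finite.insertI[OF fin]] \<open>p \<noteq> q\<close>]
            by (simp add: U_def e_def pq(1))
          have "\<not> {p, q} \<subseteq> U"
            using not[OF f] fin unfolding pq(1) edge_mon_mdvd_mlcm_iff[OF finite_Diff[OF fin] \<open>p \<noteq> q\<close>]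
            by (simp add: U_def pq(1))
          then have "p \<notin> U \<or> q \<notin> U" by blast
          then show False
          proof
            assume "p \<notin> U"
            then show False using no[of p q U] pq False cover by (simp add: U_def)
          next
            assume "q \<notin> U"
            then show False
              using no[of q p U] pq False cover adj_sym by (simp add: U_def edge_mon_commute[of q p] insert_commute)
          qed
        qed
      qed
      then show ?thesis using sub e by (simp add: scarf_faces_def)
    qed
    moreover have "mlcm (insert e \<sigma>) mdvd m" using dvd e_dvd fin by (simp add: mlcm_mdvd_iff)
    ultimately show "insert e \<sigma> \<in> below ?\<Delta> m" by (simp add: below_def)
  qed
qed

section \<open>Powers for small connected graphs\<close>

lemma principal_resolved:
  assumes "0 < t" "gens t = {p}"
  shows "scarf_resolved TYPE('k::field) t"
proof (rule scarf_resolvedI[OF assms(1)])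
  fix m u assume u: "u \<in> gens t" "u mdvd m"
  have "antichain {p}" "0 \<notin> {p}"
    using antichain_gens[of t] zero_notin_gens[OF assms(1)] unfolding assms(2) by blast+
  then have "{p} \<in> scarf_faces {p}" using pair_scarf_face_iff[of "{p}" p p] by simp
  then have "insert p \<sigma> \<in> below (scarf_faces {p}) m" if "\<sigma> \<in> below (scarf_faces {p}) m" for \<sigma>
    using that u assms(2) by (auto simp: below_def scarf_faces_def subset_singleton_iff)
  then show "acyclic_complex TYPE('k) (gens t) (below (scarf_faces (gens t)) m)"
    unfolding assms(2) by (intro cone_acyclic[of _ _ p]) (auto simp: below_def scarf_faces_def)
qed

lemma isolated_vertex_resolved:
  assumes "is_isolated_vertex G" "0 < t"
  shows "scarf_resolved TYPE('k::field) t"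
proof (rule scarf_resolvedI[OF assms(2)])
  fix m u assume "u \<in> gens t"
  moreover have "edges = {}" using assms(1) by (auto simp: is_isolated_vertex_def edges_def)
  then have "gens t = {}" using assms(2) by (cases t) auto
  ultimately show "acyclic_complex TYPE('k) (gens t) (below (scarf_faces (gens t)) m)" by simp
qed

lemma edge_resolved:
  assumes "is_edge G" "0 < t"
  shows "scarf_resolved TYPE('k::field) t"
proof -
  obtain a b where ab: "a \<noteq> b" "pverts G = {a, b}" "parcs G = {(a, b), (b, a)}"
    using assms(1) by (auto simp: is_edge_def)
  have "edges = {edge_mon a b}" unfolding edges_def ab(3) by (auto simp: edge_mon_commute)
  then have "\<exists>p. gens t = {p}" by (induction t) auto
  then show ?thesis using principal_resolved[OF assms(2)] by blast
qed

text \<open>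
  The generators of \<open>b\<^sup>t (a, c)\<^sup>t\<close>.
\<close>

lemma path2_gens:
  assumes d: "distinct [a, b, c]" and G: "pverts G = {a, b, c}" "parcs G = {(a, b), (b, a), (b, c), (c, b)}"
  shows "gens t = (\<lambda>i. mono3 a b c i t (t - i)) ` {0..t}"
proof (intro equalityI subsetI)
  fix z assume z: "z \<in> gens t"
  have keys: "Poly_Mapping.keys z \<subseteq> {a, b, c}" using gens_keys[OF z] G(1) by simp
  have "(\<Sum>v\<in>{b}. Poly_Mapping.lookup z v) = t * 1"
    by (rule gens_weight[OF _ _ z keys]) (use G d in auto)
  moreover have "(\<Sum>v\<in>{a, c}. Poly_Mapping.lookup z v) = t * 1"
    by (rule gens_weight[OF _ _ z keys]) (use G d in auto)
  ultimately have "Poly_Mapping.lookup z b = t" "Poly_Mapping.lookup z a + Poly_Mapping.lookup z c = t"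
    using d by auto
  then have "Poly_Mapping.lookup z b = t" "Poly_Mapping.lookup z c = t - Poly_Mapping.lookup z a"
    "Poly_Mapping.lookup z a \<in> {0..t}" by auto
  then show "z \<in> (\<lambda>i. mono3 a b c i t (t - i)) ` {0..t}"
    using mono3_expand[OF d keys] by (intro image_eqI[of _ _ "Poly_Mapping.lookup z a"]) simp_all
next
  fix z assume "z \<in> (\<lambda>i. mono3 a b c i t (t - i)) ` {0..t}"
  then obtain i where i: "i \<le> t" "z = mono3 a b c i t (t - i)" by auto
  have "adj a b" "adj b c" using G by auto
  then have "(Poly_Mapping.single a i + Poly_Mapping.single b i) +
      (Poly_Mapping.single b (t - i) + Poly_Mapping.single c (t - i)) \<in> gens (i + (t - i))"
    by (intro mon_pow_add edge_power_in_gens)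
  moreover have "Poly_Mapping.single b t = Poly_Mapping.single b i + Poly_Mapping.single b (t - i)"
    using i(1) by (simp flip: single_add)
  ultimately show "z \<in> gens t" using i by (simp add: mono3_def add_ac)
qed

text \<open>
  The least common multiple of \<open>g i\<close> and \<open>g j\<close> is divisible by \<open>g k\<close> for all \<open>k\<close> between \<open>i\<close> and \<open>j\<close>, so
  Scarf faces consist of consecutive generators.  The generators dividing \<open>m\<close> form an interval.
\<close>

lemma path2_resolved:
  assumes "is_path2 G" and t: "0 < t"
  shows "scarf_resolved TYPE('k::field) t"
proof -
  obtain a b c where d: "distinct [a, b, c]" and G: "pverts G = {a, b, c}"
    "parcs G = {(a, b), (b, a), (b, c), (c, b)}"
    using assms(1) unfolding is_path2_def by blast
  define g where "g i = mono3 a b c i t (t - i)" for i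
  have gens: "gens t = g ` {0..t}" unfolding g_def by (rule path2_gens[OF d G])
  have inj: "inj g" by (rule injI) (simp add: g_def mono3_eq_iff[OF d])
  have g_dvd: "g k mdvd mlcm {g i, g j} \<longleftrightarrow> k \<le> max i j \<and> t - k \<le> t - min i j" for i j k
    by (simp add: g_def mlcm_mono3[OF d] mono3_mdvd_iff[OF d]) linarith
  have faces: "scarf_faces (gens t) = {\<sigma>. \<sigma> \<subseteq> g ` {0..t} \<and> (\<exists>i. \<sigma> \<subseteq> {g i, g (Suc i)})}"
  proof (intro equalityI subsetI)
    fix \<sigma> assume \<sigma>: "\<sigma> \<in> scarf_faces (gens t)"
    then have sub: "\<sigma> \<subseteq> g ` {0..t}" by (simp add: scarf_faces_def gens)
    define J where "J = {i. i \<le> t \<and> g i \<in> \<sigma>}"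
    have \<sigma>_J: "\<sigma> = g ` J" using sub by (auto simp: J_def)
    have "\<exists>i. \<sigma> \<subseteq> {g i, g (Suc i)}"
    proof (cases "J = {}")
      case True
      then show ?thesis using \<sigma>_J by simp
    next
      case False
      have finJ: "finite J" by (simp add: J_def)
      define i j where "i = Min J" and "j = Max J"
      have ij: "i \<in> J" "j \<in> J" using Min_in[OF finJ False] Max_in[OF finJ False] by (simp_all add: i_def j_def)
      have J_sub: "J \<subseteq> {i..j}" using finJ by (auto simp: i_def j_def)
      have "j \<le> Suc i"
      proof (rule ccontr)
        assume "\<not> j \<le> Suc i"
        then have lt: "Suc i < j" by simp
        have jt: "j \<le> t" using ij(2) by (simp add: J_def)
        have "\<sigma> \<notin> scarf_faces (gens t)"
        proof (rule not_scarf_face[OF finite_gens, of "{g i, g j}" _ "g (Suc i)"])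
          show "{g i, g j} \<subseteq> \<sigma>" using ij by (simp add: J_def)
          show "g (Suc i) \<in> gens t" using lt jt by (simp add: gens)
          show "g (Suc i) mdvd mlcm {g i, g j}" using lt by (simp add: g_dvd)
          show "g (Suc i) \<notin> {g i, g j}" using lt inj by (simp add: inj_eq)
        qed
        then show False using \<sigma> by blast
      qed
      then have "J \<subseteq> {i, Suc i}" using J_sub by auto
      then show ?thesis unfolding \<sigma>_J by blast
    qed
    then show "\<sigma> \<in> {\<sigma>. \<sigma> \<subseteq> g ` {0..t} \<and> (\<exists>i. \<sigma> \<subseteq> {g i, g (Suc i)})}" using sub by blast
  next
    fix \<sigma> assume "\<sigma> \<in> {\<sigma>. \<sigma> \<subseteq> g ` {0..t} \<and> (\<exists>i. \<sigma> \<subseteq> {g i, g (Suc i)})}"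
    then obtain i where sub: "\<sigma> \<subseteq> g ` {0..t}" and i: "\<sigma> \<subseteq> {g i, g (Suc i)}" by blast
    have edge: "{g i, g j} \<in> scarf_faces (gens t)" if "i \<le> t" "j \<le> t" "j = i \<or> j = Suc i" for i j
    proof -
      have "g k = g i \<or> g k = g j" if "k \<le> t" "g k mdvd mlcm {g i, g j}" for k
      proof -
        have "i \<le> k" "k \<le> j" using that \<open>i \<le> t\<close> \<open>j \<le> t\<close> \<open>j = i \<or> j = Suc i\<close> by (auto simp: g_dvd)
        then have "k = i \<or> k = j" using \<open>j = i \<or> j = Suc i\<close> by auto
        then show ?thesis by blast
      qed
      then show ?thesis
        using pair_scarf_face_iff[OF antichain_gens zero_notin_gens[OF t], of "g i" "g j"] that(1,2)
        by (auto simp: gens)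
    qed
    show "\<sigma> \<in> scarf_faces (gens t)"
    proof (cases "\<sigma> = {}")
      case True
      then show ?thesis using empty_scarf_face[OF zero_notin_gens[OF t]] by simp
    next
      case False
      have it: "i \<le> t"
      proof (rule ccontr)
        assume "\<not> i \<le> t"
        then have "g i \<notin> g ` {0..t}" "g (Suc i) \<notin> g ` {0..t}" using inj by (auto simp: inj_eq)
        then show False using sub i False by blast
      qed
      show ?thesis
      proof (cases "Suc i \<le> t")
        case True
        show ?thesis by (rule scarf_faces_closed[OF finite_gens edge[of i "Suc i"] i]) (use it True in auto)
      next
        case False
        then have "g (Suc i) \<notin> g ` {0..t}" using inj by (auto simp: inj_eq)
        then have i': "\<sigma> \<subseteq> {g i, g i}" using sub i by blast
        show ?thesis by (rule scarf_faces_closed[OF finite_gens edge[of i i] i']) (use it in auto)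
      qed
    qed
  qed
  show ?thesis
  proof (rule scarf_resolvedI[OF t])
    fix m u assume u: "u \<in> gens t" "u mdvd m"
    then obtain k where k: "k \<le> t" "g k mdvd m" using gens by auto
    \<comment> \<open>In multidegree \<open>m\<close> the exponent \<open>i\<close> of \<open>a\<close> is bounded above by the exponent of \<open>a\<close> in \<open>m\<close>, and
      below because the exponent \<open>t - i\<close> of \<open>c\<close> is bounded above.\<close>
    define lo hi where "lo = t - Poly_Mapping.lookup m c" and "hi = min t (Poly_Mapping.lookup m a)"
    have dvd: "g i mdvd m \<longleftrightarrow> i \<le> Poly_Mapping.lookup m a \<and> t \<le> Poly_Mapping.lookup m b \<and> t - i \<le> Poly_Mapping.lookup m c" for i
    proof
      assume "g i mdvd m"
      then have "\<And>v. Poly_Mapping.lookup (g i) v \<le> Poly_Mapping.lookup m v" by (simp add: mdvd_def)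
      from this[of a] this[of b] this[of c]
      show "i \<le> Poly_Mapping.lookup m a \<and> t \<le> Poly_Mapping.lookup m b \<and> t - i \<le> Poly_Mapping.lookup m c"
        using d by (auto simp: g_def lookup_mono3[OF d])
    qed (simp add: mdvd_def g_def lookup_mono3[OF d])
    have dvd': "g i mdvd m \<longleftrightarrow> i \<in> {lo..hi}" if "i \<le> t" for i
      using k that by (auto simp: dvd lo_def hi_def)
    have "lo \<le> hi" using k dvd'[OF k(1)] by auto
    have hi: "hi \<le> t" by (simp add: hi_def)
    have "below (scarf_faces (gens t)) m = {\<sigma>. \<sigma> \<subseteq> g ` {lo..hi} \<and> (\<exists>i. \<sigma> \<subseteq> {g i, g (Suc i)})}"
    proof -
      have "\<sigma> \<subseteq> g ` {0..t} \<and> mlcm \<sigma> mdvd m \<longleftrightarrow> \<sigma> \<subseteq> g ` {lo..hi}" for \<sigma>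
      proof
        assume *: "\<sigma> \<subseteq> g ` {0..t} \<and> mlcm \<sigma> mdvd m"
        then have "finite \<sigma>" by (meson finite_atLeastAtMost finite_imageI finite_subset)
        then have "\<forall>u\<in>\<sigma>. u mdvd m" using * by (simp add: mlcm_mdvd_iff)
        then show "\<sigma> \<subseteq> g ` {lo..hi}" using * dvd' by fastforce
      next
        assume *: "\<sigma> \<subseteq> g ` {lo..hi}"
        then have "finite \<sigma>" by (meson finite_atLeastAtMost finite_imageI finite_subset)
        moreover have "\<forall>u\<in>\<sigma>. u mdvd m" using * dvd' hi by fastforce
        moreover have "\<sigma> \<subseteq> g ` {0..t}" using * hi by fastforce
        ultimately show "\<sigma> \<subseteq> g ` {0..t} \<and> mlcm \<sigma> mdvd m" by (simp add: mlcm_mdvd_iff)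
      qed
      then show ?thesis unfolding below_def faces by blast
    qed
    moreover have "g ` {lo..hi} \<subseteq> gens t" using hi by (auto simp: gens)
    ultimately show "acyclic_complex TYPE('k) (gens t) (below (scarf_faces (gens t)) m)"
      using path_complex_acyclic[OF finite_gens inj \<open>lo \<le> hi\<close>] by metis
  qed
qed

lemma connected_closed_eq:
  assumes con: "connected (with_proj G)" and "x \<in> S" "x \<in> pverts G"
    and closed: "\<And>u v. u \<in> S \<Longrightarrow> adj u v \<Longrightarrow> v \<in> S"
  shows "pverts G \<subseteq> S"
proof
  fix y assume "y \<in> pverts G"
  have "strongly_connected (with_proj G)"
    using symmetric_connected_imp_strongly_connected[OF pair_sym_arcs con] .
  then have "reachable (with_proj G) x y"
    using assms(3) \<open>y \<in> pverts G\<close> by (auto simp: strongly_connected_def)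
  then show "y \<in> S"
    by (induction rule: reachable_induct) (use assms(2) closed in auto)
qed

text \<open>
  A longest path has at most two edges, and its vertex set is closed under adjacency: an edge leaving
  it would create a claw or a longer path.
\<close>

lemma connected_claw_path_free:
  assumes con: "connected (with_proj G)"
    and tri: "\<And>a b c. adj a b \<Longrightarrow> adj b c \<Longrightarrow> \<not> adj c a"
    and claw: "\<And>x a b c. distinct [a, b, c] \<Longrightarrow> adj x a \<Longrightarrow> adj x b \<Longrightarrow> \<not> adj x c"
    and path: "\<And>a b c d. distinct [a, b, c, d] \<Longrightarrow> adj a b \<Longrightarrow> adj b c \<Longrightarrow> \<not> adj c d"
  shows "is_isolated_vertex G \<or> is_edge G \<or> is_path2 G"
proof -
  have "pverts G \<noteq> {}" using con by (auto simp: connected_def strongly_connected_def)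
  then obtain x0 where x0: "x0 \<in> pverts G" by blast
  show ?thesis
  proof (cases "\<exists>x y z. adj x y \<and> adj y z \<and> x \<noteq> z")
    case True
    then obtain x y z where xyz: "adj x y" "adj y z" "x \<noteq> z" by blast
    have yx: "adj y x" "adj z y" using xyz adj_sym by blast+
    have nxz: "\<not> adj x z" "\<not> adj z x" using tri xyz yx adj_sym by blast+
    have ne: "x \<noteq> y" "y \<noteq> z" using xyz by auto
    have nx: "v = y" if v: "adj x v" for v
    proof (rule ccontr)
      assume "v \<noteq> y"
      moreover have "v \<noteq> x" "v \<noteq> z" using v nxz by auto
      ultimately have "distinct [v, x, y, z]" using ne xyz(3) by auto
      then show False using path adj_sym[OF v] xyz by blast
    qed
    have nz: "v = y" if v: "adj z v" for v
    proof (rule ccontr)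
      assume "v \<noteq> y"
      moreover have "v \<noteq> z" "v \<noteq> x" using v nxz by auto
      ultimately have "distinct [v, z, y, x]" using ne xyz(3) by auto
      then show False using path adj_sym[OF v] yx by blast
    qed
    have ny: "v = x \<or> v = z" if "adj y v" for v
      using claw[of x z v y] that xyz yx by auto
    have "pverts G \<subseteq> {x, y, z}"
    proof (rule connected_closed_eq[OF con, of y])
      show "y \<in> pverts G" using xyz(2) by (rule in_arcsD1)
      show "v \<in> {x, y, z}" if "u \<in> {x, y, z}" "adj u v" for u v using that nx ny nz by blast
    qed simp
    then have V: "pverts G = {x, y, z}" using xyz in_arcsD1 in_arcsD2 by blast
    have arcs: "adj u v \<longleftrightarrow> (u, v) \<in> {(x, y), (y, x), (y, z), (z, y)}" for u v
    proof
      assume uv: "adj u v"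
      then have "u \<in> {x, y, z}" using in_arcsD1 V by blast
      then show "(u, v) \<in> {(x, y), (y, x), (y, z), (z, y)}" using uv nx ny nz by blast
    qed (use xyz yx in auto)
    have "parcs G = {(x, y), (y, x), (y, z), (z, y)}"
      by (rule Set.set_eqI) (simp only: split_paired_all arcs)
    moreover have "distinct [x, y, z]" using ne xyz(3) by simp
    ultimately have "is_path2 G" unfolding is_path2_def using V by (intro exI conjI)
    then show ?thesis by blast
  next
    case no_path: False
    show ?thesis
    proof (cases "\<exists>a b. adj a b")
      case True
      then obtain a b where ab: "adj a b" by blast
      have na: "v = b" if "adj a v" for v using no_path that adj_sym[OF ab] by blast
      have nb: "v = a" if "adj b v" for v using no_path that ab by blast
      have "pverts G \<subseteq> {a, b}"
      proof (rule connected_closed_eq[OF con, of a])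
        show "a \<in> pverts G" using ab by (rule in_arcsD1)
        show "v \<in> {a, b}" if "u \<in> {a, b}" "adj u v" for u v using that na nb by blast
      qed simp
      then have V: "pverts G = {a, b}" using ab in_arcsD1 in_arcsD2 by blast
      have arcs: "adj u v \<longleftrightarrow> (u, v) \<in> {(a, b), (b, a)}" for u v
      proof
        assume uv: "adj u v"
        then have "u \<in> {a, b}" using in_arcsD1 V by blast
        then show "(u, v) \<in> {(a, b), (b, a)}" using uv na nb by blast
      qed (use ab adj_sym in auto)
      have "parcs G = {(a, b), (b, a)}"
      by (rule Set.set_eqI) (simp only: split_paired_all arcs)
      moreover have "a \<noteq> b" using ab by auto
      ultimately have "is_edge G" unfolding is_edge_def using V by blast
      then show ?thesis by blast
    next
      case False
      have "pverts G \<subseteq> {x0}"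
        by (rule connected_closed_eq[OF con, of x0]) (use False x0 in auto)
      then have "pverts G = {x0}" using x0 by blast
      moreover have "parcs G = {}" using False by auto
      ultimately have "is_isolated_vertex G" unfolding is_isolated_vertex_def by blast
      then show ?thesis by blast
    qed
  qed
qed

section \<open>The classification\<close>

lemma scarf_resolved_one_iff:
  "scarf_resolved TYPE('k::field) 1 \<longleftrightarrow> gap_free G \<and> undirected_forest G"
  using resolved_gap_free resolved_short_cycle_free gap_free_forest forest_short_cycle_free
    gap_free_forest_resolved by blast

lemma scarf_resolved_power_iff:
  assumes con: "connected (with_proj G)" and t: "1 < t"
  shows "scarf_resolved TYPE('k::field) t \<longleftrightarrow> is_isolated_vertex G \<or> is_edge G \<or> is_path2 G"
proof
  assume res: "scarf_resolved TYPE('k) t"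
  have t': "0 < t" "2 \<le> t" using t by simp_all
  show "is_isolated_vertex G \<or> is_edge G \<or> is_path2 G"
  proof (rule connected_claw_path_free[OF con])
    show "\<not> adj c a" if "adj a b" "adj b c" for a b c
      using triangle_obstruction[OF res t'(1)] that by blast
    show "\<not> adj x c" if "distinct [a, b, c]" "adj x a" "adj x b" for x a b c
      using claw_obstruction[OF res t'(2)] that by blast
    show "\<not> adj c d" if "distinct [a, b, c, d]" "adj a b" "adj b c" for a b c d
      using square_or_path_obstruction[OF res t'(1)] t'(2) that by blast
  qed
next
  assume "is_isolated_vertex G \<or> is_edge G \<or> is_path2 G"
  then show "scarf_resolved TYPE('k) t"
    using isolated_vertex_resolved edge_resolved path2_resolved t by (metis less_trans zero_less_one)
qed

end

theorem theorem8p3: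
  fixes G :: "'v::linorder pair_pre_digraph"
    and I :: "('v, 'k::field) mpoly set"
  assumes "pair_graph G"
    and "I = edge_ideal G"
  shows "(supports_minimal_free_resolution (pverts G) (scarf (pverts G) I) I
            \<longleftrightarrow> gap_free G \<and> undirected_forest G) \<and>
         (connected (with_proj G) \<longrightarrow>
            (\<forall>t::nat. t > 1 \<longrightarrow>
               (supports_minimal_free_resolution (pverts G)
                    (scarf (pverts G) (ideal_power (pverts G) I t)) (ideal_power (pverts G) I t)
                  \<longleftrightarrow> is_isolated_vertex G \<or> is_edge G \<or> is_path2 G)))"
proof -
  interpret edge_ideal_graph G using assms(1) by (simp add: edge_ideal_graph_def)
  have I: "I = pow_ideal TYPE('k) 1" unfolding assms(2) by (rule edge_ideal_eq)
  have "ideal_power (pverts G) I t = pow_ideal TYPE('k) t" for t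
    unfolding I by (rule ideal_power_eq)
  then show ?thesis
    using supports_scarf_pow_iff[of "TYPE('k)"] scarf_resolved_one_iff[where 'k='k] scarf_resolved_power_iff[where 'k='k]
    by (simp add: I)
qed

end
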